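(* Let $\sigma\colon S\curvearrowright A$ and $\tau\colon T\curvearrowright B$ be algebraic actions satisfying the standing assumptions, with globalizations $\tilde\sigma\colon\mathscr S\curvearrowright\mathscr A$, $\tilde\tau\colon\mathscr T\curvearrowright\mathscr B$, and suppose $\mathscr A$ and $\mathscr B$ are torsion-free. Let $\mathfrak c\colon(\mathscr A\rtimes\mathscr S)\ltimes\overline A\to\mathscr B\rtimes\mathscr T$ be a continuous groupoid homomorphism such that $\mathfrak c^{-1}(0,1)$ equals the unit space $\{(1,x):x\in\overline A\}$. (i) If condition (I) holds, then there exist injective homomorphisms $\mathfrak t\colon\mathscr S\to\mathscr T$ and $\dot{\mathfrak b}\colon\mathbb Q\otimes\mathscr A\to\mathbb Q\otimes\mathscr B$ with $\dot{\mathfrak b}(\dot\sigma_s(x))=\dot\tau_{\mathfrak t(s)}(\dot{\mathfrak b}(x))$ for all $s\in\mathscr S$ and $x\in\mathbb Q\otimes\mathscr A$. (ii) If condition ($*$) holds, then there exist injective homomorphisms $\mathfrak t\colon\mathscr S\to\mathscr T$ and $\mathfrak b'\colon S^{-1}A\to T^{-1}B$ with $\mathfrak b'(\tilde\sigma_s(x))=\tilde\tau_{\mathfrak t(s)}(\mathfrak b'(x))$ for all $x\in S^{-1}A$ and $s\in\mathscr S$.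
   Context: Algebraic action $\sigma\colon S\curvearrowright A$: left cancellative monoid $S$, abelian group $A$, monoid homomorphism $s\mapsto\sigma_s$ into injective endomorphisms of $A$. Constructible subgroups $\mathcal C$: smallest family of subgroups of $A$ containing $A$, closed under $C\mapsto\sigma_s(C)$ and $C\mapsto\sigma_s^{-1}C=\{a:\sigma_s(a)\in C\}$. Standing assumptions: faithful, non-automorphic unless $S$ is a group, (FI) $[A:\sigma_s(A)]<\infty$ for all $s$ (so $\overline A=\varprojlim_{C\in\mathcal C}A/C$ is compact), and a globalization: group $\mathscr S\supseteq S$ generated by $S$, abelian $\mathscr A\supseteq A$ generated by $\bigcup_g\tilde\sigma_g(A)$, action $\tilde\sigma$ of $\mathscr S$ on $\mathscr A$ by automorphisms extending $\sigma$, satisfying (JF): if $\tilde\sigma_g$ fixes some $C\in\mathcal C$ pointwise then $g=1$. $\mathscr A\rtimes\mathscr S$ acts on $\mathscr A$ by $(z,\gamma).x=z+\tilde\sigma_\gamma(x)$; the restricted partial action on $A$ extends uniquely to a partial action on $\overline A$ by homeomorphisms between open sets, with partial transformation groupoid $(\mathscr A\rtimes\mathscr S)\ltimes\overline A$; groups $\mathscr A\rtimes\mathscr S$, $\mathscr B\rtimes\mathscr T$ are discrete. Same notation for $\tau$. $\dot\sigma_g={\rm id}_{\mathbb Q}\otimes\tilde\sigma_g$, $\dot\tau_t={\rm id}_{\mathbb Q}\otimes\tilde\tau_t$. Finite rank: $\mathbb Q\otimes$ the group is finite-dimensional. For a finite rank subgroup $\mathcal A'\subseteq A$: (i$_1$)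 some $s\in S$ has $\sigma_s(\mathcal A')\subseteq\mathcal A'$, ${\rm id}-\sigma_s$ injective on $\mathcal A'$, and every two-generated subgroup of $\mathscr T$ is free or abelian; (i$_2$) some $s\in S$ has $\sigma_s=\kappa\,{\rm id}_A$ with $\kappa\in\mathbb Z\setminus\{0,1\}$ and every $\alpha\in\mathscr T$ conjugate to $\alpha^\kappa$ has finite order; (ii$_1$) for every order $l>1$ of a torsion element of $\mathscr T$ there are $1\neq s_l\in S$ and coprime positive integers $\mu,\nu$ with $\sigma_{s_l}(\mathcal A')\subseteq\mathcal A'$, $\mu\det(z-{\rm id}_{\mathbb Q}\otimes\sigma_{s_l}|_{\mathcal A'})=\mu z^\delta-\nu$ for some $\delta$, and $\gcd(l,\mu)>1$ or $\gcd(l,\nu)>1$; (ii$_2$) (F) for $\tilde\tau$: ${\rm id}-\tilde\tau_t$ injective on $\mathscr B$ for all $1\ne t\in\mathscr T$. (I): $A=\bigcup_n\mathcal A_n$ for increasing finite rank subgroups, and (i$_1$) holds for all $\mathcal A_n$ or (i$_2$) holds. (II): (ii$_1$) holds for all $\mathcal A_n$, or (ii$_2$) holds and $A$ is torsion-free. (III): some $s\in S$ has $\sigma_s=\kappa\,{\rm id}_A$, $\kappa\in\mathbb Z\setminus\{0,1\}$, $\mathscr B$ has finite rank and (F) holds for $\tilde\tau$. ($*$): $A=\bigcup_n\mathcal A_n$ for increasing finite rank subgroups and ((I) and (II)) or (III) holds; there are increasing finitely generated $\mathfrak A_k$ with $A=\bigcup_k\mathfrak A_k$ and $\sigma_s(\mathfrak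 A_k)\subseteq\mathfrak A_k$ for all $s,k$; $Ss\cap St\ne\emptyset$ for all $s,t\in S$ and likewise for $T$; $\mathscr S=S^{-1}S$, $\mathscr A=S^{-1}A=\bigcup_{s\in S}\tilde\sigma_s^{-1}(A)$, $\mathscr T=T^{-1}T$, $\mathscr B=T^{-1}B=\bigcup_{t\in T}\tilde\tau_t^{-1}(B)$; and (PC): for every $C\in\mathcal C$ there is $s\in S$ with $\sigma_s(A)\subseteq C$. *)

theory Defs
  imports "Jordan_Normal_Form.Char_Poly"
begin

(* Conventions.  Groups (possibly non-abelian, e.g. the globalising       *)
(* groups of the monoids S, T) are types of class group_add, so the group *)
(* operation is written +, the neutral element 0 and inverses -x.         *)

definition zmul :: "int \<Rightarrow> 'a::group_add \<Rightarrow> 'a" where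
  "zmul k x = (if 0 \<le> k then ((+) x ^^ nat k) 0 else - (((+) x ^^ nat (- k)) 0))"

definition has_order :: "'a::group_add \<Rightarrow> nat \<Rightarrow> bool" where
  "has_order x l \<longleftrightarrow> 0 < l \<and> zmul (int l) x = 0 \<and> (\<forall>k. 0 < k \<and> k < l \<longrightarrow> zmul (int k) x \<noteq> 0)"

definition finite_order :: "'a::group_add \<Rightarrow> bool" where
  "finite_order x \<longleftrightarrow> (\<exists>n::nat. 0 < n \<and> zmul (int n) x = 0)"

definition torsion_free_set :: "'a::group_add set \<Rightarrow> bool" where
  "torsion_free_set X \<longleftrightarrow> (\<forall>x\<in>X. \<forall>k::int. 0 < k \<and> zmul k x = 0 \<longrightarrow> x = 0)"

definition is_subgroup :: "'a::group_add set \<Rightarrow> bool" where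
  "is_subgroup H \<longleftrightarrow> 0 \<in> H \<and> (\<forall>x\<in>H. \<forall>y\<in>H. x + y \<in> H) \<and> (\<forall>x\<in>H. - x \<in> H)"

definition gen_subgroup :: "'a::group_add set \<Rightarrow> 'a set" where
  "gen_subgroup X = \<Inter>{H. is_subgroup H \<and> X \<subseteq> H}"

definition is_submonoid :: "'a::group_add set \<Rightarrow> bool" where
  "is_submonoid M \<longleftrightarrow> 0 \<in> M \<and> (\<forall>x\<in>M. \<forall>y\<in>M. x + y \<in> M)"

definition is_group_hom :: "('a::group_add \<Rightarrow> 'b::group_add) \<Rightarrow> bool" where
  "is_group_hom f \<longleftrightarrow> (\<forall>x y. f (x + y) = f x + f y)"

definition finite_index :: "'a::ab_group_add set \<Rightarrow> 'a set \<Rightarrow> bool" where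
  "finite_index H K \<longleftrightarrow> finite ((\<lambda>a. (+) a ` K) ` H)"

definition is_abelian_set :: "'a::group_add set \<Rightarrow> bool" where
  "is_abelian_set H \<longleftrightarrow> (\<forall>x\<in>H. \<forall>y\<in>H. x + y = y + x)"

fun word_eval :: "('a::group_add \<times> bool) list \<Rightarrow> 'a" where
  "word_eval [] = 0"
| "word_eval ((x, e) # w) = (if e then x else - x) + word_eval w"

fun reduced_word :: "('a \<times> bool) list \<Rightarrow> bool" where
  "reduced_word ((x, e) # (y, f) # w) = (\<not> (x = y \<and> e \<noteq> f) \<and> reduced_word ((y, f) # w))"
| "reduced_word _ = True"

definition free_on :: "'a::group_add set \<Rightarrow> 'a set \<Rightarrow> bool" where
  "free_on X H \<longleftrightarrow> gen_subgroup X = H \<and>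
     (\<forall>w. w \<noteq> [] \<and> fst ` set w \<subseteq> X \<and> reduced_word w \<longrightarrow> word_eval w \<noteq> 0)"

definition is_free_group :: "'a::group_add set \<Rightarrow> bool" where
  "is_free_group H \<longleftrightarrow> (\<exists>X. free_on X H)"

subsection \<open>Q tensor an abelian group: the localisation (Z\{0})^{-1} H,
  i.e. pairs (a, m), m > 0, read as a/m, modulo (a,m) ~ (b,n) iff k(na - mb) = 0 for some k > 0\<close>

definition qrel :: "'a::ab_group_add set \<Rightarrow> 'a \<times> int \<Rightarrow> 'a \<times> int \<Rightarrow> bool" where
  "qrel H p q \<longleftrightarrow> (case p of (a, m) \<Rightarrow> case q of (b, n) \<Rightarrow>
      a \<in> H \<and> b \<in> H \<and> 0 < m \<and> 0 < n \<and> (\<exists>k>0. zmul k (zmul n a - zmul m b) = 0))"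

definition qcls :: "'a::ab_group_add set \<Rightarrow> 'a \<times> int \<Rightarrow> ('a \<times> int) set" where
  "qcls H p = {q. qrel H p q}"

definition QT :: "'a::ab_group_add set \<Rightarrow> ('a \<times> int) set set" where
  "QT H = {qcls H (a, m) | a m. a \<in> H \<and> 0 < m}"

definition qrep :: "('a \<times> int) set \<Rightarrow> 'a \<times> int" where
  "qrep x = (SOME p. p \<in> x)"

definition qzero :: "'a::ab_group_add set \<Rightarrow> ('a \<times> int) set" where
  "qzero H = qcls H (0, 1)"

definition qadd :: "'a::ab_group_add set \<Rightarrow> ('a \<times> int) set \<Rightarrow> ('a \<times> int) set \<Rightarrow> ('a \<times> int) set" where
  "qadd H x y = (case qrep x of (a, m) \<Rightarrow> case qrep y of (b, n) \<Rightarrow>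
      qcls H (zmul n a + zmul m b, m * n))"

definition qsmul :: "'a::ab_group_add set \<Rightarrow> rat \<Rightarrow> ('a \<times> int) set \<Rightarrow> ('a \<times> int) set" where
  "qsmul H r x = (case quotient_of r of (p, q) \<Rightarrow> case qrep x of (a, m) \<Rightarrow>
      qcls H (zmul p a, q * m))"

definition qmap :: "'a::ab_group_add set \<Rightarrow> ('a \<Rightarrow> 'a) \<Rightarrow> ('a \<times> int) set \<Rightarrow> ('a \<times> int) set" where
  "qmap H f x = (case qrep x of (a, m) \<Rightarrow> qcls H (f a, m))"

definition lincomb :: "'a::ab_group_add set \<Rightarrow> rat list \<Rightarrow> ('a \<times> int) set list \<Rightarrow> ('a \<times> int) set" where
  "lincomb H rs vs = foldr (\<lambda>(r, v) acc. qadd H (qsmul H r v) acc) (zip rs vs) (qzero H)"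

definition q_spans :: "'a::ab_group_add set \<Rightarrow> ('a \<times> int) set list \<Rightarrow> bool" where
  "q_spans H vs \<longleftrightarrow> set vs \<subseteq> QT H \<and>
     (\<forall>x\<in>QT H. \<exists>rs. length rs = length vs \<and> lincomb H rs vs = x)"

definition q_basis :: "'a::ab_group_add set \<Rightarrow> ('a \<times> int) set list \<Rightarrow> bool" where
  "q_basis H vs \<longleftrightarrow> q_spans H vs \<and>
     (\<forall>rs. length rs = length vs \<and> lincomb H rs vs = qzero H \<longrightarrow> set rs \<subseteq> {0})"

definition finite_rank :: "'a::ab_group_add set \<Rightarrow> bool" where
  "finite_rank H \<longleftrightarrow> (\<exists>vs. q_spans H vs)"

text \<open>P = det(z - id_Q (x) f|_H), computed as char_poly of the matrix of
  id_Q (x) f|_H in some Q-basis of Q (x) H (independent of the basis)\<close>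
definition is_charpoly :: "'a::ab_group_add set \<Rightarrow> ('a \<Rightarrow> 'a) \<Rightarrow> rat poly \<Rightarrow> bool" where
  "is_charpoly H f P \<longleftrightarrow> (\<exists>vs M. q_basis H vs \<and> M \<in> carrier_mat (length vs) (length vs) \<and>
      (\<forall>j<length vs. qmap H f (vs ! j) = lincomb H (map (\<lambda>i. M $$ (i, j)) [0..<length vs]) vs) \<and>
      P = char_poly M)"

text \<open>S \<subseteq> 'g (the group \<SS>), A \<subseteq> 'a (the group \<AA>), \<sigma> the action of \<SS> on \<AA>
  by automorphisms; \<sigma>_s for s \<in> S is the restriction of \<sigma> s to A.\<close>

inductive_set constructible :: "'g::group_add set \<Rightarrow> 'a::ab_group_add set \<Rightarrow> ('g \<Rightarrow> 'a \<Rightarrow> 'a) \<Rightarrow> 'a set set"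
  for S A \<sigma> where
  top: "A \<in> constructible S A \<sigma>"
| img: "C \<in> constructible S A \<sigma> \<Longrightarrow> s \<in> S \<Longrightarrow> \<sigma> s ` C \<in> constructible S A \<sigma>"
| pre: "C \<in> constructible S A \<sigma> \<Longrightarrow> s \<in> S \<Longrightarrow> {a \<in> A. \<sigma> s a \<in> C} \<in> constructible S A \<sigma>"

definition std_alg_action :: "'g::group_add set \<Rightarrow> 'a::ab_group_add set \<Rightarrow> ('g \<Rightarrow> 'a \<Rightarrow> 'a) \<Rightarrow> bool" where
  "std_alg_action S A \<sigma> \<longleftrightarrow>
     is_submonoid S \<and> is_subgroup A \<and>
     \<comment> \<open>globalisation: action of the group by automorphisms\<close>
     \<sigma> 0 = id \<and> (\<forall>g h. \<sigma> (g + h) = \<sigma> g \<circ> \<sigma> h) \<and> (\<forall>g x y. \<sigma> g (x + y) = \<sigma> g x + \<sigma> g y) \<and>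
     gen_subgroup S = UNIV \<and> gen_subgroup (\<Union>g. \<sigma> g ` A) = UNIV \<and>
     \<comment> \<open>\<sigma> restricts to injective endomorphisms \<sigma>_s of A, s \<in> S\<close>
     (\<forall>s\<in>S. \<sigma> s ` A \<subseteq> A) \<and>
     \<comment> \<open>faithful\<close>
     (\<forall>s\<in>S. \<forall>t\<in>S. (\<forall>a\<in>A. \<sigma> s a = \<sigma> t a) \<longrightarrow> s = t) \<and>
     \<comment> \<open>non-automorphic unless S is a group\<close>
     ((\<forall>s\<in>S. - s \<in> S) \<or> (\<exists>s\<in>S. \<sigma> s ` A \<noteq> A)) \<and>
     \<comment> \<open>(FI)\<close>
     (\<forall>s\<in>S. finite_index A (\<sigma> s ` A)) \<and>
     \<comment> \<open>(JF)\<close>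
     (\<forall>g. \<forall>C\<in>constructible S A \<sigma>. (\<forall>c\<in>C. \<sigma> g c = c) \<longrightarrow> g = 0)"

text \<open>A point of \<overline>A is a compatible family x, x C a coset of C in A for C \<in> \<C>
  (normalised to {} off \<C>).\<close>
definition Abar :: "'g::group_add set \<Rightarrow> 'a::ab_group_add set \<Rightarrow> ('g \<Rightarrow> 'a \<Rightarrow> 'a) \<Rightarrow> ('a set \<Rightarrow> 'a set) set" where
  "Abar S A \<sigma> = {x. (\<forall>C\<in>constructible S A \<sigma>. \<exists>a\<in>A. x C = (+) a ` C) \<and>
      (\<forall>C. C \<notin> constructible S A \<sigma> \<longrightarrow> x C = {}) \<and>
      (\<forall>C\<in>constructible S A \<sigma>. \<forall>D\<in>constructible S A \<sigma>. C \<subseteq> D \<longrightarrow> x C \<subseteq> x D)}"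

definition Aemb :: "'g::group_add set \<Rightarrow> 'a::ab_group_add set \<Rightarrow> ('g \<Rightarrow> 'a \<Rightarrow> 'a) \<Rightarrow> 'a \<Rightarrow> ('a set \<Rightarrow> 'a set)" where
  "Aemb S A \<sigma> a = (\<lambda>C. if C \<in> constructible S A \<sigma> then (+) a ` C else {})"

text \<open>x and y agree on the finitely many coordinates F (basic neighbourhoods of
  the product topology of the discrete spaces A/C)\<close>
definition agree_on :: "'a set set \<Rightarrow> ('a set \<Rightarrow> 'a set) \<Rightarrow> ('a set \<Rightarrow> 'a set) \<Rightarrow> bool" where
  "agree_on F x y \<longleftrightarrow> (\<forall>C\<in>F. x C = y C)"

definition in_closure :: "'g::group_add set \<Rightarrow> 'a::ab_group_add set \<Rightarrow> ('g \<Rightarrow> 'a \<Rightarrow> 'a) \<Rightarrow> 'a set \<Rightarrow> ('a set \<Rightarrow> 'a set) \<Rightarrow> bool" where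
  "in_closure S A \<sigma> X x \<longleftrightarrow> (\<forall>F. finite F \<and> F \<subseteq> constructible S A \<sigma> \<longrightarrow>
      (\<exists>a\<in>X. agree_on F (Aemb S A \<sigma> a) x))"

definition sd_mult :: "('g::group_add \<Rightarrow> 'a::ab_group_add \<Rightarrow> 'a) \<Rightarrow> 'a \<times> 'g \<Rightarrow> 'a \<times> 'g \<Rightarrow> 'a \<times> 'g" where
  "sd_mult \<sigma> p q = (case p of (z, g) \<Rightarrow> case q of (w, h) \<Rightarrow> (z + \<sigma> g w, g + h))"

definition sd_act :: "('g::group_add \<Rightarrow> 'a::ab_group_add \<Rightarrow> 'a) \<Rightarrow> 'a \<times> 'g \<Rightarrow> 'a \<Rightarrow> 'a" where
  "sd_act \<sigma> p x = (case p of (z, g) \<Rightarrow> z + \<sigma> g x)"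

definition dom_A :: "'a::ab_group_add set \<Rightarrow> ('g::group_add \<Rightarrow> 'a \<Rightarrow> 'a) \<Rightarrow> 'a \<times> 'g \<Rightarrow> 'a set" where
  "dom_A A \<sigma> \<gamma> = {x \<in> A. sd_act \<sigma> \<gamma> x \<in> A}"

text \<open>the partial transformation groupoid (\<AA> \<rtimes> \<SS>) \<ltimes> \<overline>A: pairs (\<gamma>, x) with x in
  the domain of \<gamma> in \<overline>A, which is the closure of dom_A \<gamma>\<close>
definition groupoid :: "'g::group_add set \<Rightarrow> 'a::ab_group_add set \<Rightarrow> ('g \<Rightarrow> 'a \<Rightarrow> 'a) \<Rightarrow> (('a \<times> 'g) \<times> ('a set \<Rightarrow> 'a set)) set" where
  "groupoid S A \<sigma> = {(\<gamma>, x). x \<in> Abar S A \<sigma> \<and> in_closure S A \<sigma> (dom_A A \<sigma> \<gamma>) x}"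

text \<open>the (unique continuous) extension of the partial action to \<overline>A\<close>
definition act_bar :: "'g::group_add set \<Rightarrow> 'a::ab_group_add set \<Rightarrow> ('g \<Rightarrow> 'a \<Rightarrow> 'a) \<Rightarrow> 'a \<times> 'g \<Rightarrow> ('a set \<Rightarrow> 'a set) \<Rightarrow> ('a set \<Rightarrow> 'a set)" where
  "act_bar S A \<sigma> \<gamma> x = (THE y. y \<in> Abar S A \<sigma> \<and>
     (\<forall>F'. finite F' \<and> F' \<subseteq> constructible S A \<sigma> \<longrightarrow>
        (\<exists>F. finite F \<and> F \<subseteq> constructible S A \<sigma> \<and>
           (\<forall>a\<in>dom_A A \<sigma> \<gamma>. agree_on F (Aemb S A \<sigma> a) x \<longrightarrow>
               agree_on F' (Aemb S A \<sigma> (sd_act \<sigma> \<gamma> a)) y))))"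

text \<open>c : (\<AA> \<rtimes> \<SS>) \<ltimes> \<overline>A \<rightarrow> \<BB> \<rtimes> \<TT> is a continuous groupoid homomorphism
  (target discrete) with c^{-1}(0,1) the unit space.  c is given as a function of
  (\<gamma>, x), only its values on the groupoid matter.\<close>
definition cont_groupoid_hom ::
  "'g::group_add set \<Rightarrow> 'a::ab_group_add set \<Rightarrow> ('g \<Rightarrow> 'a \<Rightarrow> 'a) \<Rightarrow> ('h::group_add \<Rightarrow> 'b::ab_group_add \<Rightarrow> 'b)
   \<Rightarrow> ('a \<times> 'g \<Rightarrow> ('a set \<Rightarrow> 'a set) \<Rightarrow> 'b \<times> 'h) \<Rightarrow> bool" where
  "cont_groupoid_hom S A \<sigma> \<tau> c \<longleftrightarrow>
     \<comment> \<open>homomorphism: c(\<gamma>\<delta>, x) = c(\<gamma>, \<delta>.x) c(\<delta>, x) for composable pairs\<close>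
     (\<forall>\<gamma> \<delta> x. (\<delta>, x) \<in> groupoid S A \<sigma> \<and> (\<gamma>, act_bar S A \<sigma> \<delta> x) \<in> groupoid S A \<sigma> \<longrightarrow>
        c (sd_mult \<sigma> \<gamma> \<delta>) x = sd_mult \<tau> (c \<gamma> (act_bar S A \<sigma> \<delta> x)) (c \<delta> x)) \<and>
     \<comment> \<open>continuity (locally constant, as the target group is discrete)\<close>
     (\<forall>\<gamma> x. (\<gamma>, x) \<in> groupoid S A \<sigma> \<longrightarrow>
        (\<exists>F. finite F \<and> F \<subseteq> constructible S A \<sigma> \<and>
           (\<forall>y. (\<gamma>, y) \<in> groupoid S A \<sigma> \<and> agree_on F x y \<longrightarrow> c \<gamma> y = c \<gamma> x)))"

definition unit_preimage :: "'g::group_add set \<Rightarrow> 'a::ab_group_add set \<Rightarrow> ('g \<Rightarrow> 'a \<Rightarrow> 'a)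
   \<Rightarrow> ('a \<times> 'g \<Rightarrow> ('a set \<Rightarrow> 'a set) \<Rightarrow> 'b::ab_group_add \<times> 'h::group_add) \<Rightarrow> bool" where
  "unit_preimage S A \<sigma> c \<longleftrightarrow>
     (\<forall>\<gamma> x. (\<gamma>, x) \<in> groupoid S A \<sigma> \<longrightarrow> (c \<gamma> x = (0, 0) \<longleftrightarrow> \<gamma> = (0, 0)))"

definition cond_i1 :: "'g::group_add set \<Rightarrow> 'a::ab_group_add set \<Rightarrow> ('g \<Rightarrow> 'a \<Rightarrow> 'a) \<Rightarrow> 'h::group_add itself \<Rightarrow> 'a set \<Rightarrow> bool" where
  "cond_i1 S A \<sigma> _ A' \<longleftrightarrow>
     (\<exists>s\<in>S. \<sigma> s ` A' \<subseteq> A' \<and> inj_on (\<lambda>x. x - \<sigma> s x) A') \<and>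
     (\<forall>\<alpha> \<beta>::'h. is_free_group (gen_subgroup {\<alpha>, \<beta>}) \<or> is_abelian_set (gen_subgroup {\<alpha>, \<beta>}))"

definition cond_i2 :: "'g::group_add set \<Rightarrow> 'a::ab_group_add set \<Rightarrow> ('g \<Rightarrow> 'a \<Rightarrow> 'a) \<Rightarrow> 'h::group_add itself \<Rightarrow> bool" where
  "cond_i2 S A \<sigma> _ \<longleftrightarrow> (\<exists>s\<in>S. \<exists>\<kappa>::int. \<kappa> \<noteq> 0 \<and> \<kappa> \<noteq> 1 \<and> (\<forall>a\<in>A. \<sigma> s a = zmul \<kappa> a) \<and>
     (\<forall>\<alpha>::'h. (\<exists>\<gamma>. \<gamma> + \<alpha> + - \<gamma> = zmul \<kappa> \<alpha>) \<longrightarrow> finite_order \<alpha>))"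

definition cond_ii1 :: "'g::group_add set \<Rightarrow> 'a::ab_group_add set \<Rightarrow> ('g \<Rightarrow> 'a \<Rightarrow> 'a) \<Rightarrow> 'h::group_add itself \<Rightarrow> 'a set \<Rightarrow> bool" where
  "cond_ii1 S A \<sigma> _ A' \<longleftrightarrow>
     (\<forall>l::nat. 1 < l \<and> (\<exists>\<alpha>::'h. has_order \<alpha> l) \<longrightarrow>
        (\<exists>s\<in>S. s \<noteq> 0 \<and> (\<exists>\<mu> \<nu>::nat. 0 < \<mu> \<and> 0 < \<nu> \<and> coprime \<mu> \<nu> \<and> \<sigma> s ` A' \<subseteq> A' \<and>
           (\<exists>P \<delta>. is_charpoly A' (\<sigma> s) P \<and> Polynomial.smult (of_nat \<mu>) P = monom (of_nat \<mu>) \<delta> - [:of_nat \<nu>:]) \<and>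
           (gcd l \<mu> > 1 \<or> gcd l \<nu> > 1))))"

definition cond_F :: "('h::group_add \<Rightarrow> 'b::ab_group_add \<Rightarrow> 'b) \<Rightarrow> bool" where
  "cond_F \<tau> \<longleftrightarrow> (\<forall>t. t \<noteq> 0 \<longrightarrow> inj (\<lambda>x. x - \<tau> t x))"

definition exhausting_fr_seq :: "'a::ab_group_add set \<Rightarrow> (nat \<Rightarrow> 'a set) \<Rightarrow> bool" where
  "exhausting_fr_seq A An \<longleftrightarrow> (\<forall>n. is_subgroup (An n) \<and> An n \<subseteq> A \<and> finite_rank (An n)) \<and>
     (\<forall>n. An n \<subseteq> An (Suc n)) \<and> (\<Union>n. An n) = A"

definition cond_I_seq :: "'g::group_add set \<Rightarrow> 'a::ab_group_add set \<Rightarrow> ('g \<Rightarrow> 'a \<Rightarrow> 'a) \<Rightarrow> 'h::group_add itself \<Rightarrow> (nat \<Rightarrow> 'a set) \<Rightarrow> bool" where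
  "cond_I_seq S A \<sigma> H An \<longleftrightarrow> exhausting_fr_seq A An \<and>
     ((\<forall>n. cond_i1 S A \<sigma> H (An n)) \<or> cond_i2 S A \<sigma> H)"

definition cond_I :: "'g::group_add set \<Rightarrow> 'a::ab_group_add set \<Rightarrow> ('g \<Rightarrow> 'a \<Rightarrow> 'a) \<Rightarrow> 'h::group_add itself \<Rightarrow> bool" where
  "cond_I S A \<sigma> H \<longleftrightarrow> (\<exists>An. cond_I_seq S A \<sigma> H An)"

definition cond_II_seq :: "'g::group_add set \<Rightarrow> 'a::ab_group_add set \<Rightarrow> ('g \<Rightarrow> 'a \<Rightarrow> 'a) \<Rightarrow> ('h::group_add \<Rightarrow> 'b::ab_group_add \<Rightarrow> 'b) \<Rightarrow> (nat \<Rightarrow> 'a set) \<Rightarrow> bool" where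
  "cond_II_seq S A \<sigma> \<tau> An \<longleftrightarrow> (\<forall>n. cond_ii1 S A \<sigma> TYPE('h) (An n)) \<or> (cond_F \<tau> \<and> torsion_free_set A)"

definition cond_III :: "'g::group_add set \<Rightarrow> 'a::ab_group_add set \<Rightarrow> ('g \<Rightarrow> 'a \<Rightarrow> 'a) \<Rightarrow> ('h::group_add \<Rightarrow> 'b::ab_group_add \<Rightarrow> 'b) \<Rightarrow> bool" where
  "cond_III S A \<sigma> \<tau> \<longleftrightarrow> (\<exists>s\<in>S. \<exists>\<kappa>::int. \<kappa> \<noteq> 0 \<and> \<kappa> \<noteq> 1 \<and> (\<forall>a\<in>A. \<sigma> s a = zmul \<kappa> a)) \<and>
     finite_rank (UNIV :: 'b set) \<and> cond_F \<tau>"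

definition loc_set :: "'g::group_add set \<Rightarrow> 'a set \<Rightarrow> ('g \<Rightarrow> 'a \<Rightarrow> 'a) \<Rightarrow> 'a set" where
  "loc_set S A \<sigma> = {x. \<exists>s\<in>S. \<sigma> s x \<in> A}"

definition ore_loc :: "'g::group_add set \<Rightarrow> 'a set \<Rightarrow> ('g \<Rightarrow> 'a \<Rightarrow> 'a) \<Rightarrow> bool" where
  "ore_loc S A \<sigma> \<longleftrightarrow> (\<forall>s\<in>S. \<forall>t\<in>S. \<exists>u\<in>S. \<exists>v\<in>S. u + s = v + t) \<and>
     (\<forall>g. \<exists>s\<in>S. \<exists>t\<in>S. g = - s + t) \<and> loc_set S A \<sigma> = UNIV"

definition cond_star :: "'g::group_add set \<Rightarrow> 'a::ab_group_add set \<Rightarrow> ('g \<Rightarrow> 'a \<Rightarrow> 'a)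
   \<Rightarrow> 'h::group_add set \<Rightarrow> 'b::ab_group_add set \<Rightarrow> ('h \<Rightarrow> 'b \<Rightarrow> 'b) \<Rightarrow> bool" where
  "cond_star S A \<sigma> T B \<tau> \<longleftrightarrow>
     (\<exists>An. exhausting_fr_seq A An \<and>
        ((cond_I_seq S A \<sigma> TYPE('h) An \<and> cond_II_seq S A \<sigma> \<tau> An) \<or> cond_III S A \<sigma> \<tau>)) \<and>
     (\<exists>Ak. (\<forall>k. \<exists>F. finite F \<and> Ak k = gen_subgroup F) \<and> (\<forall>k. Ak k \<subseteq> Ak (Suc k)) \<and>
        (\<Union>k. Ak k) = A \<and> (\<forall>s\<in>S. \<forall>k. \<sigma> s ` Ak k \<subseteq> Ak k)) \<and>
     ore_loc S A \<sigma> \<and> ore_loc T B \<tau> \<and>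
     (\<forall>C\<in>constructible S A \<sigma>. \<exists>s\<in>S. \<sigma> s ` A \<subseteq> C)"

end

theory Submission
  imports Defs "HOL-Analysis.Function_Topology" "HOL-Computational_Algebra.Fundamental_Theorem_Algebra"
begin

text \<open>
  Write \<open>\<phi> z = c (z, 1) 0\<close> for \<open>z \<in> A\<close> and \<open>\<psi> g = c (0, g) 0\<close>. As the completion of \<open>A\<close> is compact, \<open>c (z, 1)\<close>
  factors through some \<open>A/C\<close>, and hence \<open>\<phi>\<close> is an injective homomorphism on \<open>G \<inter> C\<close> for every finitely generated
  \<open>G \<subseteq> A\<close> and a suitable constructible \<open>C\<close>, which has finite index. Since \<open>0\<close> is fixed, \<open>\<psi>\<close> is a homomorphism, and
  continuity at \<open>0\<close> gives \<open>\<psi> s \<phi> z (\<psi> s)\<^sup>-\<^sup>1 = \<phi> (\<sigma> s z)\<close> for \<open>z\<close> in a constructible subgroup.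

  Under (I) or (III) the component of \<open>\<phi>\<close> in \<open>\<TT>\<close> is torsion: in a free group a conjugate of \<open>v\<close> by \<open>u\<close>
  that commutes with \<open>v\<close> comes from a commuting pair, as one sees in a nilpotent quotient of class three, and an
  automorphism of a finite rank group that is conjugate to a proper power of itself has roots of unity as
  eigenvalues. So a multiple of every \<open>z\<close> is mapped to \<open>\<BB>\<close>, which extends to an injective
  equivariant map between the rational hulls. Injectivity of this map and (JF) make \<open>\<tt>\<close> injective.

  For (ii) it remains to see that \<open>\<phi> (\<sigma> r z)\<close> itself lies in \<open>\<BB>\<close> for some \<open>r \<in> S\<close>. If (F) holds, an
  element \<open>(b, a)\<close> with \<open>a \<noteq> 1\<close> of finite order has finite order. In the case (ii\<open>\<^sub>1\<close>) the Cayley-Hamilton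
  theorem yields that \<open>a\<^sup>\<mu>\<close> is conjugate to \<open>a\<^sup>\<nu>\<close>, which is impossible for elements of order \<open>l > 1\<close>.
\<close>

section \<open>Integer multiples and subgroups\<close>

text \<open>The value at \<open>(z, 1)\<close> depends on the base point, so
  \<open>z \<mapsto> c (z, 1) 0\<close> is additive only when the second summand lies in a
  constructible subgroup on whose cosets the first value is constant. Finitely many generators can
  share such a subgroup, all of \<open>A\<close> in general cannot; so no map on \<open>A\<close> is
  at hand at first. Finite index repairs this rationally: every element has a multiple in any given
  constructible subgroup, and torsion-freeness permits division afterwards. Where additivity holds,
  the source is abelian and the target is not, so values commute; this is where the commuting
  conjugates in the free group case come from. For (ii) multiples are too coarse. There (PC) moves
  an element into the required subgroup by some \<open>\<sigma> r\<close>, invariance of the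
  finitely generated subgroups keeps it where additivity is known, and equivariance undoes
  \<open>r\<close> afterwards. In the case (ii1) the required subgroup depends on the order to be
  excluded, so a bound on the orders must come first.\<close>

lemma funpow_add_left:
  fixes x :: "'a::group_add"
  shows "((+) x ^^ n) y = ((+) x ^^ n) 0 + y"
  by (induction n) (auto simp: add.assoc)

lemma zmul_of_nat_Suc: "zmul (int (Suc n)) x = zmul (int n) x + x"
proof -
  have "((+) x ^^ Suc n) 0 = ((+) x ^^ n) x" by (simp add: funpow_swap1)
  then show ?thesis unfolding zmul_def using funpow_add_left[of n x x] by (simp del: funpow.simps of_nat_Suc)
qed

lemma zmul_0 [simp]: "zmul 0 x = 0"
  by (simp add: zmul_def)

lemma zmul_1 [simp]: "zmul 1 x = x"
  by (simp add: zmul_def)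

lemma zmul_minus: "zmul (- k) x = - zmul k x"
  by (auto simp: zmul_def)

lemma zmul_succ: "zmul (k + 1) x = zmul k x + x"
proof (cases "0 \<le> k")
  case True
  then obtain n where "k = int n" using nonneg_int_cases by blast
  then show ?thesis using zmul_of_nat_Suc[of n x] by (simp add: add.commute)
next
  case False
  then obtain n where "k = - int (Suc n)"
    by (metis int_cases not_le of_nat_0_le_iff)
  moreover have "zmul (int (Suc n)) x = x + zmul (int n) x"
    by (simp add: zmul_def nat_add_distrib)
  ultimately show ?thesis
    using zmul_minus[of "int (Suc n)" x] zmul_minus[of "int n" x]
    by (simp add: minus_add)
qed

lemma zmul_pred: "zmul (k - 1) x = zmul k x - x"
  using zmul_succ[of "k - 1" x] by (simp add: algebra_simps)

lemma zmul_add_left: "zmul (k + l) x = zmul k x + zmul l x"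
proof (induction l rule: int_induct[where k = 0])
  case (step1 i)
  then show ?case using zmul_succ[of "k + i" x] zmul_succ[of i x] by (simp add: add.assoc)
next
  case (step2 i)
  then show ?case using zmul_pred[of "k + i" x] zmul_pred[of i x]
    by (simp add: add_diff_eq)
qed auto

lemma zmul_zero_right [simp]: "zmul k 0 = 0"
  by (induction k rule: int_induct[where k = 0]) (auto simp: zmul_succ zmul_pred)

lemma zmul_mult: "zmul (k * l) x = zmul k (zmul l x)"
proof (induction k rule: int_induct[where k = 0])
  case (step1 i)
  then show ?case by (simp add: zmul_succ distrib_right zmul_add_left)
next
  case (step2 i)
  have "zmul ((i - 1) * l) x = zmul (i * l + - l) x" by (simp add: left_diff_distrib)
  then show ?case using step2 by (simp only: zmul_add_left zmul_minus zmul_pred) simp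
qed auto

lemma zmul_hom:
  fixes f :: "'a::group_add \<Rightarrow> 'b::group_add"
  assumes "\<And>x y. f (x + y) = f x + f y"
  shows "f (zmul k x) = zmul k (f x)"
proof -
  have f0: "f 0 = 0" using assms[of 0 0] by (metis add_0_right add_left_cancel)
  have fd: "f (u - v) = f u - f v" for u v
    using assms[of "u - v" v] by (simp add: algebra_simps)
  show ?thesis
    by (induction k rule: int_induct[where k = 0]) (auto simp: f0 fd zmul_succ zmul_pred assms)
qed

lemma zmul_add_right: "zmul k (x + y) = zmul k x + zmul k (y::'a::ab_group_add)"
  by (induction k rule: int_induct[where k = 0]) (auto simp: zmul_succ zmul_pred algebra_simps)

lemma zmul_minus_right: "zmul k (- x) = - zmul k (x::'a::ab_group_add)"
  using zmul_add_right[of k x "- x"] by (simp add: eq_neg_iff_add_eq_0 add.commute)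

lemma zmul_diff_right: "zmul k (x - y) = zmul k x - zmul k (y::'a::ab_group_add)"
  using zmul_add_right[of k x "- y"] by (simp add: zmul_minus_right)

lemma zmul_diff_left: "zmul (k - l) x = zmul k x - zmul l x"
  using zmul_add_left[of k "- l" x] by (simp add: zmul_minus)

lemma zmul_commute: "zmul k (zmul l x) = zmul l (zmul k x)"
  by (metis mult.commute zmul_mult)

lemma zmul_sum: "zmul k (sum f I) = (\<Sum>i\<in>I. zmul k (f i :: 'a::ab_group_add))"
  by (induction I rule: infinite_finite_induct) (auto simp: zmul_add_right)

lemma torsion_freeD:
  assumes "torsion_free_set (UNIV :: 'a::group_add set)" "zmul k (x::'a) = 0" "k \<noteq> 0"
  shows "x = 0"
proof (cases "0 < k")
  case True
  then show ?thesis using assms unfolding torsion_free_set_def by blast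
next
  case False
  then have "0 < - k" "zmul (- k) x = 0" using assms(2,3) by (simp_all add: zmul_minus)
  then show ?thesis using assms unfolding torsion_free_set_def by blast
qed

lemma torsion_free_cancel:
  assumes "torsion_free_set (UNIV :: 'a::ab_group_add set)" "zmul k (x::'a) = zmul k y" "k \<noteq> 0"
  shows "x = y"
  using torsion_freeD[OF assms(1), of k "x - y"] assms by (simp add: zmul_diff_right)

section \<open>Subgroups and generated subgroups\<close>

lemma is_subgroup_zmul:
  assumes "is_subgroup H" "x \<in> H"
  shows "zmul k x \<in> H"
proof -
  have "u - x \<in> H" if "u \<in> H" for u
    using assms that unfolding is_subgroup_def by (metis add_uminus_conv_diff)
  then show ?thesis
    by (induction k rule: int_induct[where k = 0])
      (use assms in \<open>simp_all add: zmul_succ zmul_pred is_subgroup_def\<close>)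
qed

lemma is_subgroup_diff: "is_subgroup H \<Longrightarrow> x \<in> H \<Longrightarrow> y \<in> H \<Longrightarrow> x - y \<in> H"
  unfolding is_subgroup_def by (metis add_uminus_conv_diff)

lemma is_subgroup_sum:
  fixes f :: "'i \<Rightarrow> 'a::ab_group_add"
  assumes "is_subgroup H" "\<And>i. i \<in> I \<Longrightarrow> f i \<in> H"
  shows "sum f I \<in> H"
  using assms by (induction I rule: infinite_finite_induct) (simp_all add: is_subgroup_def)

lemma is_subgroup_UNIV [simp]: "is_subgroup UNIV"
  unfolding is_subgroup_def by auto

lemma is_subgroup_gen: "is_subgroup (gen_subgroup X)"
  unfolding gen_subgroup_def is_subgroup_def by blast

lemma gen_subgroup_superset: "X \<subseteq> gen_subgroup X"
  unfolding gen_subgroup_def by auto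

lemma gen_subgroup_least: "is_subgroup H \<Longrightarrow> X \<subseteq> H \<Longrightarrow> gen_subgroup X \<subseteq> H"
  unfolding gen_subgroup_def by auto

lemma gen_subgroup_induct [consumes 1, case_names zero add minus gen]:
  assumes "x \<in> gen_subgroup X"
    and "P 0" "\<And>x y. P x \<Longrightarrow> P y \<Longrightarrow> P (x + y)" "\<And>x. P x \<Longrightarrow> P (- x)" "\<And>x. x \<in> X \<Longrightarrow> P x"
  shows "P x"
proof -
  have "is_subgroup {x. P x}" using assms unfolding is_subgroup_def by simp
  then show ?thesis using gen_subgroup_least[of "{x. P x}" X] assms by blast
qed

section \<open>Orders of elements and subgroups of finite index\<close>

lemma has_order_dvd:
  assumes "has_order x l" "zmul k x = 0"
  shows "int l dvd k"
proof -
  have l: "0 < l" "zmul (int l) x = 0" using assms(1) by (auto simp: has_order_def)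
  have "zmul k x = zmul (k div int l * int l + k mod int l) x" by simp
  also have "\<dots> = zmul (k mod int l) x" using l(2) by (simp only: zmul_add_left zmul_mult) simp
  finally have "zmul (k mod int l) x = 0" using assms(2) by simp
  moreover have nn: "0 \<le> k mod int l" "k mod int l < int l" using l(1) by simp_all
  ultimately have "\<not> 0 < nat (k mod int l)"
    using assms(1)[unfolded has_order_def, THEN conjunct2, THEN conjunct2, THEN spec, of "nat (k mod int l)"]
    by (simp add: nat_less_iff)
  then have "k mod int l = 0" using nn by linarith
  then show ?thesis by (simp add: mod_0_imp_dvd)
qed

lemma finite_order_has_order:
  assumes "finite_order x"
  obtains l where "has_order x l"
proof -
  define l where "l = (LEAST n::nat. 0 < n \<and> zmul (int n) x = 0)"
  have "0 < l \<and> zmul (int l) x = 0"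
    unfolding l_def by (rule LeastI_ex) (use assms in \<open>auto simp: finite_order_def\<close>)
  moreover have "\<forall>k. 0 < k \<and> k < l \<longrightarrow> zmul (int k) x \<noteq> 0"
    unfolding l_def using not_less_Least by blast
  ultimately show thesis using that unfolding has_order_def by blast
qed

lemma finite_orderI: "zmul k x = 0 \<Longrightarrow> k \<noteq> 0 \<Longrightarrow> finite_order x"
  unfolding finite_order_def
  by (rule exI[of _ "nat \<bar>k\<bar>"]) (auto simp: zmul_minus abs_if)

lemma zmul_conj: "zmul k (u + v - u) = u + zmul k v - (u::'a::group_add)"
  by (rule zmul_hom[of "\<lambda>v. u + v - u", symmetric])
    (simp only: diff_conv_add_uminus add.assoc minus_add_cancel)

text \<open>Pigeonhole: the multiples of \<open>z\<close> meet only finitely many cosets of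
  \<open>K\<close>, so two of them differ by an element of \<open>K\<close>.\<close>

lemma finite_index_multiple:
  fixes K :: "'a::ab_group_add set"
  assumes "finite_index H K" "is_subgroup H" "is_subgroup K" "z \<in> H"
  shows "\<exists>n>0. zmul n z \<in> K"
proof -
  have "finite (range (\<lambda>n::nat. (+) (zmul (int n) z) ` K))"
    by (rule finite_subset[OF _ assms(1)[unfolded finite_index_def]])
      (use assms is_subgroup_zmul[of H z] in auto)
  then have "\<not> inj (\<lambda>n::nat. (+) (zmul (int n) z) ` K)"
    using finite_imageD infinite_UNIV_nat by blast
  then obtain m n :: nat where mn: "m < n" "(+) (zmul (int m) z) ` K = (+) (zmul (int n) z) ` K"
    by (auto simp: inj_def) (metis linorder_neqE_nat)
  have "zmul (int n) z \<in> (+) (zmul (int n) z) ` K"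
    using assms(3) unfolding is_subgroup_def by (intro image_eqI[of _ _ 0]) auto
  then obtain k where "k \<in> K" "zmul (int n) z = zmul (int m) z + k" using mn(2) by auto
  then have "zmul (int n - int m) z = k" by (simp add: zmul_diff_left)
  then show ?thesis using mn(1) \<open>k \<in> K\<close> by (intro exI[of _ "int n - int m"]) auto
qed

section \<open>Free groups\<close>

lemma word_eval_append: "word_eval (u @ v) = word_eval u + word_eval v"
  by (induction u rule: word_eval.induct) (auto simp: add.assoc)

lemma not_reduced_word_split:
  "\<not> reduced_word w \<Longrightarrow> \<exists>u x e v. w = u @ (x, e) # (x, \<not> e) # v"
proof (induction w rule: reduced_word.induct)
  case (1 x e y f w)
  show ?case
  proof (cases "x = y \<and> e \<noteq> f")
    case True
    then show ?thesis by (intro exI[of _ "[]"] exI[of _ x] exI[of _ e] exI[of _ w]) auto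
  next
    case False
    then obtain u z g v where "(y, f) # w = u @ (z, g) # (z, \<not> g) # v" using 1 by auto
    then show ?thesis by (intro exI[of _ "(x, e) # u"] exI[of _ z] exI[of _ g] exI[of _ v]) auto
  qed
qed auto

lemma word_eval_inverse:
  "word_eval (rev (map (\<lambda>(x, e). (x, \<not> e)) w)) = - word_eval w"
  by (induction w rule: word_eval.induct) (auto simp: word_eval_append minus_add)

lemma letters_inverse: "fst ` set (rev (map (\<lambda>(x, e). (x, \<not> e)) w)) = fst ` set w"
  by (simp add: image_image case_prod_unfold)

lemma commute_minus:
  fixes a b :: "'a::group_add"
  assumes "a + b = b + a"
  shows "- a + b = b + - a"
proof -
  have "- a + b = - a + (b + a) + - a" by (simp only: add.assoc add.right_inverse add_0_right)
  also have "\<dots> = b + - a" by (simp flip: assms add.assoc)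
  finally show ?thesis .
qed

lemma is_subgroup_centralizer: "is_subgroup {h. \<forall>x\<in>X. h + x = x + (h::'a::group_add)}"
  unfolding is_subgroup_def by (auto simp: commute_minus add.assoc) (metis add.assoc)

text \<open>Freeness is encoded by the nonvanishing of reduced words. A nonempty word with value 0
  is therefore not reduced, and deleting an adjacent pair of inverse letters changes neither its
  value nor its image under \<open>f\<close>.\<close>

lemma free_on_trivial_word:
  fixes f :: "'a::group_add \<Rightarrow> 'k::group_add"
  assumes "free_on X H" "fst ` set w \<subseteq> X" "word_eval w = 0"
  shows "word_eval (map (apfst f) w) = 0"
  using assms(2,3)
proof (induction w rule: length_induct)
  case (1 w)
  show ?case
  proof (cases "w = []")
    case False
    then have "\<not> reduced_word w" using assms(1) 1(2,3) unfolding free_on_def by blast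
    then obtain u x e v where w: "w = u @ (x, e) # (x, \<not> e) # v"
      using not_reduced_word_split by blast
    have "word_eval (map (apfst f) (u @ v)) = 0"
      by (rule 1(1)[rule_format]) (use w 1(2,3) in \<open>auto simp: word_eval_append split: if_splits\<close>)
    then show ?thesis by (auto simp: w word_eval_append)
  qed simp
qed

lemma gen_subgroup_word:
  assumes "h \<in> gen_subgroup X"
  shows "\<exists>w. fst ` set w \<subseteq> X \<and> word_eval w = h"
  using assms
proof (induction rule: gen_subgroup_induct)
  case zero
  show ?case by (rule exI[of _ "[]"]) auto
next
  case (add x y)
  then obtain v w where "fst ` set v \<subseteq> X" "word_eval v = x" "fst ` set w \<subseteq> X" "word_eval w = y"
    by blast
  then show ?case by (intro exI[of _ "v @ w"]) (auto simp: word_eval_append)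
next
  case (minus x)
  then obtain w where "fst ` set w \<subseteq> X" "word_eval w = x" by blast
  then show ?case
    by (intro exI[of _ "rev (map (\<lambda>(x, e). (x, \<not> e)) w)"])
      (auto simp only: word_eval_inverse letters_inverse)
next
  case (gen x)
  then show ?case by (intro exI[of _ "[(x, True)]"]) auto
qed

text \<open>\<open>F\<close> is computed from an arbitrarily chosen word for each element. Any other
  word followed by the formal inverse of the chosen one has value 0, so by
  \<open>free_on_trivial_word\<close> the choice does not matter.\<close>

lemma free_on_universal:
  fixes f :: "'a::group_add \<Rightarrow> 'k::group_add"
  assumes "free_on X H"
  obtains F where "\<And>g h. g \<in> H \<Longrightarrow> h \<in> H \<Longrightarrow> F (g + h) = F g + F h" "\<And>x. x \<in> X \<Longrightarrow> F x = f x"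
proof -
  have H: "H = gen_subgroup X" using assms unfolding free_on_def by simp
  obtain W where W: "\<And>h. h \<in> H \<Longrightarrow> fst ` set (W h) \<subseteq> X \<and> word_eval (W h) = h"
    using gen_subgroup_word unfolding H by metis
  define F where "F h = word_eval (map (apfst f) (W h))" for h
  have inv: "map (apfst f) (rev (map (\<lambda>(x, e). (x, \<not> e)) w)) =
      rev (map (\<lambda>(x, e). (x, \<not> e)) (map (apfst f) w))" for w
    by (induction w) auto
  have F: "F (word_eval w) = word_eval (map (apfst f) w)" if w: "fst ` set w \<subseteq> X" for w
  proof -
    have h: "word_eval w \<in> H"
      using w unfolding H
    proof (induction w rule: word_eval.induct)
      case (2 x e w)
      then show ?case
        using is_subgroup_gen[of X] gen_subgroup_superset[of X] unfolding is_subgroup_def by auto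
    qed (use is_subgroup_gen[of X] in \<open>simp add: is_subgroup_def\<close>)
    let ?w = "w @ rev (map (\<lambda>(x, e). (x, \<not> e)) (W (word_eval w)))"
    have "fst ` set ?w \<subseteq> X" "word_eval ?w = 0"
      using W[OF h] w by (simp_all only: set_append image_Un letters_inverse word_eval_append word_eval_inverse) simp_all
    then have "word_eval (map (apfst f) ?w) = 0" by (rule free_on_trivial_word[OF assms])
    then show ?thesis unfolding F_def map_append inv word_eval_append word_eval_inverse by simp
  qed
  show thesis
  proof (rule that)
    fix g h assume "g \<in> H" "h \<in> H"
    then show "F (g + h) = F g + F h"
      using F[of "W g @ W h"] W unfolding F_def[of g] F_def[of h] by (auto simp: word_eval_append)
  next
    fix x assume "x \<in> X"
    then show "F x = f x" using F[of "[(x, True)]"] by simp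
  qed
qed

text \<open>\<open>Nilp p q c d e f\<close> stands for the pair of unipotent \<open>4 \<times> 4\<close> matrices whose diagonals above the
  main one are \<open>(p, q, p)\<close>, \<open>(c, d)\<close>, \<open>e\<close> and \<open>(q, p, q)\<close>, \<open>(d, c)\<close>, \<open>f\<close>. The group of these pairs detects
  both basic commutators of weight three.\<close>

datatype nilp = Nilp int int int int int int

instantiation nilp :: group_add
begin

definition zero_nilp where "0 = Nilp 0 0 0 0 0 0"

fun plus_nilp where
  "Nilp p q c d e f + Nilp p' q' c' d' e' f' =
    Nilp (p + p') (q + q') (c + c' + p * q') (d + d' + q * p')
      (e + e' + p * d' + c * p') (f + f' + q * c' + d * q')"

fun uminus_nilp where
  "- Nilp p q c d e f = Nilp (- p) (- q) (p * q - c) (p * q - d)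
    (p * d + c * p - p * p * q - e) (q * c + d * q - q * q * p - f)"

definition minus_nilp where "x - y = x + - (y::nilp)"

instance
proof
  fix a b c :: nilp
  show "a + b + c = a + (b + c)" by (cases a; cases b; cases c) (simp add: algebra_simps)
  show "0 + a = a" "a + 0 = a" by (cases a; simp add: zero_nilp_def)+
  show "- a + a = 0" by (cases a) (simp add: zero_nilp_def algebra_simps)
  show "a + - b = a - b" by (simp add: minus_nilp_def)
qed

end

text \<open>The commutator of \<open>u\<close> and \<open>v\<close> has the entries
  \<open>p * s - q * r\<close> and its negative on the second diagonal. Commuting once more with
  \<open>v\<close> brings in the factor \<open>r\<close> or \<open>s\<close>, and the opposite signs
  make the two contributions to a corner entry add up, which explains the factor 2.\<close>

lemma nilp_commutator:
  assumes comm: "(u + v - u) + v = v + (u + v - u)"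
    and u: "u = Nilp p q c d e f" and v: "v = Nilp r s c' d' e' f'"
  shows "r * (p * s - q * r) = 0" "s * (p * s - q * r) = 0"
proof -
  define E where "E w = (case w of Nilp p q c d e f \<Rightarrow> e)" for w
  define G where "G w = (case w of Nilp p q c d e f \<Rightarrow> f)" for w
  have "E (u + v - u + v) - E (v + (u + v - u)) = 2 * (r * (p * s - q * r))"
    unfolding u v E_def minus_nilp_def by (simp add: algebra_simps)
  then show "r * (p * s - q * r) = 0" using comm by simp
  have "G (u + v - u + v) - G (v + (u + v - u)) = - 2 * (s * (p * s - q * r))"
    unfolding u v G_def minus_nilp_def by (simp add: algebra_simps)
  then show "s * (p * s - q * r) = 0" using comm by simp
qed

text \<open>If \<open>u\<close> and \<open>v\<close> generate a free group of rank at least two, then their images in the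
  abelianisation have determinant \<open>\<plusminus>1\<close>, and hence the commutator of \<open>u + v - u\<close> and \<open>v\<close> survives in
  \<^typ>\<open>nilp\<close>.\<close>

lemma commute_if_commute_conj:
  fixes u v :: "'h::group_add"
  assumes FA: "is_free_group (gen_subgroup {u, v}) \<or> is_abelian_set (gen_subgroup {u, v})"
    and comm: "(u + v - u) + v = v + (u + v - u)"
  shows "u + v = v + u"
proof -
  let ?H = "gen_subgroup {u, v}"
  have uv: "u \<in> ?H" "v \<in> ?H" using gen_subgroup_superset[of "{u, v}"] by auto
  have sg: "is_subgroup ?H" by (rule is_subgroup_gen)
  have abel: ?thesis if "is_abelian_set ?H" using that uv unfolding is_abelian_set_def by blast
  show ?thesis
  proof (cases "is_abelian_set ?H")
    case False
    then obtain X where X: "free_on X ?H" using FA unfolding is_free_group_def by blast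
    then have HX: "?H = gen_subgroup X" unfolding free_on_def by simp
    \<comment> \<open>A basis with at most one element would make the group abelian: centralisers
      are subgroups, so commutation spreads from \<open>X\<close> to the generated group in one
      argument and then in the other.\<close>
    have "\<exists>x\<in>X. \<exists>y\<in>X. x \<noteq> y"
    proof (rule ccontr)
      assume *: "\<not> ?thesis"
      have c1: "?H \<subseteq> {h. \<forall>x\<in>X. h + x = x + h}"
        unfolding HX by (rule gen_subgroup_least[OF is_subgroup_centralizer]) (use * in auto)
      have "?H \<subseteq> {h. \<forall>x\<in>?H. h + x = x + h}"
        by (subst HX, rule gen_subgroup_least[OF is_subgroup_centralizer]) (use c1 in auto)
      then show False using False unfolding is_abelian_set_def by blast
    qed
    then obtain x y where xy: "x \<in> X" "y \<in> X" "x \<noteq> y" by blast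
    \<comment> \<open>Two basis elements become the standard generators and all others are killed,
      so the first two coordinates of \<open>F h\<close> are the exponent sums of \<open>x\<close>
      and \<open>y\<close> in \<open>h\<close>.\<close>
    define f where "f z = (if z = x then Nilp 1 0 0 0 0 0 else if z = y then Nilp 0 1 0 0 0 0 else 0)" for z
    obtain F where F: "\<And>g h. g \<in> ?H \<Longrightarrow> h \<in> ?H \<Longrightarrow> F (g + h) = F g + F h"
      and Fx: "\<And>z. z \<in> X \<Longrightarrow> F z = f z"
      by (rule free_on_universal[OF X, of f]) (rule that)
    have F0: "F 0 = 0" using F[of 0 0] sg unfolding is_subgroup_def by (metis add_0_right add_left_cancel)
    have Fm: "F (- g) = - F g" if "g \<in> ?H" for g
      using F[of "- g" g] that sg F0 unfolding is_subgroup_def by (simp add: eq_neg_iff_add_eq_0)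
    obtain p q c d e f where Fu: "F u = Nilp p q c d e f" by (cases "F u")
    obtain r s c' d' e' f' where Fv: "F v = Nilp r s c' d' e' f'" by (cases "F v")
    have conj: "u + v + - u \<in> ?H" using uv sg unfolding is_subgroup_def by blast
    have "u + v \<in> ?H" "- u \<in> ?H" using uv sg unfolding is_subgroup_def by blast+
    then have "F (u + v + - u) = F u + F v - F u"
      using uv F[of "u + v" "- u"] F[of u v] Fm[of u] by simp
    then have "(F u + F v - F u) + F v = F v + (F u + F v - F u)"
      using F[OF conj uv(2)] F[OF uv(2) conj] comm by simp
    then have rs: "r * (p * s - q * r) = 0" "s * (p * s - q * r) = 0"
      using nilp_commutator[OF _ Fu Fv] by blast+
    \<comment> \<open>All exponent vectors lie in the lattice spanned by those of \<open>u\<close>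
      and \<open>v\<close>. Since \<open>x\<close> and \<open>y\<close> contribute the unit vectors,
      this lattice is everything and the determinant \<open>p * s - q * r\<close> is not 0.\<close>
    define P where "P h \<longleftrightarrow> h \<in> ?H \<and> (\<exists>i j c d e f. F h = Nilp (i * p + j * r) (i * q + j * s) c d e f)" for h
    have P: "P h" if "h \<in> ?H" for h
      using that
    proof (induction rule: gen_subgroup_induct)
      case zero
      show ?case unfolding P_def F0 zero_nilp_def
        using sg by (auto simp: is_subgroup_def intro!: exI[of _ "0::int"])
    next
      case (add g h)
      then obtain i j c d e f i' j' c' d' e' f' where
        "F g = Nilp (i * p + j * r) (i * q + j * s) c d e f"
        "F h = Nilp (i' * p + j' * r) (i' * q + j' * s) c' d' e' f'" unfolding P_def by blast
      then have "F (g + h) = Nilp (i * p + j * r) (i * q + j * s) c d e f +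
          Nilp (i' * p + j' * r) (i' * q + j' * s) c' d' e' f'"
        using add F unfolding P_def by simp
      then have "\<exists>c d e f. F (g + h) = Nilp ((i + i') * p + (j + j') * r) ((i + i') * q + (j + j') * s) c d e f"
        by (simp add: algebra_simps)
      then show ?case using add sg unfolding P_def is_subgroup_def by blast
    next
      case (minus g)
      then obtain i j c d e f where "F g = Nilp (i * p + j * r) (i * q + j * s) c d e f"
        unfolding P_def by blast
      then have "F (- g) = - Nilp (i * p + j * r) (i * q + j * s) c d e f"
        using minus Fm unfolding P_def by simp
      moreover have "- (i * p + j * r) = (- i) * p + (- j) * r" "- (i * q + j * s) = (- i) * q + (- j) * s"
        by simp_all
      ultimately have "\<exists>c d e f. F (- g) = Nilp ((- i) * p + (- j) * r) ((- i) * q + (- j) * s) c d e f"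
        unfolding uminus_nilp.simps by metis
      then show ?case using minus sg unfolding P_def is_subgroup_def by blast
    next
      case (gen g)
      have "\<exists>c d e f. F u = Nilp (1 * p + 0 * r) (1 * q + 0 * s) c d e f"
        "\<exists>c d e f. F v = Nilp (0 * p + 1 * r) (0 * q + 1 * s) c d e f"
        unfolding Fu Fv by simp_all
      then show ?case using gen uv unfolding P_def by blast
    qed
    have "x \<in> ?H" "y \<in> ?H" using xy gen_subgroup_superset[of X] unfolding HX by auto
    from P[OF this(1)] P[OF this(2)] obtain i j i' j' where
      "i * p + j * r = 1" "i * q + j * s = 0" "i' * p + j' * r = 0" "i' * q + j' * s = 1"
      using xy unfolding P_def by (auto simp: Fx f_def)
    moreover have "(i * j' - i' * j) * (p * s - q * r) =
        (i * p + j * r) * (i' * q + j' * s) - (i * q + j * s) * (i' * p + j' * r)"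
      by (simp add: algebra_simps)
    ultimately have "p * s - q * r \<noteq> 0" by auto
    \<comment> \<open>A nonzero determinant forces \<open>r\<close> and \<open>s\<close> to be 0 by
      \<open>rs\<close>, and then it vanishes, a contradiction.\<close>
    then show ?thesis using rs by auto
  qed (rule abel)
qed

section \<open>Rational hulls and finite rank\<close>

text \<open>The array is padded by a zero row to a square matrix. Its determinant vanishes, and over
  the integral domain \<open>int\<close> this already gives an integral kernel vector.\<close>

lemma int_dependence:
  fixes k :: "nat \<Rightarrow> nat \<Rightarrow> int"
  shows "\<exists>c. (\<exists>i\<le>n. c i \<noteq> 0) \<and> (\<forall>j<n. (\<Sum>i\<le>n. c i * k i j) = 0)"
proof -
  define r where "r j = vec (Suc n) (\<lambda>i. k i j)" for j
  define M where "M = mat\<^sub>r (Suc n) (Suc n) (\<lambda>j. if j = n then 0\<^sub>v (Suc n) else r j)"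
  have M: "M \<in> carrier_mat (Suc n) (Suc n)" unfolding M_def by simp
  have "det M = 0" unfolding M_def by (rule det_row_0) (auto simp: r_def)
  then obtain v where v: "v \<in> carrier_vec (Suc n)" "v \<noteq> 0\<^sub>v (Suc n)" "M *\<^sub>v v = 0\<^sub>v (Suc n)"
    using det_0_iff_vec_prod_zero[OF M] by blast
  have "\<exists>i\<le>n. v $ i \<noteq> 0"
  proof (rule ccontr)
    assume "\<not> ?thesis"
    then have "v = 0\<^sub>v (Suc n)" using v(1) by (intro eq_vecI) auto
    then show False using v(2) by simp
  qed
  moreover have "(\<Sum>i\<le>n. v $ i * k i j) = 0" if j: "j < n" for j
  proof -
    have "(M *\<^sub>v v) $ j = (\<Sum>i\<in>{0..<Suc n}. k i j * v $ i)"
      using j v(1) unfolding M_def by (auto simp: scalar_prod_def r_def intro!: sum.cong)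
    then show ?thesis using v(3) j by (simp add: mult.commute atLeast0LessThan lessThan_Suc_atMost)
  qed
  ultimately show ?thesis by blast
qed

lemma zmul_sum_left: "zmul (sum c I) x = (\<Sum>i\<in>I. zmul (c i) (x::'a::ab_group_add))"
  by (induction I rule: infinite_finite_induct) (auto simp: zmul_add_left)

lemma common_denominator:
  fixes r :: "'i \<Rightarrow> rat"
  assumes "finite I"
  shows "\<exists>(D::int) k. 0 < D \<and> (\<forall>i\<in>I. of_int (k i) = of_int D * r i)"
proof -
  have "\<exists>D::int. 0 < D \<and> (\<forall>i\<in>I. \<exists>k::int. of_int k = of_int D * r i)"
    using assms
  proof induction
    case (insert x I)
    then obtain D :: int where D: "0 < D" "\<forall>i\<in>I. \<exists>k::int. of_int k = of_int D * r i" by blast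
    obtain p q where pq: "quotient_of (r x) = (p, q)" by (cases "quotient_of (r x)")
    then have q: "0 < q" "r x = of_int p / of_int q"
      using quotient_of_denom_pos quotient_of_div by blast+
    have "\<exists>k::int. of_int k = of_int (D * q) * r i" if "i \<in> insert x I" for i
    proof (cases "i = x")
      case True
      have "of_int (D * p) = of_int (D * q) * r i" unfolding True q(2) using q(1) by simp
      then show ?thesis by blast
    next
      case False
      then have "i \<in> I" using that by simp
      from bspec[OF D(2) this] obtain k :: int where "of_int k = of_int D * r i" by (elim exE)
      then have "of_int (k * q) = of_int (D * q) * r i" by simp
      then show ?thesis by blast
    qed
    then show ?case using D q by (intro exI[of _ "D * q"]) simp
  qed (auto intro: exI[of _ 1])
  then obtain D :: int where D: "0 < D" "\<forall>i\<in>I. \<exists>k::int. of_int k = of_int D * r i" by blast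
  from bchoice[OF D(2)] D(1) show ?thesis by blast
qed

section \<open>Computing with fractions over a torsion-free group\<close>

lemma qcls_eq_iff:
  assumes tf: "torsion_free_set (UNIV :: 'a::ab_group_add set)"
    and "a \<in> H" "b \<in> H" "0 < m" "0 < n"
  shows "qcls H (a, m) = qcls H (b::'a, n) \<longleftrightarrow> zmul n a = zmul m b"
proof -
  have rel: "qrel H (a, m) (b, n) \<longleftrightarrow> a \<in> H \<and> b \<in> H \<and> 0 < m \<and> 0 < n \<and> zmul n a = zmul m b" for a b m n
  proof -
    have "(\<exists>k>0. zmul k (zmul n a - zmul m b) = 0) \<longleftrightarrow> zmul n a = zmul m b"
    proof
      assume "\<exists>k>0. zmul k (zmul n a - zmul m b) = 0"
      then obtain k where "0 < k" "zmul k (zmul n a - zmul m b) = 0" by blast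
      then show "zmul n a = zmul m b" using torsion_freeD[OF tf, of k "zmul n a - zmul m b"] by simp
    qed (auto intro: exI[of _ 1])
    then show ?thesis unfolding qrel_def by simp
  qed
  show ?thesis
  proof
    assume "qcls H (a, m) = qcls H (b, n)"
    moreover have "(b, n) \<in> qcls H (b, n)" unfolding qcls_def using assms by (simp add: rel)
    ultimately have "(b, n) \<in> qcls H (a, m)" by simp
    then show "zmul n a = zmul m b" unfolding qcls_def by (simp add: rel)
  next
    assume e: "zmul n a = zmul m b"
    have "zmul p a = zmul m c \<longleftrightarrow> zmul p b = zmul n c" for c p
    proof
      assume "zmul p a = zmul m c"
      then have "zmul m (zmul p b) = zmul m (zmul n c)" 
        using e zmul_commute[of m p b] zmul_commute[of p n a] zmul_commute[of n m c] by metis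
      then show "zmul p b = zmul n c" using torsion_free_cancel[OF tf] assms by blast
    next
      assume "zmul p b = zmul n c"
      then have "zmul n (zmul p a) = zmul n (zmul m c)" 
        using e zmul_commute[of n p a] zmul_commute[of p m b] zmul_commute[of m n c] by metis
      then show "zmul p a = zmul m c" using torsion_free_cancel[OF tf] assms by blast
    qed
    then show "qcls H (a, m) = qcls H (b, n)" unfolding qcls_def using assms by (auto simp: rel)
  qed
qed

text \<open>\<open>qrep\<close> is a Hilbert choice. Proportionality of the chosen pair to the given
  one is what makes the operations on classes independent of it.\<close>

lemma qrep_qcls:
  assumes "a \<in> H" "0 < m" "torsion_free_set (UNIV :: 'a::ab_group_add set)"
  obtains b n where "qrep (qcls H (a::'a, m)) = (b, n)" "b \<in> H" "0 < n" "zmul n a = zmul m b"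
proof -
  have "(a, m) \<in> qcls H (a, m)" unfolding qcls_def qrel_def using assms
    by (auto intro: exI[of _ 1])
  then have "qrep (qcls H (a, m)) \<in> qcls H (a, m)" unfolding qrep_def by (rule someI)
  moreover obtain b n where bn: "qrep (qcls H (a, m)) = (b, n)" by (cases "qrep (qcls H (a, m))")
  ultimately obtain k where "b \<in> H" "0 < n" "0 < k" "zmul k (zmul n a - zmul m b) = 0"
    unfolding qcls_def qrel_def by auto
  then show thesis using that[OF bn] torsion_freeD[OF assms(3), of k "zmul n a - zmul m b"] by simp
qed

lemma qadd_qcls:
  assumes tf: "torsion_free_set (UNIV :: 'a::ab_group_add set)" and H: "is_subgroup H"
    and "a \<in> H" "b \<in> H" "0 < m" "0 < n"
  shows "qadd H (qcls H (a, m)) (qcls H (b::'a, n)) = qcls H (zmul n a + zmul m b, m * n)"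
proof -
  obtain a' m' where a: "qrep (qcls H (a, m)) = (a', m')" "a' \<in> H" "0 < m'" "zmul m' a = zmul m a'"
    using qrep_qcls[OF assms(3,5) tf] by blast
  obtain b' n' where b: "qrep (qcls H (b, n)) = (b', n')" "b' \<in> H" "0 < n'" "zmul n' b = zmul n b'"
    using qrep_qcls[OF assms(4,6) tf] by blast
  have mem: "zmul i x + zmul j y \<in> H" if "x \<in> H" "y \<in> H" for i j x y
    using that is_subgroup_zmul[OF H] H unfolding is_subgroup_def by blast
  have "zmul (m * n) (zmul n' a' + zmul m' b') = zmul (n * n') (zmul m a') + zmul (m * m') (zmul n b')"
    by (simp add: zmul_add_right mult.commute mult.left_commute flip: zmul_mult)
  also have "\<dots> = zmul (m' * n') (zmul n a + zmul m b)"
    unfolding a(4)[symmetric] b(4)[symmetric]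
    by (simp add: zmul_add_right mult.commute mult.left_commute flip: zmul_mult)
  finally show ?thesis
    unfolding qadd_def a b by (simp add: qcls_eq_iff[OF tf] mem assms a b)
qed

lemma qsmul_qcls:
  assumes tf: "torsion_free_set (UNIV :: 'a::ab_group_add set)" and H: "is_subgroup H"
    and "a \<in> H" "0 < m" "quotient_of r = (p, q)"
  shows "qsmul H r (qcls H (a::'a, m)) = qcls H (zmul p a, q * m)"
proof -
  obtain a' m' where a: "qrep (qcls H (a, m)) = (a', m')" "a' \<in> H" "0 < m'" "zmul m' a = zmul m a'"
    using qrep_qcls[OF assms(3,4) tf] by blast
  have q: "0 < q" using assms(5) quotient_of_denom_pos by blast
  have "zmul (q * m) (zmul p a') = zmul (q * p) (zmul m a')"
    by (simp add: mult.commute mult.left_commute flip: zmul_mult)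
  also have "\<dots> = zmul (q * m') (zmul p a)" unfolding a(4)[symmetric]
    by (simp add: mult.commute mult.left_commute flip: zmul_mult)
  finally show ?thesis
    unfolding qsmul_def assms a using q
    by (simp add: qcls_eq_iff[OF tf] is_subgroup_zmul[OF H] assms a)
qed

lemma qmap_qcls:
  assumes tf: "torsion_free_set (UNIV :: 'a::ab_group_add set)"
    and f: "\<And>x y. f (x + y) = f x + f y" "f ` H \<subseteq> H" and "a \<in> H" "0 < m"
  shows "qmap H f (qcls H (a::'a, m)) = qcls H (f a, m)"
proof -
  obtain a' m' where a: "qrep (qcls H (a, m)) = (a', m')" "a' \<in> H" "0 < m'" "zmul m' a = zmul m a'"
    using qrep_qcls[OF assms(4,5) tf] by blast
  have "zmul m (f a') = zmul m' (f a)" using a(4) zmul_hom[of f, OF f(1)] by metis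
  then show ?thesis unfolding qmap_def a using f(2) a assms
    by (simp add: qcls_eq_iff[OF tf] image_subset_iff)
qed

text \<open>With a common denominator \<open>D\<close>, the coefficient \<open>rs ! i\<close> times
  a_i / m_i equals k_i a_i / D. This turns linear algebra over the rationals into integer identities
  in \<open>H\<close>.\<close>

lemma lincomb_qcls:
  fixes a :: "nat \<Rightarrow> 'a::ab_group_add"
  assumes tf: "torsion_free_set (UNIV :: 'a set)" and H: "is_subgroup H" and D: "0 < D"
    and "length rs = length vs"
    and "\<And>i. i < length vs \<Longrightarrow> a i \<in> H" "\<And>i. i < length vs \<Longrightarrow> 0 < m i"
      "\<And>i. i < length vs \<Longrightarrow> vs ! i = qcls H (a i, m i)"
    and "\<And>i. i < length vs \<Longrightarrow> of_int (k i) * of_int (m i) = of_int D * rs ! i"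
  shows "lincomb H rs vs = qcls H (\<Sum>i<length vs. zmul (k i) (a i), D)"
  using assms(4-)
proof (induction rs vs arbitrary: a m k rule: list_induct2)
  case Nil
  then show ?case using D H unfolding lincomb_def qzero_def
    by (simp add: qcls_eq_iff[OF tf] is_subgroup_def)
next
  case (Cons r rs v vs)
  let ?S = "\<Sum>i<length vs. zmul (k (Suc i)) (a (Suc i))"
  have S: "?S \<in> H" by (rule is_subgroup_sum[OF H]) (use Cons.prems(1) is_subgroup_zmul[OF H] in auto)
  have IH: "lincomb H rs vs = qcls H (?S, D)"
  proof (rule Cons.IH[of "a \<circ> Suc" "m \<circ> Suc" "k \<circ> Suc", unfolded o_def])
    fix i assume i: "i < length vs"
    show "a (Suc i) \<in> H" "0 < m (Suc i)" using Cons.prems(1,2)[of "Suc i"] i by auto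
    show "vs ! i = qcls H (a (Suc i), m (Suc i))" using Cons.prems(3)[of "Suc i"] i by auto
    show "of_int (k (Suc i)) * of_int (m (Suc i)) = of_int D * rs ! i"
      using Cons.prems(4)[of "Suc i"] i by auto
  qed
  obtain p q where pq: "quotient_of r = (p, q)" by (cases "quotient_of r")
  then have q: "0 < q" "r = of_int p / of_int q"
    using quotient_of_denom_pos quotient_of_div by blast+
  have a0: "a 0 \<in> H" "0 < m 0" "v = qcls H (a 0, m 0)" "of_int (k 0) * of_int (m 0) = of_int D * r"
    using Cons.prems(1-4)[of 0] by simp_all
  have "of_int (k 0 * m 0 * q) = (of_int (D * p) :: rat)" using a0(4) q by simp
  then have kq: "k 0 * m 0 * q = D * p" by (simp only: of_int_eq_iff)
  have "lincomb H (r # rs) (v # vs) = qadd H (qsmul H r v) (lincomb H rs vs)"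
    unfolding lincomb_def by simp
  also have "\<dots> = qcls H (zmul D (zmul p (a 0)) + zmul (q * m 0) ?S, q * m 0 * D)"
    unfolding IH a0(3) qsmul_qcls[OF tf H a0(1,2) pq]
    by (rule qadd_qcls[OF tf H]) (use a0 q S D is_subgroup_zmul[OF H] in auto)
  also have "\<dots> = qcls H (zmul (k 0) (a 0) + ?S, D)"
  proof (subst qcls_eq_iff[OF tf])
    show "zmul D (zmul D (zmul p (a 0)) + zmul (q * m 0) ?S) = zmul (q * m 0 * D) (zmul (k 0) (a 0) + ?S)"
      unfolding zmul_add_right zmul_mult[symmetric] using kq by (simp add: ac_simps)
  qed (use a0 q S D H is_subgroup_zmul[OF H] in \<open>auto simp: is_subgroup_def\<close>)
  finally show ?case by (simp add: sum.lessThan_Suc_shift del: sum.lessThan_Suc)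
qed

lemma qcls_in_QT: "a \<in> H \<Longrightarrow> 0 < m \<Longrightarrow> qcls H (a, m) \<in> QT H"
  unfolding QT_def by (rule CollectI, intro exI[of _ a] exI[of _ m]) simp

lemma QT_reps:
  assumes "set vs \<subseteq> QT H"
  shows "\<exists>a m. \<forall>i<length vs. a i \<in> H \<and> 0 < m i \<and> vs ! i = qcls H (a i, m i)"
proof -
  have "\<forall>i. \<exists>p. i < length vs \<longrightarrow> fst p \<in> H \<and> 0 < snd p \<and> vs ! i = qcls H p"
  proof
    fix i
    show "\<exists>p. i < length vs \<longrightarrow> fst p \<in> H \<and> 0 < snd p \<and> vs ! i = qcls H p"
    proof (cases "i < length vs")
      case True
      then have "vs ! i \<in> QT H" using assms nth_mem by blast
      then show ?thesis unfolding QT_def by fastforce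
    qed simp
  qed
  from choice[OF this] obtain p where
    p: "\<forall>i. i < length vs \<longrightarrow> fst (p i) \<in> H \<and> 0 < snd (p i) \<and> vs ! i = qcls H (p i)" ..
  then show ?thesis by (intro exI[of _ "fst \<circ> p"] exI[of _ "snd \<circ> p"]) auto
qed

lemma q_spans_multiple:
  assumes tf: "torsion_free_set (UNIV :: 'a::ab_group_add set)" and H: "is_subgroup H"
    and vs: "q_spans H vs"
    and a: "\<And>i. i < length vs \<Longrightarrow> a i \<in> H" "\<And>i. i < length vs \<Longrightarrow> 0 < m i"
      "\<And>i. i < length vs \<Longrightarrow> vs ! i = qcls H (a i, m i)"
    and x: "(x::'a) \<in> H"
  shows "\<exists>D>0. \<exists>k. zmul D x = (\<Sum>i<length vs. zmul (k i) (a i))"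
proof -
  have "qcls H (x, 1) \<in> QT H" using x by (simp add: qcls_in_QT)
  then obtain rs where rs: "length rs = length vs" "lincomb H rs vs = qcls H (x, 1)"
    using vs unfolding q_spans_def by blast
  obtain D k where D: "0 < (D::int)" "\<forall>i\<in>{..<length vs}. of_int (k i) = of_int D * (rs ! i / of_int (m i))"
    using common_denominator[of "{..<length vs}" "\<lambda>i. rs ! i / of_int (m i)"] by auto
  have k: "of_int (k i) * of_int (m i) = of_int D * rs ! i" if "i < length vs" for i
    using D(2) a(2)[OF that] that by (simp add: field_simps)
  have S: "(\<Sum>i<length vs. zmul (k i) (a i)) \<in> H"
    by (rule is_subgroup_sum[OF H]) (use a is_subgroup_zmul[OF H] in auto)
  have "qcls H (x, 1) = qcls H (\<Sum>i<length vs. zmul (k i) (a i), D)"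
    using lincomb_qcls[OF tf H D(1) rs(1) a k] rs(2) by simp
  then have "zmul D x = (\<Sum>i<length vs. zmul (k i) (a i))"
    using qcls_eq_iff[OF tf x S, of 1 D] D(1) by simp
  then show ?thesis using D(1) by blast
qed

text \<open>Denominators are cleared and \<open>int_dependence\<close> is applied to the coordinates
  in the numerators of a spanning list. The bound \<open>n\<close> depends on \<open>H\<close>
  alone, and the family may have repetitions, so it can be an orbit under an endomorphism.\<close>

lemma finite_rank_dependence:
  assumes tf: "torsion_free_set (UNIV :: 'a::ab_group_add set)" and H: "is_subgroup H"
    and fr: "finite_rank H"
  shows "\<exists>n. \<forall>x. (\<forall>i. x i \<in> H) \<longrightarrow>
    (\<exists>c. (\<exists>i\<le>n. c i \<noteq> 0) \<and> (\<Sum>i\<le>(n::nat). zmul (c i) (x i :: 'a)) = 0)"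
proof -
  obtain vs where vs: "q_spans H vs" using fr unfolding finite_rank_def by blast
  then obtain a m where a: "\<And>i. i < length vs \<Longrightarrow> a i \<in> H" "\<And>i. i < length vs \<Longrightarrow> 0 < m i"
    "\<And>i. i < length vs \<Longrightarrow> vs ! i = qcls H (a i, m i)"
    using QT_reps[of vs H] unfolding q_spans_def by auto
  let ?n = "length vs"
  show ?thesis
  proof (intro exI[of _ ?n] allI impI)
    fix x :: "nat \<Rightarrow> 'a" assume "\<forall>i. x i \<in> H"
    then have x: "x i \<in> H" for i by blast
    have "\<forall>i. \<exists>D k. 0 < D \<and> zmul D (x i) = (\<Sum>j<?n. zmul (k j) (a j))"
      using q_spans_multiple[OF tf H vs a x] by blast
    then obtain D k where Dk: "\<And>i. 0 < D i" "\<And>i. zmul (D i) (x i) = (\<Sum>j<?n. zmul (k i j) (a j))"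
      by metis
    obtain c where c: "\<exists>i\<le>?n. c i \<noteq> 0" "\<And>j. j < ?n \<Longrightarrow> (\<Sum>i\<le>?n. c i * k i j) = 0"
      using int_dependence[of ?n k] by blast
    have "(\<Sum>i\<le>?n. zmul (c i * D i) (x i)) = (\<Sum>i\<le>?n. \<Sum>j<?n. zmul (c i * k i j) (a j))"
      by (simp add: zmul_mult Dk zmul_sum)
    also have "\<dots> = (\<Sum>j<?n. \<Sum>i\<le>?n. zmul (c i * k i j) (a j))" by (rule sum.swap)
    also have "\<dots> = (\<Sum>j<?n. zmul (\<Sum>i\<le>?n. c i * k i j) (a j))" by (simp add: zmul_sum_left)
    also have "\<dots> = 0" by (simp add: c)
    finally show "\<exists>c. (\<exists>i\<le>?n. c i \<noteq> 0) \<and> (\<Sum>i\<le>?n. zmul (c i) (x i)) = 0"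
      using c(1) less_imp_neq[OF Dk(1), symmetric] by (intro exI[of _ "\<lambda>i. c i * D i"]) auto
  qed
qed

text \<open>The iterates of \<open>z\<close> under \<open>f\<close> satisfy a nontrivial integer
  relation. If its constant coefficient is not 0, it exhibits a multiple of \<open>z\<close> as a
  value of \<open>f\<close>; otherwise injectivity cancels one \<open>f\<close> and shortens the
  relation.\<close>

lemma injective_endomorphism_rationally_onto:
  fixes f :: "'a::ab_group_add \<Rightarrow> 'a"
  assumes tf: "torsion_free_set (UNIV :: 'a set)" and H: "is_subgroup H" and fr: "finite_rank H"
    and f: "\<And>x y. f (x + y) = f x + f y" "f ` H \<subseteq> H" "inj_on f H" and z: "z \<in> H"
  shows "\<exists>M>0. \<exists>y\<in>H. zmul M z = f y"
proof -
  obtain n where n: "\<forall>x. (\<forall>i. x i \<in> H) \<longrightarrow>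
    (\<exists>c. (\<exists>i\<le>n. c i \<noteq> 0) \<and> (\<Sum>i\<le>(n::nat). zmul (c i) (x i :: 'a)) = 0)"
    using finite_rank_dependence[OF tf H fr] ..
  have mem: "(f ^^ i) z \<in> H" for i by (induction i) (use z f(2) in auto)
  have f0: "f 0 = 0" using f(1)[of 0 0] by simp
  have fsum: "f (sum g I) = (\<Sum>i\<in>I. f (g i))" for g :: "nat \<Rightarrow> 'a" and I
    by (rule sum_comp_morphism[symmetric, unfolded o_def]) (auto simp: f f0)
  have fz: "f (zmul k x) = zmul k (f x)" for k x by (rule zmul_hom[OF f(1)])
  have fm: "f (- x) = - f x" for x
    using f(1)[of x "- x"] f0 by (simp add: eq_neg_iff_add_eq_0 add.commute)
  have neg: "- x \<in> H" if "x \<in> H" for x using H that unfolding is_subgroup_def by blast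
  have "\<exists>M. M \<noteq> 0 \<and> (\<exists>y\<in>H. zmul M z = f y)"
    if "\<exists>i\<le>n. c i \<noteq> 0" "(\<Sum>i\<le>n. zmul (c i) ((f ^^ i) z)) = 0" for n c
    using that
  proof (induction n arbitrary: c)
    case 0
    then show ?case
      by (intro exI[of _ "c 0"] conjI bexI[of _ 0]) (use H f0 in \<open>auto simp: is_subgroup_def\<close>)
  next
    case (Suc n)
    let ?y = "\<Sum>i\<le>n. zmul (c (Suc i)) ((f ^^ i) z)"
    have y: "?y \<in> H" by (rule is_subgroup_sum[OF H]) (use mem is_subgroup_zmul[OF H] in auto)
    have e: "zmul (c 0) z + f ?y = 0"
      using Suc.prems(2) by (simp add: sum.atMost_Suc_shift fsum fz del: sum.atMost_Suc)
    show ?case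
    proof (cases "c 0 = 0")
      case True
      then have "f ?y = f 0" using e f0 by simp
      then have "?y = 0" using f(3) y H unfolding inj_on_def is_subgroup_def by blast
      moreover have "\<exists>i\<le>n. c (Suc i) \<noteq> 0"
        using Suc.prems(1) True by (metis Suc_le_mono not0_implies_Suc)
      ultimately show ?thesis using Suc.IH[of "\<lambda>i. c (Suc i)"] by simp
    next
      case False
      have "zmul (c 0) z = f (- ?y)"
        using e by (simp only: fm eq_neg_iff_add_eq_0)
      then show ?thesis using False neg[OF y] by blast
    qed
  qed
  then obtain M y where My: "M \<noteq> 0" "y \<in> H" "zmul M z = f y" using n[rule_format, of "\<lambda>i. (f ^^ i) z"] mem by blast
  show ?thesis
  proof (cases "0 < M")
    case False
    have "zmul (- M) z = f (- y)"
      using My(3) by (simp add: zmul_minus fm)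
    then show ?thesis using False My neg by (intro exI[of _ "- M"]) auto
  qed (use My in blast)
qed

section \<open>The Cayley-Hamilton theorem\<close>

text \<open>Comparing coefficients in C B = det C for the adjugate \<open>B\<close> of the
  characteristic matrix \<open>C\<close> gives relations that telescope after multiplication by
  powers of \<open>M\<close>. Stating the result for all large \<open>N\<close> leaves the degree of
  the characteristic polynomial out of the argument.\<close>

lemma cayley_hamilton_entry:
  fixes M :: "'a::comm_ring_1 mat"
  assumes M: "M \<in> carrier_mat n n" and ij: "i < n" "j < n"
  shows "\<exists>N0. \<forall>N\<ge>N0. (\<Sum>k\<le>N. coeff (char_poly M) k * (M ^\<^sub>m k) $$ (i, j)) = 0"
proof -
  define C where "C = char_poly_matrix M"
  define B where "B = adj_mat C"
  define b where "b k = mat n n (\<lambda>(i, j). coeff (B $$ (i, j)) k)" for k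
  \<comment> \<open>These are the coefficients of the indeterminate times \<open>B\<close>, hence
    those of \<open>B\<close> shifted by one place.\<close>
  define b' where "b' k = (case k of 0 \<Rightarrow> 0\<^sub>m n n | Suc l \<Rightarrow> b l)" for k
  let ?p = "coeff (char_poly M)"
  have C: "C \<in> carrier_mat n n" using M unfolding C_def by simp
  have B: "B \<in> carrier_mat n n" "C * B = char_poly M \<cdot>\<^sub>m 1\<^sub>m n"
    using adj_mat[OF C] unfolding B_def C_def char_poly_def by auto
  have b: "b k \<in> carrier_mat n n" for k unfolding b_def by simp
  have pow: "M ^\<^sub>m k \<in> carrier_mat n n" for k using M by simp
  have rel: "?p k \<cdot>\<^sub>m 1\<^sub>m n + M * b k = b' k" for k
  proof (rule eq_matI)
    fix i j assume "i < dim_row (b' k)" "j < dim_col (b' k)"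
    then have ij: "i < n" "j < n" by (auto simp: b'_def b_def split: nat.splits)
    have "(C * B) $$ (i, j) = (\<Sum>l<n. C $$ (i, l) * B $$ (l, j))"
      using C B(1) ij by (auto simp: scalar_prod_def atLeast0LessThan intro!: sum.cong)
    also have "\<dots> = (\<Sum>l<n. (if i = l then pCons 0 (B $$ (l, j)) else 0) - Polynomial.smult (M $$ (i, l)) (B $$ (l, j)))"
      by (rule sum.cong) (use M ij in \<open>auto simp: C_def char_poly_matrix_def\<close>)
    also have "\<dots> = pCons 0 (B $$ (i, j)) - (\<Sum>l<n. Polynomial.smult (M $$ (i, l)) (B $$ (l, j)))"
      using ij by (simp add: sum_subtractf)
    finally have "coeff ((char_poly M \<cdot>\<^sub>m 1\<^sub>m n) $$ (i, j)) k =
        coeff (pCons 0 (B $$ (i, j))) k - (\<Sum>l<n. M $$ (i, l) * coeff (B $$ (l, j)) k)"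
      unfolding B(2) by (simp add: coeff_sum)
    moreover have "(M * b k) $$ (i, j) = (\<Sum>l<n. M $$ (i, l) * coeff (B $$ (l, j)) k)"
      using M b[of k] ij by (auto simp: scalar_prod_def b_def atLeast0LessThan intro!: sum.cong)
    moreover have "b' k $$ (i, j) = coeff (pCons 0 (B $$ (i, j))) k"
      using ij by (auto simp: b'_def b_def coeff_pCons split: nat.splits)
    moreover have "coeff ((char_poly M \<cdot>\<^sub>m 1\<^sub>m n) $$ (i, j)) k = (?p k \<cdot>\<^sub>m 1\<^sub>m n) $$ (i, j)"
      using ij by auto
    ultimately have "(?p k \<cdot>\<^sub>m 1\<^sub>m n) $$ (i, j) + (M * b k) $$ (i, j) = b' k $$ (i, j)"
      by (simp only: diff_add_cancel)
    moreover have "(?p k \<cdot>\<^sub>m 1\<^sub>m n + M * b k) $$ (i, j) = (?p k \<cdot>\<^sub>m 1\<^sub>m n) $$ (i, j) + (M * b k) $$ (i, j)"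
      by (rule index_add_mat(1)) (use ij M b[of k] in auto)
    ultimately show "(?p k \<cdot>\<^sub>m 1\<^sub>m n + M * b k) $$ (i, j) = b' k $$ (i, j)" by (simp only:)
  qed (use M b in \<open>auto simp: b'_def b_def split: nat.splits\<close>)
  \<comment> \<open>Multiplied by the \<open>k\<close>-th power of \<open>M\<close>, the relation
    \<open>rel\<close> in degree \<open>k\<close> cancels against its neighbour, and one boundary
    term remains. It disappears once \<open>N\<close> exceeds all degrees in the adjugate.\<close>
  have tele: "(\<Sum>k\<le>N. ?p k * (M ^\<^sub>m k) $$ (i, j)) + (M ^\<^sub>m (Suc N) * b N) $$ (i, j) = 0" for N
  proof (induction N)
    case 0
    have "(?p 0 \<cdot>\<^sub>m 1\<^sub>m n + M * b 0) $$ (i, j) = 0" unfolding rel using ij by (simp add: b'_def)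
    then show ?case using ij M b[of 0] by simp
  next
    case (Suc N)
    have "M ^\<^sub>m (Suc N) * b N = M ^\<^sub>m (Suc N) * (?p (Suc N) \<cdot>\<^sub>m 1\<^sub>m n + M * b (Suc N))"
      unfolding rel by (simp add: b'_def)
    also have "\<dots> = M ^\<^sub>m (Suc N) * (?p (Suc N) \<cdot>\<^sub>m 1\<^sub>m n) + M ^\<^sub>m (Suc N) * (M * b (Suc N))"
      by (rule mult_add_distrib_mat[OF pow]) (use M b in auto)
    also have "M ^\<^sub>m (Suc N) * (?p (Suc N) \<cdot>\<^sub>m 1\<^sub>m n) = ?p (Suc N) \<cdot>\<^sub>m M ^\<^sub>m (Suc N)"
      using mult_smult_distrib[OF pow[of "Suc N"] one_carrier_mat, of "?p (Suc N)"]
        right_mult_one_mat[OF pow[of "Suc N"]] by (simp del: pow_mat.simps)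
    also have "M ^\<^sub>m (Suc N) * (M * b (Suc N)) = M ^\<^sub>m (Suc (Suc N)) * b (Suc N)"
      using assoc_mult_mat[OF pow[of "Suc N"] M b[of "Suc N"]] by simp
    finally have "(M ^\<^sub>m (Suc N) * b N) $$ (i, j) =
        ?p (Suc N) * (M ^\<^sub>m (Suc N)) $$ (i, j) + (M ^\<^sub>m (Suc (Suc N)) * b (Suc N)) $$ (i, j)"
      using ij carrier_matD[OF pow[of "Suc N"]] carrier_matD[OF pow[of "Suc (Suc N)"]]
        carrier_matD[OF b[of "Suc N"]] by (simp del: pow_mat.simps)
    then show ?case using Suc by (simp add: add.assoc del: pow_mat.simps)
  qed
  define N0 where "N0 = Suc (\<Sum>i<n. \<Sum>j<n. degree (B $$ (i, j)))"
  have deg: "degree (B $$ (i, j)) < N0" if "i < n" "j < n" for i j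
  proof -
    have "degree (B $$ (i, j)) \<le> (\<Sum>j<n. degree (B $$ (i, j)))"
      using that by (intro member_le_sum[of j "{..<n}" "\<lambda>j. degree (B $$ (i, j))"]) auto
    also have "\<dots> \<le> (\<Sum>i<n. \<Sum>j<n. degree (B $$ (i, j)))"
      using that by (intro member_le_sum[of i "{..<n}" "\<lambda>i. \<Sum>j<n. degree (B $$ (i, j))"]) auto
    finally show ?thesis unfolding N0_def by simp
  qed
  have "(\<Sum>k\<le>N. ?p k * (M ^\<^sub>m k) $$ (i, j)) = 0" if N: "N0 \<le> N" for N
  proof -
    have "coeff (B $$ (i, j)) N = 0" if "i < n" "j < n" for i j
      by (rule coeff_eq_0) (use deg[OF that] N in simp)
    then have "b N = 0\<^sub>m n n" unfolding b_def by (intro eq_matI) simp_all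
    then have "(M ^\<^sub>m (Suc N) * b N) $$ (i, j) = 0"
      using right_mult_zero_mat[OF pow[of "Suc N"], of n] ij by (simp del: pow_mat.simps)
    then show ?thesis using tele[of N] by (simp del: pow_mat.simps)
  qed
  then show ?thesis by blast
qed

lemma binomial_char_poly_pow:
  fixes M :: "'a::comm_ring_1 mat"
  assumes M: "M \<in> carrier_mat n n"
    and P: "Polynomial.smult \<mu> (char_poly M) = monom \<mu> \<delta> - [:\<nu>:]" and ij: "i < n" "j < n"
  shows "\<mu> * (M ^\<^sub>m \<delta>) $$ (i, j) = (if i = j then \<nu> else 0)"
proof -
  obtain N0 where N0: "\<forall>N\<ge>N0. (\<Sum>k\<le>N. coeff (char_poly M) k * (M ^\<^sub>m k) $$ (i, j)) = 0"
    using cayley_hamilton_entry[OF M ij] by blast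
  \<comment> \<open>The sum has to be in the range of Cayley-Hamilton and must also contain the
    index \<open>\<delta>\<close>.\<close>
  define N where "N = max N0 \<delta>"
  have c: "\<mu> * coeff (char_poly M) k = (if k = \<delta> then \<mu> else 0) - (if k = 0 then \<nu> else 0)" for k
    using arg_cong[OF P, of "\<lambda>p. coeff p k"] by (auto simp: coeff_pCons split: nat.splits)
  have "0 = \<mu> * (\<Sum>k\<le>N. coeff (char_poly M) k * (M ^\<^sub>m k) $$ (i, j))"
    using N0 unfolding N_def by simp
  also have "\<dots> = (\<Sum>k\<le>N. (\<mu> * coeff (char_poly M) k) * (M ^\<^sub>m k) $$ (i, j))"
    by (simp add: sum_distrib_left mult.assoc)
  also have "\<dots> = (\<Sum>k\<le>N. if k = \<delta> then \<mu> * (M ^\<^sub>m k) $$ (i, j) else 0)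
      - (\<Sum>k\<le>N. if k = 0 then \<nu> * (M ^\<^sub>m k) $$ (i, j) else 0)"
    unfolding c sum_subtractf[symmetric] by (rule sum.cong) (auto simp: left_diff_distrib)
  also have "\<dots> = \<mu> * (M ^\<^sub>m \<delta>) $$ (i, j) - \<nu> * (M ^\<^sub>m 0) $$ (i, j)"
    unfolding N_def by simp
  finally show ?thesis using ij M by (auto split: if_splits)
qed

text \<open>Cayley-Hamilton for a binomial says that \<open>\<mu>\<close> times the
  \<open>\<delta>\<close>-th power of the matrix is \<open>\<nu>\<close> times the identity. The
  work lies in carrying this from a rational basis back to elements of \<open>H\<close>, where only
  integer multiples make sense.\<close>

lemma is_charpoly_binomial:
  fixes f :: "'a::ab_group_add \<Rightarrow> 'a"
  assumes tf: "torsion_free_set (UNIV :: 'a set)" and H: "is_subgroup H"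
    and f: "\<And>x y. f (x + y) = f x + f y" "f ` H \<subseteq> H"
    and P: "is_charpoly H f P" "Polynomial.smult (of_nat \<mu>) P = monom (of_nat \<mu>) \<delta> - [:of_nat \<nu>:]"
    and pos: "0 < \<mu>" and x: "x \<in> H"
  shows "zmul (int \<mu>) ((f ^^ \<delta>) x) = zmul (int \<nu>) x"
proof -
  obtain vs M where vs: "q_basis H vs" and M: "M \<in> carrier_mat (length vs) (length vs)"
    and fM: "\<forall>j<length vs. qmap H f (vs ! j) = lincomb H (map (\<lambda>i. M $$ (i, j)) [0..<length vs]) vs"
    and PM: "P = char_poly M"
    using P(1) unfolding is_charpoly_def by blast
  let ?n = "length vs"
  have sp: "q_spans H vs" using vs unfolding q_basis_def by simp
  obtain a m where a: "\<And>i. i < ?n \<Longrightarrow> a i \<in> H" "\<And>i. i < ?n \<Longrightarrow> 0 < m i"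
    "\<And>i. i < ?n \<Longrightarrow> vs ! i = qcls H (a i, m i)"
    using QT_reps[of vs H] sp unfolding q_spans_def by auto
  have f0: "f 0 = 0" using f(1)[of 0 0] by simp
  have fd: "(f ^^ d) (x + y) = (f ^^ d) x + (f ^^ d) y" for d x y by (induction d) (auto simp: f)
  have fd0: "(f ^^ d) 0 = 0" for d by (induction d) (auto simp: f0)
  have fsum: "(f ^^ d) (sum g I) = (\<Sum>i\<in>I. (f ^^ d) (g i))" for d and g :: "nat \<Rightarrow> 'a" and I
    by (induction I rule: infinite_finite_induct) (auto simp: fd fd0)
  have fz: "(f ^^ d) (zmul k x) = zmul k ((f ^^ d) x)" for d k x by (rule zmul_hom[OF fd])
  have one: "zmul D (f (a j)) = zmul (m j) (\<Sum>i<?n. zmul (k i) (a i))"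
    if j: "j < ?n" and D: "0 < D" and k: "\<And>i. i < ?n \<Longrightarrow> of_int (k i) * of_int (m i) = of_int D * M $$ (i, j)"
    for D k j
  proof -
    let ?rs = "map (\<lambda>i. M $$ (i, j)) [0..<?n]"
    have k': "of_int (k i) * of_int (m i) = of_int D * ?rs ! i" if "i < ?n" for i
      using k[OF that] that by simp
    have S: "(\<Sum>i<?n. zmul (k i) (a i)) \<in> H"
      by (rule is_subgroup_sum[OF H]) (use a is_subgroup_zmul[OF H] in auto)
    have "qcls H (f (a j), m j) = qmap H f (vs ! j)"
      using a[OF j] qmap_qcls[OF tf f, of "a j" "m j"] by simp
    also have "\<dots> = lincomb H ?rs vs" using fM j by blast
    also have "\<dots> = qcls H (\<Sum>i<?n. zmul (k i) (a i), D)"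
      by (rule lincomb_qcls[OF tf H D _ a k']) auto
    finally show ?thesis
      using qcls_eq_iff[OF tf _ S, of "f (a j)" "m j" D] f(2) a[OF j] D by (simp add: image_subset_iff)
  qed
  \<comment> \<open>Powers of the matrix represent powers of \<open>f\<close>. The denominator
    \<open>D\<close> stays arbitrary because the induction step brings its own denominators
    \<open>D1\<close> and \<open>D2\<close>, which are cancelled at the end by
    torsion-freeness.\<close>
  have R: "zmul D ((f ^^ d) (a j)) = zmul (m j) (\<Sum>i<?n. zmul (k i) (a i))"
    if "j < ?n" "0 < D" "\<And>i. i < ?n \<Longrightarrow> of_int (k i) * of_int (m i) = of_int D * (M ^\<^sub>m d) $$ (i, j)"
    for D k j d
    using that
  proof (induction d arbitrary: j D k)
    case 0
    have k: "k i * m i = (if i = j then D else 0)" if "i < ?n" for i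
    proof -
      have "(of_int (k i * m i) :: rat) = of_int (if i = j then D else 0)"
        using 0(3)[OF that] that 0(1) M by simp
      then show ?thesis by (simp only: of_int_eq_iff)
    qed
    have "zmul (m j) (\<Sum>i<?n. zmul (k i) (a i)) = (\<Sum>i<?n. zmul (m j) (zmul (k i) (a i)))"
      by (rule zmul_sum)
    also have "\<dots> = (\<Sum>i<?n. if i = j then zmul D (a j) else 0)"
    proof (rule sum.cong[OF refl])
      fix i assume "i \<in> {..<?n}"
      then have i: "i < ?n" by simp
      show "zmul (m j) (zmul (k i) (a i)) = (if i = j then zmul D (a j) else 0)"
      proof (cases "i = j")
        case True
        then show ?thesis using k[OF i] by (simp add: mult.commute flip: zmul_mult)
      next
        case False
        then have "k i = 0" using k[OF i] a(2)[OF i] by auto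
        then show ?thesis using False by simp
      qed
    qed
    finally show ?case using 0(1) by simp
  next
    case (Suc d)
    obtain D1 k1 where D1: "0 < (D1::int)" "\<forall>l\<in>{..<?n}. of_int (k1 l) = of_int D1 * (M $$ (l, j) / of_int (m l))"
      using common_denominator[of "{..<?n}" "\<lambda>l. M $$ (l, j) / of_int (m l)"] by auto
    obtain D2 k2 where D2: "0 < (D2::int)" "\<forall>p\<in>{..<?n} \<times> {..<?n}. of_int (k2 p) = of_int D2 * ((M ^\<^sub>m d) $$ p / of_int (m (fst p)))"
      using common_denominator[of "{..<?n} \<times> {..<?n}" "\<lambda>p. (M ^\<^sub>m d) $$ p / of_int (m (fst p))"] by auto
    have k1: "of_int (k1 l) * of_int (m l) = of_int D1 * M $$ (l, j)" if "l < ?n" for l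
      using D1(2) a(2)[OF that] that by (simp add: field_simps)
    have k2: "of_int (k2 (i, l)) * of_int (m i) = of_int D2 * (M ^\<^sub>m d) $$ (i, l)" if "i < ?n" "l < ?n" for i l
      using D2(2) a(2)[OF that(1)] that by (simp add: field_simps)
    have f1: "zmul D1 (f (a j)) = zmul (m j) (\<Sum>l<?n. zmul (k1 l) (a l))"
      by (rule one[OF Suc.prems(1) D1(1) k1])
    have f2: "zmul D2 ((f ^^ d) (a l)) = zmul (m l) (\<Sum>i<?n. zmul (k2 (i, l)) (a i))" if "l < ?n" for l
      by (rule Suc.IH[OF that D2(1) k2[OF _ that]])
    have coef: "D * (\<Sum>l<?n. k1 l * (m l * k2 (i, l))) = D2 * D1 * k i" if i: "i < ?n" for i
    proof -
      have "(M ^\<^sub>m Suc d) $$ (i, j) = (\<Sum>l<?n. (M ^\<^sub>m d) $$ (i, l) * M $$ (l, j))"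
        using M i Suc.prems(1) by (auto simp: scalar_prod_def atLeast0LessThan intro!: sum.cong)
      then have "of_int (D2 * D1 * k i * m i) = (of_int (D2 * D1 * D) :: rat) * (\<Sum>l<?n. (M ^\<^sub>m d) $$ (i, l) * M $$ (l, j))"
        using Suc.prems(3)[OF i] by simp
      also have "\<dots> = of_int D * (\<Sum>l<?n. (of_int D2 * (M ^\<^sub>m d) $$ (i, l)) * (of_int D1 * M $$ (l, j)))"
        by (simp add: sum_distrib_left ac_simps)
      also have "\<dots> = of_int D * (\<Sum>l<?n. (of_int (k2 (i, l)) * of_int (m i)) * (of_int (k1 l) * of_int (m l)))"
        by (rule arg_cong[of _ _ "(*) (of_int D)"], rule sum.cong[OF refl]) (simp only: k1 k2[OF i] lessThan_iff)
      also have "\<dots> = of_int (D * (\<Sum>l<?n. k1 l * (m l * k2 (i, l))) * m i)"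
        by (simp add: sum_distrib_left sum_distrib_right ac_simps)
      finally show ?thesis using a(2)[OF i] by (simp only: of_int_eq_iff mult_cancel_right) auto
    qed
    have "zmul (D2 * D1) (zmul D ((f ^^ Suc d) (a j))) = zmul (D * D2) ((f ^^ d) (zmul D1 (f (a j))))"
      by (simp add: fz funpow_swap1 ac_simps flip: zmul_mult)
    also have "\<dots> = zmul D (zmul (m j) (\<Sum>l<?n. zmul (k1 l) (zmul D2 ((f ^^ d) (a l)))))"
      unfolding f1 fz fsum zmul_sum by (simp add: ac_simps flip: zmul_mult)
    also have "\<dots> = zmul D (zmul (m j) (\<Sum>l<?n. \<Sum>i<?n. zmul (k1 l * (m l * k2 (i, l))) (a i)))"
      by (simp add: f2 zmul_sum flip: zmul_mult)
    also have "(\<Sum>l<?n. \<Sum>i<?n. zmul (k1 l * (m l * k2 (i, l))) (a i)) =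
        (\<Sum>i<?n. zmul (\<Sum>l<?n. k1 l * (m l * k2 (i, l))) (a i))"
      unfolding zmul_sum_left by (rule sum.swap)
    also have "zmul D (zmul (m j) \<dots>) = zmul (m j) (\<Sum>i<?n. zmul (D * (\<Sum>l<?n. k1 l * (m l * k2 (i, l)))) (a i))"
      unfolding zmul_commute[of D] by (simp add: zmul_sum zmul_mult)
    also have "\<dots> = zmul (m j) (\<Sum>i<?n. zmul (D2 * D1 * k i) (a i))"
      by (intro arg_cong2[of _ _ _ _ zmul] refl sum.cong) (use coef in auto)
    also have "\<dots> = zmul (D2 * D1) (zmul (m j) (\<Sum>i<?n. zmul (k i) (a i)))"
      unfolding zmul_commute[of "D2 * D1"] by (simp add: zmul_sum zmul_mult)
    finally show ?case by (rule torsion_free_cancel[OF tf]) (use D1 D2 in auto)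
  qed
  have P': "Polynomial.smult (of_nat \<mu>) (char_poly M) = monom (of_nat \<mu>) \<delta> - [:of_nat \<nu>:]"
    using P(2) PM by simp
  have base: "zmul (int \<mu>) ((f ^^ \<delta>) (a j)) = zmul (int \<nu>) (a j)" if j: "j < ?n" for j
  proof -
    \<comment> \<open>Column \<open>j\<close> of the \<open>\<delta>\<close>-th power is \<nu> /
      \<mu> times a unit vector, so \<open>int \<mu> * m j\<close> is a denominator to which
      \<open>R\<close> applies, with integer coefficients read off directly.\<close>
    have "zmul (int \<mu> * m j) ((f ^^ \<delta>) (a j)) = zmul (m j) (\<Sum>i<?n. zmul (if i = j then int \<nu> else 0) (a i))"
    proof (rule R[OF j])
      show "0 < int \<mu> * m j" using pos a(2)[OF j] by simp
      fix i assume i: "i < ?n"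
      show "of_int (if i = j then int \<nu> else 0) * of_int (m i) = of_int (int \<mu> * m j) * (M ^\<^sub>m \<delta>) $$ (i, j)"
        using binomial_char_poly_pow[OF M P' i j] by (auto simp: mult.assoc mult.left_commute mult.commute)
    qed
    also have "(\<Sum>i<?n. zmul (if i = j then int \<nu> else 0) (a i)) = (\<Sum>i<?n. if i = j then zmul (int \<nu>) (a j) else 0)"
      by (rule sum.cong) auto
    finally have "zmul (m j) (zmul (int \<mu>) ((f ^^ \<delta>) (a j))) = zmul (m j) (zmul (int \<nu>) (a j))"
      using j by (simp add: mult.commute flip: zmul_mult)
    then show ?thesis by (rule torsion_free_cancel[OF tf]) (use a(2)[OF j] in auto)
  qed
  obtain D k where D: "0 < D" "zmul D x = (\<Sum>i<?n. zmul (k i) (a i))"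
    using q_spans_multiple[OF tf H sp a x] by blast
  have "zmul D (zmul (int \<mu>) ((f ^^ \<delta>) x)) = zmul (int \<mu>) ((f ^^ \<delta>) (zmul D x))"
    by (simp add: fz zmul_commute)
  also have "\<dots> = (\<Sum>i<?n. zmul (k i) (zmul (int \<mu>) ((f ^^ \<delta>) (a i))))"
    unfolding D(2) fsum zmul_sum fz by (simp add: zmul_commute)
  also have "\<dots> = (\<Sum>i<?n. zmul (k i) (zmul (int \<nu>) (a i)))" by (simp add: base)
  also have "\<dots> = zmul (int \<nu>) (zmul D x)" unfolding D(2) zmul_sum by (simp add: zmul_commute)
  also have "\<dots> = zmul D (zmul (int \<nu>) x)" by (rule zmul_commute)
  finally show ?thesis by (rule torsion_free_cancel[OF tf]) (use D in auto)
qed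

section \<open>Polynomials in an endomorphism\<close>

text \<open>The module structure over integer polynomials in which the indeterminate acts as
  \<open>M\<close>. The group has no division, so coefficients are integers and divisions of
  polynomials become pseudo-divisions.\<close>

definition poly_act :: "('b::ab_group_add \<Rightarrow> 'b) \<Rightarrow> int poly \<Rightarrow> 'b \<Rightarrow> 'b" where
  "poly_act M f x = (\<Sum>i\<le>degree f. zmul (coeff f i) ((M ^^ i) x))"

locale additive_endo =
  fixes M :: "'b::ab_group_add \<Rightarrow> 'b"
  assumes add: "M (x + y) = M x + M y"
begin

lemma zero: "M 0 = 0"
  using add[of 0 0] by simp

lemma pow_add: "(M ^^ i) (x + y) = (M ^^ i) x + (M ^^ i) y"
  by (induction i) (auto simp: add)

lemma endo_sum: "M (sum g I) = (\<Sum>i\<in>I. M (g i))"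
  by (induction I rule: infinite_finite_induct) (auto simp: add zero)

lemma endo_zmul: "M (zmul k x) = zmul k (M x)"
  by (rule zmul_hom[OF add])

lemma poly_act_bound:
  assumes "degree f \<le> N"
  shows "poly_act M f x = (\<Sum>i\<le>N. zmul (coeff f i) ((M ^^ i) x))"
  unfolding poly_act_def
  by (rule sum.mono_neutral_left) (use assms in \<open>auto simp: coeff_eq_0\<close>)

lemma poly_act_0 [simp]: "poly_act M 0 x = 0"
  by (simp add: poly_act_def)

lemma poly_act_add_right: "poly_act M f (x + y) = poly_act M f x + poly_act M f y"
  by (simp add: poly_act_def pow_add zmul_add_right sum.distrib)

lemma poly_act_zmul: "poly_act M f (zmul k x) = zmul k (poly_act M f x)"
  by (rule zmul_hom[OF poly_act_add_right])

lemma poly_act_zero [simp]: "poly_act M f 0 = 0"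
  using poly_act_add_right[of f 0 0] by simp

lemma poly_act_sum: "poly_act M f (sum g I) = (\<Sum>i\<in>I. poly_act M f (g i))"
  by (induction I rule: infinite_finite_induct) (auto simp: poly_act_add_right)

lemma poly_act_add: "poly_act M (f + g) x = poly_act M f x + poly_act M g x"
proof -
  let ?N = "max (degree f) (degree g)"
  have "degree (f + g) \<le> ?N" by (rule degree_add_le_max)
  then show ?thesis
    by (simp add: poly_act_bound[of _ ?N] zmul_add_left sum.distrib)
qed

lemma poly_act_smult: "poly_act M (Polynomial.smult c f) x = zmul c (poly_act M f x)"
  by (simp add: poly_act_bound[of _ "degree f"] zmul_mult zmul_sum)

lemma poly_act_diff: "poly_act M (f - g) x = poly_act M f x - poly_act M g x"
  using poly_act_add[of "f - g" g x] by (simp add: eq_diff_eq)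

lemma poly_act_pCons: "poly_act M (pCons c f) x = zmul c x + M (poly_act M f x)"
proof -
  have "degree (pCons c f) \<le> Suc (degree f)" by (rule degree_pCons_le)
  then show ?thesis
    by (simp add: poly_act_bound[of _ "Suc (degree f)"] sum.atMost_Suc_shift endo_sum endo_zmul
        poly_act_def del: sum.atMost_Suc)
qed

lemma poly_act_mult: "poly_act M (f * g) x = poly_act M f (poly_act M g x)"
  by (induction f) (auto simp: poly_act_pCons poly_act_add poly_act_smult mult_pCons_left)

lemma poly_act_monom: "poly_act M (monom 1 k) x = (M ^^ k) x"
proof (induction k)
  case 0
  show ?case unfolding monom_0 by (simp add: poly_act_pCons zero)
next
  case (Suc k)
  then show ?case by (simp add: monom_Suc poly_act_pCons)
qed

lemma poly_act_pcompose_monom: "poly_act M (pcompose f (monom 1 k)) x = poly_act (M ^^ k) f x"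
proof -
  interpret Mk: additive_endo "M ^^ k" by unfold_locales (rule pow_add)
  show ?thesis
  proof (induction f)
    case (pCons c f)
    have "poly_act M [:c:] x = zmul c x" by (simp add: poly_act_pCons zero)
    then show ?case using pCons
      by (simp add: pcompose_pCons poly_act_add poly_act_mult poly_act_monom Mk.poly_act_pCons)
  qed simp
qed

text \<open>Dependence of the iterates of a single vector gives a polynomial killing it. The product
  over the numerators of a spanning list kills all of these, hence a multiple of every vector, hence
  every vector.\<close>

lemma exists_annihilator:
  assumes tf: "torsion_free_set (UNIV :: 'b set)" and fr: "finite_rank (UNIV :: 'b set)"
  shows "\<exists>f. f \<noteq> 0 \<and> (\<forall>x. poly_act M f x = 0)"
proof -
  have sub: "is_subgroup (UNIV :: 'b set)" by simp
  have loc: "\<exists>f. f \<noteq> 0 \<and> poly_act M f x = 0" for x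
  proof -
    obtain n where "\<forall>y. (\<forall>i. y i \<in> (UNIV::'b set)) \<longrightarrow>
      (\<exists>c. (\<exists>i\<le>n. c i \<noteq> 0) \<and> (\<Sum>i\<le>(n::nat). zmul (c i) (y i)) = 0)"
      using finite_rank_dependence[OF tf sub fr] ..
    then obtain c where c: "\<exists>i\<le>n. c i \<noteq> 0" "(\<Sum>i\<le>n. zmul (c i) ((M ^^ i) x)) = 0"
      by (elim allE[of _ "\<lambda>i. (M ^^ i) x"]) auto
    define f where "f = (\<Sum>i\<le>n. monom (c i) i)"
    have cf: "coeff f i = (if i \<le> n then c i else 0)" for i
      unfolding f_def coeff_sum by (auto simp: coeff_monom)
    have "degree f \<le> n" by (rule degree_le) (simp add: cf)
    then have "poly_act M f x = (\<Sum>i\<le>n. zmul (coeff f i) ((M ^^ i) x))" by (rule poly_act_bound)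
    also have "\<dots> = 0" using c(2) by (simp add: cf)
    finally have "poly_act M f x = 0" .
    moreover have "f \<noteq> 0"
    proof
      assume "f = 0"
      moreover obtain i where "i \<le> n" "c i \<noteq> 0" using c(1) by blast
      ultimately show False using cf[of i] by simp
    qed
    ultimately show ?thesis by blast
  qed
  obtain vs where vs: "q_spans (UNIV::'b set) vs" using fr unfolding finite_rank_def by blast
  obtain a m where a: "\<And>i. i < length vs \<Longrightarrow> a i \<in> (UNIV::'b set)" "\<And>i. i < length vs \<Longrightarrow> 0 < m i"
    "\<And>i. i < length vs \<Longrightarrow> vs ! i = qcls UNIV (a i, m i)"
    using QT_reps[of vs "UNIV::'b set"] vs unfolding q_spans_def by auto
  have "\<forall>i. \<exists>f. f \<noteq> 0 \<and> poly_act M f (a i) = 0" using loc by blast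
  from choice[OF this] obtain f where f: "\<And>i. f i \<noteq> 0" "\<And>i. poly_act M (f i) (a i) = 0" by blast
  define F where "F = (\<Prod>i<length vs. f i)"
  have F0: "F \<noteq> 0" unfolding F_def using f(1) by simp
  have Fa: "poly_act M F (a i) = 0" if "i < length vs" for i
  proof -
    have "F = (\<Prod>i\<in>{..<length vs} - {i}. f i) * f i"
      unfolding F_def using that by (subst prod.remove[of _ i]) (auto simp: mult.commute)
    then show ?thesis by (simp add: poly_act_mult f)
  qed
  have "poly_act M F x = 0" for x
  proof -
    obtain D k where D: "0 < D" "zmul D x = (\<Sum>i<length vs. zmul (k i) (a i))"
      using q_spans_multiple[OF tf sub vs a UNIV_I] by blast
    have "zmul D (poly_act M F x) = poly_act M F (zmul D x)" by (simp add: poly_act_zmul)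
    also have "\<dots> = 0" unfolding D(2) poly_act_sum by (simp add: poly_act_zmul Fa)
    finally show ?thesis using torsion_freeD[OF tf] D(1) by blast
  qed
  then show ?thesis using F0 by blast
qed

end

section \<open>Integer polynomials and roots of unity\<close>

lemma pseudo_division:
  fixes f g :: "int poly"
  assumes "g \<noteq> 0"
  shows "\<exists>c q r. c \<noteq> 0 \<and> Polynomial.smult c f = g * q + r \<and> (r = 0 \<or> degree r < degree g)"
proof -
  obtain q r where "pseudo_divmod f g = (q, r)" by (cases "pseudo_divmod f g")
  from pseudo_divmod[OF assms this] show ?thesis
    using assms by (intro exI[of _ "lead_coeff g ^ (Suc (degree f) - degree g)"] exI[of _ q] exI[of _ r]) auto
qed

lemma exists_least_degree:
  assumes "\<exists>f::int poly. P f"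
  shows "\<exists>f. P f \<and> (\<forall>g. P g \<longrightarrow> degree f \<le> degree g)"
  using assms ex_has_least_nat[of P _ degree] by blast

abbreviation cpoly :: "int poly \<Rightarrow> complex \<Rightarrow> complex" where
  "cpoly f \<equiv> poly (map_poly of_int f)"

lemma cpoly_pcompose_monom: "cpoly (pcompose f (monom 1 k)) z = cpoly f (z ^ k)"
proof (induction f)
  case (pCons a f)
  have "cpoly [:a:] z = of_int a" by (cases "a = 0") (simp_all add: map_poly_pCons)
  then show ?case using pCons
    by (simp add: pcompose_pCons map_poly_pCons of_int_poly_hom.hom_add of_int_poly_hom.hom_mult
        poly_monom map_poly_monom)
qed simp

text \<open>The orbit of \<open>z\<close> under the \<open>k\<close>-th power map is finite, so two
  different exponents \<open>k ^ i\<close> and \<open>k ^ j\<close> give the same power of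
  \<open>z\<close>, and the smaller one can be cancelled.\<close>

lemma root_of_unity_if_power_orbit_finite:
  fixes z :: complex
  assumes "finite R" "z \<in> R" "z \<noteq> 0" "2 \<le> k" "\<And>w. w \<in> R \<Longrightarrow> w ^ k \<in> R"
  shows "\<exists>n>0. z ^ n = 1"
proof -
  have "z ^ (k ^ i) \<in> R" for i
  proof (induction i)
    case (Suc i)
    then show ?case using assms(5)[of "z ^ (k ^ i)"] by (simp add: mult.commute flip: power_mult)
  qed (use assms in simp)
  then have "finite (range (\<lambda>i. z ^ (k ^ i)))" using assms(1) by (meson finite_subset image_subsetI)
  then have "\<not> inj (\<lambda>i::nat. z ^ (k ^ i))" using finite_imageD infinite_UNIV_nat by blast
  then obtain i j :: nat where ij: "i < j" "z ^ (k ^ i) = z ^ (k ^ j)"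
    by (auto simp: inj_def) (metis linorder_neqE_nat)
  have "k ^ i < k ^ j" using ij(1) assms(4) by (intro power_strict_increasing) auto
  moreover from this have "z ^ (k ^ j) = z ^ (k ^ i) * z ^ (k ^ j - k ^ i)" by (simp flip: power_add)
  ultimately show ?thesis using ij(2) assms(3) by (intro exI[of _ "k ^ j - k ^ i"]) auto
qed

text \<open>The complex roots of a minimal annihilating polynomial of \<open>M\<close> form a finite set that is closed under
  \<open>z \<mapsto> z ^ k\<close>, so they are roots of unity.\<close>

lemma fixed_vector_if_conj_to_power:
  fixes M U :: "'b::ab_group_add \<Rightarrow> 'b"
  assumes tf: "torsion_free_set (UNIV :: 'b set)" and fr: "finite_rank (UNIV :: 'b set)"
    and M: "\<And>x y. M (x + y) = M x + M y" "inj M"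
    and U: "\<And>x y. U (x + y) = U x + U y" "surj U"
    and k: "2 \<le> k" and conj: "\<And>x. U (M x) = (M ^^ k) (U x)" and nz: "\<exists>x::'b. x \<noteq> 0"
  shows "\<exists>n>0. \<exists>w. w \<noteq> 0 \<and> (M ^^ n) w = w"
proof -
  interpret additive_endo M by unfold_locales (rule M)
  interpret U: additive_endo U by unfold_locales (rule U)
  obtain f where f: "f \<noteq> 0" "\<And>x. poly_act M f x = 0"
    and fmin: "\<And>g. g \<noteq> 0 \<Longrightarrow> \<forall>x. poly_act M g x = 0 \<Longrightarrow> degree f \<le> degree g"
    using exists_least_degree[OF exists_annihilator[OF tf fr]] by blast
  have fpos: "degree f > 0"
  proof (rule ccontr)
    assume "\<not> ?thesis"
    then obtain c where c: "f = [:c:]" using degree_eq_zeroE by blast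
    obtain x :: 'b where x: "x \<noteq> 0" using nz by blast
    have "zmul c x = 0" using f(2)[of x] by (simp add: c poly_act_pCons zero)
    then show False using torsion_freeD[OF tf] x f(1) c by auto
  qed
  \<comment> \<open>Injectivity of \<open>M\<close> would allow cancelling a factor of the
    indeterminate, against minimality of the degree. This keeps 0 out of the roots of
    \<open>f\<close>.\<close>
  have f0: "coeff f 0 \<noteq> 0"
  proof
    assume f0: "coeff f 0 = 0"
    obtain c g where g: "f = pCons c g" by (cases f)
    then have "c = 0" using f0 by simp
    have "poly_act M g x = 0" for x
    proof -
      have "M (poly_act M g x) = M 0" using f(2)[of x] by (simp add: g \<open>c = 0\<close> poly_act_pCons zero)
      then show ?thesis using M(2) by (simp only: inj_eq)
    qed
    moreover have "g \<noteq> 0" using g \<open>c = 0\<close> f(1) by auto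
    ultimately have "degree f \<le> degree g" using fmin by blast
    then show False using g \<open>g \<noteq> 0\<close> by simp
  qed
  have UM: "((M ^^ k) ^^ i) (U x) = U ((M ^^ i) x)" for i x
    by (induction i) (auto simp: conj)
  \<comment> \<open>\<open>U\<close> intertwines \<open>f\<close> evaluated at \<open>M\<close> with
    \<open>f\<close> evaluated at \<open>M ^^ k\<close>, and it is onto. So f(X^k) annihilates as
    well, and minimality makes \<open>f\<close> divide it up to a scalar.\<close>
  have kill: "poly_act M (pcompose f (monom 1 k)) y = 0" for y
  proof -
    obtain x where x: "y = U x" using U(2) by (metis surjE)
    have "poly_act (M ^^ k) f (U x) = U (poly_act M f x)"
      unfolding poly_act_def UM by (simp add: U.endo_sum U.endo_zmul)
    then show ?thesis by (simp add: poly_act_pcompose_monom x f U.zero)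
  qed
  obtain c q r where cqr: "c \<noteq> 0" "Polynomial.smult c (pcompose f (monom 1 k)) = f * q + r"
    "r = 0 \<or> degree r < degree f"
    using pseudo_division[OF f(1), of "pcompose f (monom 1 k)"] by blast
  have "poly_act M r x = 0" for x
    using arg_cong[OF cqr(2), of "\<lambda>p. poly_act M p x"]
    by (simp add: poly_act_smult kill poly_act_add poly_act_mult f(2))
  then have "r = 0" using fmin[of r] cqr(3) by (meson not_le)
  then have fk: "Polynomial.smult c (pcompose f (monom 1 k)) = f * q" using cqr(2) by simp
  define R where "R = {z. cpoly f z = 0}"
  have "map_poly of_int f \<noteq> (0::complex poly)" using f(1) by simp
  then have "finite R" unfolding R_def by (rule poly_roots_finite)
  have Rk: "z ^ k \<in> R" if "z \<in> R" for z
  proof -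
    have "of_int c * cpoly f (z ^ k) = cpoly f z * cpoly q z"
      using arg_cong[OF fk, of "\<lambda>p. cpoly p z"]
      by (simp add: of_int_hom.map_poly_hom_smult of_int_poly_hom.hom_mult cpoly_pcompose_monom)
    then show ?thesis using that cqr(1) unfolding R_def by simp
  qed
  have "\<not> constant (cpoly f)" using fpos by (simp add: constant_degree)
  then obtain z where z: "cpoly f z = 0" using fundamental_theorem_of_algebra by blast
  have "z \<noteq> 0" using z f0 by (auto simp: poly_0_coeff_0)
  then obtain n where n: "n > 0" "z ^ n = 1"
    using root_of_unity_if_power_orbit_finite[OF \<open>finite R\<close> _ _ k Rk] z unfolding R_def by blast
  \<comment> \<open>\<open>g\<close> is, up to a scalar, the minimal polynomial of the root of unity
    \<open>z\<close>, so it divides both \<open>f\<close> and X^n - 1 up to scalars. The cofactor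
    \<open>q1\<close> of \<open>g\<close> in \<open>f\<close> has smaller degree than
    \<open>f\<close> and does not annihilate; a nonzero vector in its image is killed by
    \<open>g\<close>, hence fixed by \<open>M ^^ n\<close>.\<close>
  obtain g where g: "g \<noteq> 0" "cpoly g z = 0"
    and gmin: "\<And>h. h \<noteq> 0 \<Longrightarrow> cpoly h z = 0 \<Longrightarrow> degree g \<le> degree h"
    using exists_least_degree[of "\<lambda>g. g \<noteq> 0 \<and> cpoly g z = 0"] f(1) z by blast
  have gpos: "degree g > 0"
  proof (rule ccontr)
    assume "\<not> ?thesis"
    then obtain c where "g = [:c:]" using degree_eq_zeroE by blast
    then show False using g by simp
  qed
  have gdvd: "\<exists>c q. c \<noteq> 0 \<and> Polynomial.smult c h = g * q" if h: "cpoly h z = 0" for h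
  proof -
    obtain c q r where cqr: "c \<noteq> 0" "Polynomial.smult c h = g * q + r" "r = 0 \<or> degree r < degree g"
      using pseudo_division[OF g(1), of h] by blast
    have "cpoly r z = 0"
      using arg_cong[OF cqr(2), of "\<lambda>p. cpoly p z"] h g(2)
      by (simp add: of_int_hom.map_poly_hom_smult of_int_poly_hom.hom_mult of_int_poly_hom.hom_add)
    then have "r = 0" using gmin[of r] cqr(3) by (meson not_le)
    then show ?thesis using cqr by auto
  qed
  obtain c1 q1 where q1: "c1 \<noteq> 0" "Polynomial.smult c1 f = g * q1" using gdvd[OF z] by blast
  have q1nz: "q1 \<noteq> 0" using q1 f(1) by auto
  have "degree f = degree g + degree q1"
    using arg_cong[OF q1(2), of degree] q1(1) g(1) q1nz by (simp add: degree_mult_eq)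
  then have "\<not> degree f \<le> degree q1" using gpos by simp
  then obtain y where y: "poly_act M q1 y \<noteq> 0" using fmin[OF q1nz] by blast
  define w where "w = poly_act M q1 y"
  have gw: "poly_act M g w = 0"
    using arg_cong[OF q1(2), of "\<lambda>p. poly_act M p y"] unfolding w_def
    by (simp add: poly_act_smult poly_act_mult f(2))
  have "cpoly (monom 1 n - 1) z = 0"
    using n by (simp add: of_int_poly_hom.hom_minus map_poly_monom poly_monom)
  then obtain c2 q2 where q2: "c2 \<noteq> 0" "Polynomial.smult c2 (monom 1 n - 1) = g * q2" using gdvd by blast
  have "poly_act M 1 w = w" using poly_act_monom[of 0 w] by simp
  then have "zmul c2 ((M ^^ n) w - w) = 0"
    using arg_cong[OF q2(2), of "\<lambda>p. poly_act M p w"] gw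
    by (simp add: poly_act_smult poly_act_diff poly_act_monom poly_act_mult mult.commute[of g])
  then have "(M ^^ n) w = w" using torsion_freeD[OF tf] q2(1) by (metis right_minus_eq)
  then show ?thesis using n(1) y w_def by blast
qed

section \<open>Constructible subgroups and the completion\<close>

lemma coset_eq_iff:
  assumes "is_subgroup K"
  shows "(+) a ` K = (+) b ` K \<longleftrightarrow> a - b \<in> (K::'a::ab_group_add set)"
proof
  assume e: "(+) a ` K = (+) b ` K"
  have "0 \<in> K" using assms unfolding is_subgroup_def by blast
  then have "a \<in> (+) a ` K" by (intro image_eqI[of _ _ 0]) auto
  then have "a \<in> (+) b ` K" using e by simp
  then show "a - b \<in> K" by auto
next
  assume ab: "a - b \<in> K"
  have sub: "(+) a ` K \<subseteq> (+) b ` K" if "a - b \<in> K" for a b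
  proof
    fix x assume "x \<in> (+) a ` K"
    then obtain k where "k \<in> K" "x = a + k" by blast
    then have "(a - b) + k \<in> K" "x = b + ((a - b) + k)" using that assms unfolding is_subgroup_def by auto
    then show "x \<in> (+) b ` K" by blast
  qed
  have "b - a \<in> K" using ab assms unfolding is_subgroup_def by (metis minus_diff_eq)
  then show "(+) a ` K = (+) b ` K" using sub ab by blast
qed

lemma finite_index_iff:
  fixes K :: "'a::ab_group_add set"
  assumes "is_subgroup K"
  shows "finite_index H K \<longleftrightarrow> (\<exists>R. finite R \<and> (\<forall>h\<in>H. \<exists>r\<in>R. h - r \<in> K))"
proof
  assume "finite_index H K"
  from finite_subset_image[OF this[unfolded finite_index_def] order_refl]
  obtain R where R: "R \<subseteq> H" "finite R" "(\<lambda>a. (+) a ` K) ` H = (\<lambda>a. (+) a ` K) ` R"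
    by (elim exE conjE)
  have "\<exists>r\<in>R. h - r \<in> K" if "h \<in> H" for h
  proof -
    have "(+) h ` K \<in> (\<lambda>a. (+) a ` K) ` R" unfolding R(3)[symmetric] using that by (rule imageI)
    then obtain r where "r \<in> R" "(+) h ` K = (+) r ` K" by (elim imageE)
    then show ?thesis using coset_eq_iff[OF assms] by blast
  qed
  then show "\<exists>R. finite R \<and> (\<forall>h\<in>H. \<exists>r\<in>R. h - r \<in> K)" using R(2) by blast
next
  assume "\<exists>R. finite R \<and> (\<forall>h\<in>H. \<exists>r\<in>R. h - r \<in> K)"
  then obtain R where R: "finite R" "\<And>h. h \<in> H \<Longrightarrow> \<exists>r\<in>R. h - r \<in> K" by blast
  have "(\<lambda>a. (+) a ` K) ` H \<subseteq> (\<lambda>a. (+) a ` K) ` R"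
  proof (rule image_subsetI)
    fix h assume "h \<in> H"
    then obtain r where "r \<in> R" "h - r \<in> K" using R(2) by blast
    then show "(+) h ` K \<in> (\<lambda>a. (+) a ` K) ` R"
      using coset_eq_iff[OF assms, of h r] by (intro image_eqI[of _ _ r]) simp_all
  qed
  then show "finite_index H K" unfolding finite_index_def by (rule finite_subset) (simp add: R(1))
qed

locale std_action =
  fixes S :: "'g::group_add set" and A :: "'a::ab_group_add set" and \<sigma> :: "'g \<Rightarrow> 'a \<Rightarrow> 'a"
  assumes std: "std_alg_action S A \<sigma>"
begin

abbreviation "\<C> \<equiv> constructible S A \<sigma>"

lemma S_monoid: "0 \<in> S" "s \<in> S \<Longrightarrow> t \<in> S \<Longrightarrow> s + t \<in> S"
  using std unfolding std_alg_action_def is_submonoid_def by auto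

lemma subgroup_A: "is_subgroup A"
  using std unfolding std_alg_action_def by auto

lemma act_0 [simp]: "\<sigma> 0 x = x"
  using std unfolding std_alg_action_def by auto

lemma act_add: "\<sigma> (g + h) x = \<sigma> g (\<sigma> h x)"
  using std unfolding std_alg_action_def by auto

lemma act_hom: "\<sigma> g (x + y) = \<sigma> g x + \<sigma> g y"
  using std unfolding std_alg_action_def by auto

lemma act_minus_cancel [simp]: "\<sigma> (- g) (\<sigma> g x) = x" "\<sigma> g (\<sigma> (- g) x) = x"
  using act_add[of "- g" g x] act_add[of g "- g" x] by simp_all

lemma act_inj: "\<sigma> g x = \<sigma> g y \<Longrightarrow> x = y"
  by (metis act_minus_cancel(1))

lemma act_zero [simp]: "\<sigma> g 0 = 0"
  using act_hom[of g 0 0] by simp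

lemma act_diff: "\<sigma> g (x - y) = \<sigma> g x - \<sigma> g y"
  using act_hom[of g "x - y" y] by (simp add: eq_diff_eq)

lemma act_zmul: "\<sigma> g (zmul k x) = zmul k (\<sigma> g x)"
  by (rule zmul_hom[OF act_hom])

lemma gen_S: "gen_subgroup S = UNIV"
  using std unfolding std_alg_action_def by auto

lemma gen_A: "gen_subgroup (\<Union>g. \<sigma> g ` A) = UNIV"
  using std unfolding std_alg_action_def by auto

lemma act_A: "s \<in> S \<Longrightarrow> a \<in> A \<Longrightarrow> \<sigma> s a \<in> A"
  using std unfolding std_alg_action_def by blast

lemma finite_index_act: "s \<in> S \<Longrightarrow> finite_index A (\<sigma> s ` A)"
  using std unfolding std_alg_action_def by auto

lemma eq_0_if_fixes:
  "C \<in> \<C> \<Longrightarrow> (\<And>c. c \<in> C \<Longrightarrow> \<sigma> g c = c) \<Longrightarrow> g = 0"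
proof -
  have "\<forall>g. \<forall>C\<in>\<C>. (\<forall>c\<in>C. \<sigma> g c = c) \<longrightarrow> g = 0"
    using std unfolding std_alg_action_def by (elim conjE)
  then show "C \<in> \<C> \<Longrightarrow> (\<And>c. c \<in> C \<Longrightarrow> \<sigma> g c = c) \<Longrightarrow> g = 0" by blast
qed

lemma is_subgroup_act_image: "is_subgroup C \<Longrightarrow> is_subgroup (\<sigma> g ` C)"
proof -
  assume C: "is_subgroup C"
  have "- \<sigma> g x = \<sigma> g (- x)" for x using act_diff[of g 0 x] by simp
  then show ?thesis using C unfolding is_subgroup_def
    by (auto simp flip: act_hom intro!: image_eqI[of 0 _ 0])
qed

lemma constructible_subgroup: "C \<in> \<C> \<Longrightarrow> is_subgroup C \<and> C \<subseteq> A"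
proof (induction rule: constructible.induct)
  case top
  then show ?case using subgroup_A by simp
next
  case (img C s)
  then show ?case using is_subgroup_act_image act_A by blast
next
  case (pre C s)
  have "\<sigma> s (- x) = - \<sigma> s x" for x using act_diff[of s 0 x] by simp
  then show ?case using pre subgroup_A unfolding is_subgroup_def by (auto simp: act_hom)
qed

text \<open>For an image, representatives modulo \<sigma>_s(A), which exist by (FI), are combined
  with images of representatives modulo \<open>C\<close>. For a preimage, one element is chosen for
  every coset of \<open>C\<close> that \<sigma>_s reaches.\<close>

lemma constructible_finite_index: "C \<in> \<C> \<Longrightarrow> finite_index A C"
proof (induction rule: constructible.induct)
  case top
  show ?case unfolding finite_index_iff[OF subgroup_A]
    by (rule exI[of _ "{0}"]) auto
next
  case (img C s)
  have C: "is_subgroup C" using constructible_subgroup img by blast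
  obtain R where R: "finite R" "\<And>h. h \<in> A \<Longrightarrow> \<exists>r\<in>R. h - r \<in> C"
    using img.IH unfolding finite_index_iff[OF C] by blast
  obtain Q where Q: "finite Q" "\<And>h. h \<in> A \<Longrightarrow> \<exists>q\<in>Q. h - q \<in> \<sigma> s ` A"
    using finite_index_act[OF img.hyps(2)]
    unfolding finite_index_iff[OF is_subgroup_act_image[OF subgroup_A]] by blast
  show ?case unfolding finite_index_iff[OF is_subgroup_act_image[OF C]]
  proof (intro exI[of _ "(\<lambda>(q, r). q + \<sigma> s r) ` (Q \<times> R)"] conjI ballI)
    fix h assume "h \<in> A"
    then obtain q a where q: "q \<in> Q" "a \<in> A" "h - q = \<sigma> s a" using Q(2) by blast
    obtain r where r: "r \<in> R" "a - r \<in> C" using R(2) q by blast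
    have "h - (q + \<sigma> s r) = \<sigma> s (a - r)" using q(3) by (simp add: act_diff algebra_simps)
    then show "\<exists>r\<in>(\<lambda>(q, r). q + \<sigma> s r) ` (Q \<times> R). h - r \<in> \<sigma> s ` C"
      using q r by (intro bexI[of _ "q + \<sigma> s r"]) auto
  qed (use Q R in auto)
next
  case (pre C s)
  have C: "is_subgroup C" using constructible_subgroup pre by blast
  have P: "is_subgroup {a \<in> A. \<sigma> s a \<in> C}"
    using constructible_subgroup constructible.pre[OF pre.hyps] by blast
  obtain R where R: "finite R" "\<And>h. h \<in> A \<Longrightarrow> \<exists>r\<in>R. h - r \<in> C"
    using pre.IH unfolding finite_index_iff[OF C] by blast
  \<comment> \<open>For a coset that \<open>\<sigma> s\<close> misses the value is arbitrary; such
    an \<open>r\<close> is never selected below.\<close>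
  define e where "e r = (SOME a. a \<in> A \<and> \<sigma> s a - r \<in> C)" for r
  show ?case unfolding finite_index_iff[OF P]
  proof (intro exI[of _ "e ` R"] conjI ballI)
    fix h assume h: "h \<in> A"
    then obtain r where r: "r \<in> R" "\<sigma> s h - r \<in> C" using R(2) act_A[OF pre.hyps(2)] by blast
    have e: "e r \<in> A \<and> \<sigma> s (e r) - r \<in> C"
      unfolding e_def by (rule someI[of _ h]) (use h r in auto)
    have "\<sigma> s (h - e r) = (\<sigma> s h - r) - (\<sigma> s (e r) - r)" by (simp add: act_diff)
    then have "\<sigma> s (h - e r) \<in> C" using is_subgroup_diff[OF C] r e by metis
    moreover have "h - e r \<in> A" using is_subgroup_diff[OF subgroup_A] h e by blast
    ultimately show "\<exists>r\<in>e ` R. h - r \<in> {a \<in> A. \<sigma> s a \<in> C}" using r by blast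
  qed (use R in auto)
qed

text \<open>Intersecting with \<open>D\<close> is moved inside: an image meets \<open>D\<close> in
  the image of \<open>C\<close> intersected with the preimage of \<open>D\<close>, and dually, by
  injectivity, for a preimage. The induction hypothesis is thus used for another group than
  \<open>D\<close>.\<close>

lemma constructible_inter: "C \<in> \<C> \<Longrightarrow> D \<in> \<C> \<Longrightarrow> C \<inter> D \<in> \<C>"
proof (induction arbitrary: D rule: constructible.induct)
  case top
  then have "A \<inter> D = D" using constructible_subgroup by blast
  then show ?case using top by simp
next
  case (img C s)
  have "C \<subseteq> A" using constructible_subgroup img by blast
  then have "\<sigma> s ` C \<inter> D = \<sigma> s ` (C \<inter> {a \<in> A. \<sigma> s a \<in> D})" by blast
  moreover have "\<sigma> s ` (C \<inter> {a \<in> A. \<sigma> s a \<in> D}) \<in> \<C>"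
    by (intro constructible.img img.IH constructible.pre img.prems img.hyps(2))
  ultimately show ?case by simp
next
  case (pre C s)
  have "D \<subseteq> A" using constructible_subgroup pre by blast
  then have "{a \<in> A. \<sigma> s a \<in> C} \<inter> D = {a \<in> A. \<sigma> s a \<in> C \<inter> \<sigma> s ` D}"
    using act_inj by blast
  moreover have "{a \<in> A. \<sigma> s a \<in> C \<inter> \<sigma> s ` D} \<in> \<C>"
    by (intro constructible.pre pre.IH constructible.img pre.prems pre.hyps(2))
  ultimately show ?case by simp
qed

text \<open>Lets a basic neighbourhood, given by finitely many coordinates, be replaced by a coset
  of one constructible subgroup.\<close>

lemma constructible_finite_lower_bound:
  assumes "finite F" "F \<subseteq> \<C>"
  shows "\<exists>C\<in>\<C>. \<forall>D\<in>F. C \<subseteq> D"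
  using assms
proof induction
  case empty
  then show ?case using constructible.top[of A S \<sigma>] by blast
next
  case (insert D F)
  then obtain C where "C \<in> \<C>" "\<forall>D\<in>F. C \<subseteq> D" by blast
  moreover have "C \<inter> D \<in> \<C>" using insert constructible_inter calculation by blast
  ultimately show ?case by (intro bexI[of _ "C \<inter> D"]) auto
qed

text \<open>This is continuity at 0 of an arbitrary group element. Preimages serve for elements of
  \<open>S\<close>, images for their inverses, and the property passes to sums.\<close>

lemma constructible_dominated:
  shows "\<forall>C'\<in>\<C>. \<exists>C\<in>\<C>. \<sigma> g ` C \<subseteq> C'"
proof -
  define P where "P g \<longleftrightarrow> (\<forall>C'\<in>\<C>. \<exists>C\<in>\<C>. \<sigma> g ` C \<subseteq> C')" for g
  have Padd: "P (g + h)" if Pg: "P g" and Ph: "P h" for g h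
    unfolding P_def
  proof
    fix C' assume "C' \<in> \<C>"
    then obtain D where D: "D \<in> \<C>" "\<sigma> g ` D \<subseteq> C'" using Pg unfolding P_def by blast
    then obtain C where "C \<in> \<C>" "\<sigma> h ` C \<subseteq> D" using Ph unfolding P_def by blast
    then show "\<exists>C\<in>\<C>. \<sigma> (g + h) ` C \<subseteq> C'" using D by (intro bexI[of _ C]) (auto simp: act_add)
  qed
  have "g \<in> gen_subgroup S" using gen_S by simp
  then have "P g \<and> P (- g)"
  proof (induction rule: gen_subgroup_induct)
    case zero
    then show ?case unfolding P_def by auto
  next
    case (add x y)
    then show ?case using Padd minus_add by metis
  next
    case (minus x)
    then show ?case by simp
  next
    case (gen s)
    have "P s" unfolding P_def
    proof
      fix C assume "C \<in> \<C>"
      then show "\<exists>D\<in>\<C>. \<sigma> s ` D \<subseteq> C"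
        using constructible.pre[OF _ gen] by (intro bexI[of _ "{a \<in> A. \<sigma> s a \<in> C}"]) auto
    qed
    moreover have "P (- s)" unfolding P_def
    proof
      fix C assume "C \<in> \<C>"
      then show "\<exists>D\<in>\<C>. \<sigma> (- s) ` D \<subseteq> C"
        using constructible.img[OF _ gen] by (intro bexI[of _ "\<sigma> s ` C"]) auto
    qed
    ultimately show ?case by blast
  qed
  then show ?thesis unfolding P_def by blast
qed

lemma multiple_in_A: "\<exists>N>0. zmul N x \<in> A"
proof -
  define P where "P g \<longleftrightarrow> (\<forall>a\<in>A. \<exists>N>0. zmul N (\<sigma> g a) \<in> A)" for g
  have Padd: "P (g + h)" if Pg: "P g" and Ph: "P h" for g h
    unfolding P_def
  proof
    fix a assume "a \<in> A"
    then obtain N where N: "N > 0" "zmul N (\<sigma> h a) \<in> A" using Ph unfolding P_def by blast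
    then obtain M where M: "M > 0" "zmul M (\<sigma> g (zmul N (\<sigma> h a))) \<in> A" using Pg unfolding P_def by blast
    then show "\<exists>N>0. zmul N (\<sigma> (g + h) a) \<in> A"
      using N by (intro exI[of _ "M * N"]) (auto simp: act_zmul act_add zmul_mult)
  qed
  have P: "P g \<and> P (- g)" for g
  proof -
    have "g \<in> gen_subgroup S" using gen_S by simp
    then show ?thesis
    proof (induction rule: gen_subgroup_induct)
      case zero
      then show ?case unfolding P_def by (auto intro!: exI[of _ 1])
    next
      case (add x y)
      then show ?case using Padd minus_add by metis
    next
      case (minus x)
      then show ?case by simp
    next
      case (gen s)
      have "P s" unfolding P_def using act_A[OF gen] by (auto intro!: exI[of _ 1])
      moreover have "P (- s)" unfolding P_def
      proof
        fix a assume a: "a \<in> A"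
        obtain N where N: "N > 0" "zmul N a \<in> \<sigma> s ` A"
          using finite_index_multiple[OF finite_index_act[OF gen] subgroup_A is_subgroup_act_image[OF subgroup_A] a]
          by blast
        then show "\<exists>N>0. zmul N (\<sigma> (- s) a) \<in> A"
          by (intro exI[of _ N]) (auto simp flip: act_zmul)
      qed
      ultimately show ?case by blast
    qed
  qed
  have "x \<in> gen_subgroup (\<Union>g. \<sigma> g ` A)" using gen_A by simp
  then show ?thesis
  proof (induction rule: gen_subgroup_induct)
    case zero
    show ?case using subgroup_A by (intro exI[of _ 1]) (auto simp: is_subgroup_def)
  next
    case (add x y)
    then obtain M N where MN: "M > 0" "zmul M x \<in> A" "N > 0" "zmul N y \<in> A" by blast
    have "zmul N (zmul M x) + zmul M (zmul N y) \<in> A"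
      using MN subgroup_A is_subgroup_zmul[OF subgroup_A] unfolding is_subgroup_def by blast
    then show ?case using MN
      by (intro exI[of _ "M * N"]) (auto simp: zmul_add_right zmul_mult zmul_commute[of N M])
  next
    case (minus x)
    then obtain N where "N > 0" "zmul N x \<in> A" by blast
    then show ?case using subgroup_A unfolding is_subgroup_def
      by (intro exI[of _ N]) (auto simp: zmul_minus_right)
  next
    case (gen x)
    then show ?case using P unfolding P_def by blast
  qed
qed

lemma multiple_in_constructible: "C \<in> \<C> \<Longrightarrow> a \<in> A \<Longrightarrow> \<exists>N>0. zmul N a \<in> C"
  using finite_index_multiple[OF constructible_finite_index subgroup_A] constructible_subgroup by blast

section \<open>The dense image of \<open>A\<close> in the completion\<close>

lemma Aemb_eq_iff:
  assumes "C \<in> \<C>"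
  shows "Aemb S A \<sigma> a C = Aemb S A \<sigma> b C \<longleftrightarrow> a - b \<in> C"
  using assms coset_eq_iff[of C a b] constructible_subgroup unfolding Aemb_def by auto

lemma Aemb_in_Abar: "a \<in> A \<Longrightarrow> Aemb S A \<sigma> a \<in> Abar S A \<sigma>"
  unfolding Abar_def Aemb_def by auto

lemma Aemb_in_groupoid: "a \<in> dom_A A \<sigma> \<gamma> \<Longrightarrow> (\<gamma>, Aemb S A \<sigma> a) \<in> groupoid S A \<sigma>"
  unfolding groupoid_def in_closure_def
  using Aemb_in_Abar[of a] by (auto simp: dom_A_def agree_on_def)

text \<open>\<open>act_bar\<close> is the description of a limit. Continuity of the action shows
  that the expected point is a limit, and \<open>a\<close> itself lies in each of its
  neighbourhoods, which pins down every coordinate.\<close>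

lemma act_bar_Aemb:
  assumes a: "a \<in> dom_A A \<sigma> \<gamma>"
  shows "act_bar S A \<sigma> \<gamma> (Aemb S A \<sigma> a) = Aemb S A \<sigma> (sd_act \<sigma> \<gamma> a)"
  unfolding act_bar_def
proof (rule the_equality)
  obtain z g where \<gamma>: "\<gamma> = (z, g)" by (cases \<gamma>)
  have diff: "sd_act \<sigma> \<gamma> b - sd_act \<sigma> \<gamma> a = \<sigma> g (b - a)" for b
    unfolding \<gamma> sd_act_def by (simp add: act_diff)
  show "Aemb S A \<sigma> (sd_act \<sigma> \<gamma> a) \<in> Abar S A \<sigma> \<and>
    (\<forall>F'. finite F' \<and> F' \<subseteq> \<C> \<longrightarrow>
      (\<exists>F. finite F \<and> F \<subseteq> \<C> \<and> (\<forall>b\<in>dom_A A \<sigma> \<gamma>. agree_on F (Aemb S A \<sigma> b) (Aemb S A \<sigma> a) \<longrightarrow>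
        agree_on F' (Aemb S A \<sigma> (sd_act \<sigma> \<gamma> b)) (Aemb S A \<sigma> (sd_act \<sigma> \<gamma> a)))))"
  proof (intro conjI allI impI)
    show "Aemb S A \<sigma> (sd_act \<sigma> \<gamma> a) \<in> Abar S A \<sigma>" using a Aemb_in_Abar unfolding dom_A_def by blast
    fix F' assume F': "finite F' \<and> F' \<subseteq> \<C>"
    obtain D where D: "D \<in> \<C>" "\<forall>C\<in>F'. D \<subseteq> C" using constructible_finite_lower_bound F' by blast
    obtain C where C: "C \<in> \<C>" "\<sigma> g ` C \<subseteq> D" using constructible_dominated D by blast
    show "\<exists>F. finite F \<and> F \<subseteq> \<C> \<and> (\<forall>b\<in>dom_A A \<sigma> \<gamma>. agree_on F (Aemb S A \<sigma> b) (Aemb S A \<sigma> a) \<longrightarrow>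
        agree_on F' (Aemb S A \<sigma> (sd_act \<sigma> \<gamma> b)) (Aemb S A \<sigma> (sd_act \<sigma> \<gamma> a)))"
    proof (intro exI[of _ "{C}"] conjI ballI impI)
      fix b assume "agree_on {C} (Aemb S A \<sigma> b) (Aemb S A \<sigma> a)"
      then have "b - a \<in> C" using Aemb_eq_iff[OF C(1)] unfolding agree_on_def by simp
      then have "sd_act \<sigma> \<gamma> b - sd_act \<sigma> \<gamma> a \<in> D" unfolding diff using C by blast
      then show "agree_on F' (Aemb S A \<sigma> (sd_act \<sigma> \<gamma> b)) (Aemb S A \<sigma> (sd_act \<sigma> \<gamma> a))"
        unfolding agree_on_def using D(2) F' Aemb_eq_iff by blast
    qed (use C in auto)
  qed
  fix y
  assume y: "y \<in> Abar S A \<sigma> \<and>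
    (\<forall>F'. finite F' \<and> F' \<subseteq> \<C> \<longrightarrow>
      (\<exists>F. finite F \<and> F \<subseteq> \<C> \<and> (\<forall>b\<in>dom_A A \<sigma> \<gamma>. agree_on F (Aemb S A \<sigma> b) (Aemb S A \<sigma> a) \<longrightarrow>
        agree_on F' (Aemb S A \<sigma> (sd_act \<sigma> \<gamma> b)) y)))"
  show "y = Aemb S A \<sigma> (sd_act \<sigma> \<gamma> a)"
  proof
    fix C
    show "y C = Aemb S A \<sigma> (sd_act \<sigma> \<gamma> a) C"
    proof (cases "C \<in> \<C>")
      case True
      then obtain F where "\<forall>b\<in>dom_A A \<sigma> \<gamma>. agree_on F (Aemb S A \<sigma> b) (Aemb S A \<sigma> a) \<longrightarrow>
        agree_on {C} (Aemb S A \<sigma> (sd_act \<sigma> \<gamma> b)) y"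
        using y[THEN conjunct2, THEN spec, of "{C}"] by auto
      then show ?thesis using a by (auto simp: agree_on_def)
    next
      case False
      then show ?thesis using y unfolding Abar_def Aemb_def by auto
    qed
  qed
qed

text \<open>Compactness enters here: the completion is a closed subset of the product of the finite discrete
  spaces \<open>A/C\<close>.\<close>

lemma locally_constant_uniform:
  assumes lc: "\<And>x. x \<in> Abar S A \<sigma> \<Longrightarrow>
    \<exists>F. finite F \<and> F \<subseteq> \<C> \<and> (\<forall>y\<in>Abar S A \<sigma>. agree_on F x y \<longrightarrow> \<phi> y = \<phi> x)"
  shows "\<exists>C\<in>\<C>. \<forall>a\<in>A. \<forall>b\<in>A. b - a \<in> C \<longrightarrow> \<phi> (Aemb S A \<sigma> b) = \<phi> (Aemb S A \<sigma> a)"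
proof -
  \<comment> \<open>Off \<C> the factor is a single point, in accordance with the normalisation in
    \<open>Abar\<close>; so the product can run over all sets and stays compact.\<close>
  define Q where "Q C = (if C \<in> \<C> then (\<lambda>a. (+) a ` C) ` A else {{}})" for C
  define K where "K = product_topology (\<lambda>C. discrete_topology (Q C)) (UNIV :: 'a set set)"
  have finQ: "finite (Q C)" for C
    using constructible_finite_index[of C] unfolding Q_def finite_index_def by simp
  have "compact_space K"
    unfolding K_def compact_space_product_topology using finQ by (simp add: compact_space_discrete_topology)
  have top: "x \<in> topspace K \<longleftrightarrow> (\<forall>C. x C \<in> Q C)" for x
    unfolding K_def topspace_product_topology by (auto simp: PiE_UNIV_domain)
  have Abar_top: "Abar S A \<sigma> \<subseteq> topspace K"
  proof
    fix x assume "x \<in> Abar S A \<sigma>"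
    then show "x \<in> topspace K" unfolding top Abar_def Q_def by auto
  qed
  define N where "N F x = {y \<in> topspace K. agree_on F x y}" for F x
  have openN: "openin K (N F x)" if "finite F" "x \<in> topspace K" for F x
  proof -
    have Nf: "y \<in> N F x \<longleftrightarrow> (\<forall>C. y C \<in> (if C \<in> F then {x C} else Q C))" for y
    proof
      assume "y \<in> N F x"
      then show "\<forall>C. y C \<in> (if C \<in> F then {x C} else Q C)"
        unfolding N_def agree_on_def by (simp add: top)
    next
      assume y: "\<forall>C. y C \<in> (if C \<in> F then {x C} else Q C)"
      have "y C \<in> Q C" for C using y[rule_format, of C] that(2) by (cases "C \<in> F") (simp_all add: top)
      moreover have "x C = y C" if "C \<in> F" for C using y[rule_format, of C] that by simp
      ultimately show "y \<in> N F x" unfolding N_def agree_on_def by (simp add: top)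
    qed
    have "N F x = (\<Pi>\<^sub>E C\<in>UNIV. if C \<in> F then {x C} else Q C)"
      by (rule Set.set_eqI, unfold Nf) (simp add: PiE_UNIV_domain Pi_iff)
    moreover have "openin K \<dots>"
      unfolding K_def
    proof (rule product_topology_basis)
      fix C
      show "openin (discrete_topology (Q C)) (if C \<in> F then {x C} else Q C)"
        using that(2) unfolding top by simp
      show "finite {C. (if C \<in> F then {x C} else Q C) \<noteq> topspace (discrete_topology (Q C))}"
        by (rule finite_subset[OF _ that(1)]) auto
    qed
    ultimately show ?thesis by simp
  qed
  define P where "P x F \<longleftrightarrow> finite F \<and> F \<subseteq> \<C> \<and>
    (\<forall>y\<in>Abar S A \<sigma>. \<forall>y'\<in>Abar S A \<sigma>. y \<in> N F x \<longrightarrow> y' \<in> N F x \<longrightarrow> \<phi> y = \<phi> y')" for x F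
  have "\<exists>F. P x F" if x: "x \<in> topspace K" for x
  proof (cases "x \<in> Abar S A \<sigma>")
    case True
    then obtain F where "finite F" "F \<subseteq> \<C>" "\<forall>y\<in>Abar S A \<sigma>. agree_on F x y \<longrightarrow> \<phi> y = \<phi> x"
      using lc by blast
    then show ?thesis unfolding P_def N_def by (intro exI[of _ F]) auto
  next
    \<comment> \<open>Closedness of the completion: an incompatible family violates monotonicity at
      some pair of coordinates, and fixing these two gives a neighbourhood that misses
      \<open>Abar\<close>, where \<open>P\<close> holds vacuously.\<close>
    case False
    have "\<exists>a\<in>A. x C = (+) a ` C" if "C \<in> \<C>" for C
    proof -
      have "x C \<in> (\<lambda>a. (+) a ` C) ` A" using x that unfolding top Q_def by (auto split: if_splits)
      then show ?thesis by (elim imageE) (rule bexI)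
    qed
    moreover have "x C = {}" if "C \<notin> \<C>" for C
      using x[unfolded top, rule_format, of C] that unfolding Q_def by simp
    ultimately have "\<not> (\<forall>C\<in>\<C>. \<forall>D\<in>\<C>. C \<subseteq> D \<longrightarrow> x C \<subseteq> x D)"
      using False unfolding Abar_def by simp
    then obtain C D where CD: "C \<in> \<C>" "D \<in> \<C>" "C \<subseteq> D" "\<not> x C \<subseteq> x D" by blast
    have "y \<notin> N {C, D} x" if "y \<in> Abar S A \<sigma>" for y
    proof
      assume "y \<in> N {C, D} x"
      then have "x C = y C" "x D = y D" unfolding N_def agree_on_def by simp_all
      moreover have "y C \<subseteq> y D" using that CD(1-3) unfolding Abar_def by simp
      ultimately show False using CD(4) by simp
    qed
    then show ?thesis using CD unfolding P_def by (intro exI[of _ "{C, D}"]) simp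
  qed
  then have "\<forall>x\<in>topspace K. \<exists>F. P x F" by blast
  from bchoice[OF this] obtain G where "\<forall>x\<in>topspace K. P x (G x)" ..
  then have G: "finite (G x)" "G x \<subseteq> \<C>"
    "\<And>y y'. y \<in> Abar S A \<sigma> \<Longrightarrow> y' \<in> Abar S A \<sigma> \<Longrightarrow> y \<in> N (G x) x \<Longrightarrow> y' \<in> N (G x) x \<Longrightarrow> \<phi> y = \<phi> y'"
    if "x \<in> topspace K" for x
    using that unfolding P_def by blast+
  have "\<exists>X. X \<subseteq> topspace K \<and> finite X \<and> topspace K \<subseteq> (\<Union>x\<in>X. N (G x) x)"
  proof -
    let ?U = "(\<lambda>x. N (G x) x) ` topspace K"
    have "topspace K \<subseteq> \<Union>?U" unfolding N_def agree_on_def by auto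
    moreover have "\<forall>U\<in>?U. openin K U" using openN G(1) by simp
    ultimately have "\<exists>\<F>. finite \<F> \<and> \<F> \<subseteq> ?U \<and> topspace K \<subseteq> \<Union>\<F>"
      using \<open>compact_space K\<close>[unfolded compact_space_alt, THEN spec, of ?U] by simp
    then obtain \<F> where \<F>: "finite \<F>" "\<F> \<subseteq> ?U" "topspace K \<subseteq> \<Union>\<F>" by (elim exE conjE)
    from finite_subset_image[OF \<F>(1,2)] obtain X where
      "X \<subseteq> topspace K" "finite X" "\<F> = (\<lambda>x. N (G x) x) ` X" by (elim exE conjE)
    then show ?thesis using \<F>(3) by (intro exI[of _ X]) simp
  qed
  then obtain X where X: "X \<subseteq> topspace K" "finite X" "topspace K \<subseteq> (\<Union>x\<in>X. N (G x) x)" by blast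
  have "finite (\<Union>(G ` X))" "\<Union>(G ` X) \<subseteq> \<C>" using X(1,2) G(1,2) by (auto simp: subset_iff)
  then obtain C where C: "C \<in> \<C>" "\<forall>D\<in>\<Union>(G ` X). C \<subseteq> D" using constructible_finite_lower_bound by blast
  show ?thesis
  proof (intro bexI[OF _ C(1)] ballI impI)
    fix a b assume ab: "a \<in> A" "b \<in> A" "b - a \<in> C"
    have mem: "Aemb S A \<sigma> a \<in> Abar S A \<sigma>" "Aemb S A \<sigma> b \<in> Abar S A \<sigma>" using ab Aemb_in_Abar by auto
    then obtain x where x: "x \<in> X" "Aemb S A \<sigma> a \<in> N (G x) x" using X(3) Abar_top by blast
    have "Aemb S A \<sigma> b D = Aemb S A \<sigma> a D" if "D \<in> G x" for D
    proof -
      have "D \<in> \<C>" using that G(2) x(1) X(1) by blast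
      moreover have "C \<subseteq> D" using that C(2) x(1) by blast
      ultimately show ?thesis using Aemb_eq_iff[of D b a] ab(3) by blast
    qed
    then have "Aemb S A \<sigma> b \<in> N (G x) x"
      using x(2) mem(2) Abar_top unfolding N_def agree_on_def by auto
    then show "\<phi> (Aemb S A \<sigma> b) = \<phi> (Aemb S A \<sigma> a)" using G(3)[OF _ mem(2,1)] x X(1) by blast
  qed
qed

end

context std_action
begin

text \<open>By compatibility a representative of \<open>x C\<close> also represents
  \<open>x D\<close> for every constructible \<open>D\<close> above \<open>C\<close>. As a
  consequence, translations by elements of \<open>A\<close> are defined on the whole
  completion.\<close>

lemma Abar_in_closure:
  assumes x: "x \<in> Abar S A \<sigma>"
  shows "in_closure S A \<sigma> A x"
  unfolding in_closure_def
proof (intro allI impI)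
  fix F assume F: "finite F \<and> F \<subseteq> \<C>"
  obtain C where C: "C \<in> \<C>" "\<forall>D\<in>F. C \<subseteq> D" using constructible_finite_lower_bound F by blast
  have rep: "\<exists>a\<in>A. x D = (+) a ` D" if "D \<in> \<C>" for D using x that unfolding Abar_def by simp
  have mono: "x D \<subseteq> x D'" if "D \<in> \<C>" "D' \<in> \<C>" "D \<subseteq> D'" for D D'
    using x that unfolding Abar_def by simp
  obtain a where a: "a \<in> A" "x C = (+) a ` C" using rep[OF C(1)] ..
  have "Aemb S A \<sigma> a D = x D" if D: "D \<in> F" for D
  proof -
    have D': "D \<in> \<C>" "C \<subseteq> D" using D F C(2) by auto
    obtain d where d: "d \<in> A" "x D = (+) d ` D" using rep[OF D'(1)] ..
    have "0 \<in> C" using constructible_subgroup[OF C(1)] unfolding is_subgroup_def by blast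
    then have "a \<in> x C" unfolding a(2) by (intro image_eqI[of _ _ 0]) auto
    then have "a \<in> (+) d ` D" using mono[OF C(1) D'] d(2) by blast
    then have "a - d \<in> D" by auto
    then show ?thesis
      unfolding d(2) Aemb_def using D'(1) coset_eq_iff[of D a d] constructible_subgroup by simp
  qed
  then show "\<exists>a\<in>A. agree_on F (Aemb S A \<sigma> a) x" using a(1) unfolding agree_on_def by blast
qed

end

section \<open>The cocycle at the origin\<close>

locale cocycle = src: std_action S A \<sigma> + tgt: std_action T B \<tau>
  for S :: "'g::group_add set" and A :: "'a::ab_group_add set" and \<sigma> :: "'g \<Rightarrow> 'a \<Rightarrow> 'a"
    and T :: "'h::group_add set" and B :: "'b::ab_group_add set" and \<tau> :: "'h \<Rightarrow> 'b \<Rightarrow> 'b" +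
  fixes c :: "'a \<times> 'g \<Rightarrow> ('a set \<Rightarrow> 'a set) \<Rightarrow> 'b \<times> 'h"
  assumes tf_A: "torsion_free_set (UNIV :: 'a set)" and tf_B: "torsion_free_set (UNIV :: 'b set)"
    and hom: "cont_groupoid_hom S A \<sigma> \<tau> c" and units: "unit_preimage S A \<sigma> c"
begin

text \<open>The cocycle is evaluated at points coming from \<open>A\<close>; there the extended
  action is the original one, so \<open>act_bar\<close> drops out of the cocycle identity.\<close>

definition c0 :: "'a \<times> 'g \<Rightarrow> 'a \<Rightarrow> 'b \<times> 'h" where
  "c0 \<gamma> a = c \<gamma> (Aemb S A \<sigma> a)"

lemma c0_mult:
  assumes "a \<in> A" "sd_act \<sigma> \<delta> a \<in> A" "sd_act \<sigma> \<gamma> (sd_act \<sigma> \<delta> a) \<in> A"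
  shows "c0 (sd_mult \<sigma> \<gamma> \<delta>) a = sd_mult \<tau> (c0 \<gamma> (sd_act \<sigma> \<delta> a)) (c0 \<delta> a)"
proof -
  have a: "a \<in> dom_A A \<sigma> \<delta>" "sd_act \<sigma> \<delta> a \<in> dom_A A \<sigma> \<gamma>" using assms unfolding dom_A_def by auto
  have "\<forall>\<gamma> \<delta> x. (\<delta>, x) \<in> groupoid S A \<sigma> \<and> (\<gamma>, act_bar S A \<sigma> \<delta> x) \<in> groupoid S A \<sigma> \<longrightarrow>
        c (sd_mult \<sigma> \<gamma> \<delta>) x = sd_mult \<tau> (c \<gamma> (act_bar S A \<sigma> \<delta> x)) (c \<delta> x)"
    using hom unfolding cont_groupoid_hom_def by blast
  from this[rule_format, of \<delta> "Aemb S A \<sigma> a" \<gamma>] show ?thesis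
    using src.Aemb_in_groupoid[OF a(1)] src.Aemb_in_groupoid[OF a(2)] src.act_bar_Aemb[OF a(1)]
    unfolding c0_def by simp
qed

lemma locally_constant:
  assumes "(\<gamma>, x) \<in> groupoid S A \<sigma>"
  shows "\<exists>F. finite F \<and> F \<subseteq> src.\<C> \<and>
    (\<forall>y. (\<gamma>, y) \<in> groupoid S A \<sigma> \<and> agree_on F x y \<longrightarrow> c \<gamma> y = c \<gamma> x)"
proof -
  have "\<forall>\<gamma> x. (\<gamma>, x) \<in> groupoid S A \<sigma> \<longrightarrow>
        (\<exists>F. finite F \<and> F \<subseteq> src.\<C> \<and>
           (\<forall>y. (\<gamma>, y) \<in> groupoid S A \<sigma> \<and> agree_on F x y \<longrightarrow> c \<gamma> y = c \<gamma> x))"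
    using hom unfolding cont_groupoid_hom_def by (elim conjE)
  then show ?thesis using assms by (elim allE[of _ \<gamma>] allE[of _ x] impE)
qed

lemma c0_continuous:
  assumes "a \<in> A" "sd_act \<sigma> \<gamma> a \<in> A"
  shows "\<exists>C\<in>src.\<C>. \<forall>b\<in>A. sd_act \<sigma> \<gamma> b \<in> A \<longrightarrow> b - a \<in> C \<longrightarrow> c0 \<gamma> b = c0 \<gamma> a"
proof -
  have "a \<in> dom_A A \<sigma> \<gamma>" using assms unfolding dom_A_def by auto
  from locally_constant[OF src.Aemb_in_groupoid[OF this]] obtain F where F: "finite F" "F \<subseteq> src.\<C>"
    "\<And>y. (\<gamma>, y) \<in> groupoid S A \<sigma> \<Longrightarrow> agree_on F (Aemb S A \<sigma> a) y \<Longrightarrow> c \<gamma> y = c \<gamma> (Aemb S A \<sigma> a)"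
    by blast
  obtain C where C: "C \<in> src.\<C>" "\<forall>D\<in>F. C \<subseteq> D" using src.constructible_finite_lower_bound[OF F(1,2)] ..
  show ?thesis
  proof (intro bexI[OF _ C(1)] ballI impI)
    fix b assume b: "b \<in> A" "sd_act \<sigma> \<gamma> b \<in> A" "b - a \<in> C"
    have "Aemb S A \<sigma> a D = Aemb S A \<sigma> b D" if "D \<in> F" for D
    proof -
      have "D \<in> src.\<C>" "b - a \<in> D" using that F(2) C(2) b(3) by auto
      then show ?thesis using src.Aemb_eq_iff[of D b a] by simp
    qed
    then have "agree_on F (Aemb S A \<sigma> a) (Aemb S A \<sigma> b)" unfolding agree_on_def by blast
    moreover have "b \<in> dom_A A \<sigma> \<gamma>" using b unfolding dom_A_def by auto
    ultimately show "c0 \<gamma> b = c0 \<gamma> a" unfolding c0_def using F(3) src.Aemb_in_groupoid by blast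
  qed
qed

lemma c0_unit:
  assumes "a \<in> A" "sd_act \<sigma> \<gamma> a \<in> A"
  shows "c0 \<gamma> a = (0, 0) \<longleftrightarrow> \<gamma> = (0, 0)"
proof -
  have "a \<in> dom_A A \<sigma> \<gamma>" using assms unfolding dom_A_def by auto
  then show ?thesis using units src.Aemb_in_groupoid unfolding unit_preimage_def c0_def by blast
qed

lemma A_closed: "0 \<in> A" "x \<in> A \<Longrightarrow> y \<in> A \<Longrightarrow> x + y \<in> A" "x \<in> A \<Longrightarrow> - x \<in> A"
  using src.subgroup_A unfolding is_subgroup_def by auto

lemma sd_act_translation [simp]: "sd_act \<sigma> (z, 0) x = z + x"
  by (simp add: sd_act_def)

lemma c0_add:
  assumes "z \<in> A" "w \<in> A" "x \<in> A"
  shows "c0 (z + w, 0) x = sd_mult \<tau> (c0 (z, 0) (w + x)) (c0 (w, 0) x)"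
  using c0_mult[of x "(w, 0)" "(z, 0)"] assms A_closed by (simp add: sd_mult_def)

lemma c0_zero: "x \<in> A \<Longrightarrow> c0 (0, 0) x = (0, 0)"
  using c0_unit[of x "(0, 0)"] by simp

text \<open>A translation by \<open>z \<in> A\<close> is defined everywhere, so compactness yields
  one subgroup that works at every base point, whereas \<open>c0_continuous\<close> gives one for
  each point.\<close>

lemma c0_uniform:
  assumes z: "z \<in> A"
  shows "\<exists>C\<in>src.\<C>. \<forall>x\<in>A. \<forall>w\<in>C. c0 (z, 0) (x + w) = c0 (z, 0) x"
proof -
  have dom: "dom_A A \<sigma> (z, 0) = A" unfolding dom_A_def using z A_closed by auto
  have gr: "((z, 0), x) \<in> groupoid S A \<sigma>" if "x \<in> Abar S A \<sigma>" for x
    unfolding groupoid_def using that src.Abar_in_closure dom by simp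
  have "\<exists>F. finite F \<and> F \<subseteq> src.\<C> \<and> (\<forall>y\<in>Abar S A \<sigma>. agree_on F x y \<longrightarrow> c (z, 0) y = c (z, 0) x)"
    if "x \<in> Abar S A \<sigma>" for x
    using locally_constant[OF gr[OF that]] gr by blast
  from src.locally_constant_uniform[OF this]
  obtain C where C: "C \<in> src.\<C>" "\<forall>a\<in>A. \<forall>b\<in>A. b - a \<in> C \<longrightarrow> c0 (z, 0) b = c0 (z, 0) a"
    unfolding c0_def by blast
  have "C \<subseteq> A" using src.constructible_subgroup C by blast
  then have "\<forall>x\<in>A. \<forall>w\<in>C. c0 (z, 0) (x + w) = c0 (z, 0) x" using C(2) A_closed by auto
  then show ?thesis using C(1) by blast
qed

lemma sd_mult_right_inverse_unique:
  assumes "sd_mult \<tau> p q = (0, 0)" "sd_mult \<tau> p q' = (0, 0)"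
  shows "q = q'"
proof -
  obtain b t where p: "p = (b, t)" by (cases p)
  obtain d u where q: "q = (d, u)" by (cases q)
  obtain d' u' where q': "q' = (d', u')" by (cases q')
  have "b + \<tau> t d = 0" "b + \<tau> t d' = 0" "t + u = 0" "t + u' = 0"
    using assms unfolding p q q' sd_mult_def by simp_all
  then have "b + \<tau> t d = b + \<tau> t d'" "t + u = t + u'" by simp_all
  then show ?thesis unfolding q q' using tgt.act_inj by auto
qed

text \<open>By the cocycle identity the \<open>z\<close> whose value is constant on the cosets of a
  fixed \<open>C\<close> form a subgroup. A subgroup \<open>C\<close> that serves the finitely many
  generators therefore serves the group.\<close>

lemma c0_uniform_gen:
  assumes "finite Z" "Z \<subseteq> A"
  shows "\<exists>C\<in>src.\<C>. \<forall>z\<in>gen_subgroup Z. \<forall>x\<in>A. \<forall>w\<in>C. c0 (z, 0) (x + w) = c0 (z, 0) x"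
proof -
  have "\<forall>z\<in>Z. \<exists>C. C \<in> src.\<C> \<and> (\<forall>x\<in>A. \<forall>w\<in>C. c0 (z, 0) (x + w) = c0 (z, 0) x)"
    using c0_uniform assms(2) by blast
  from bchoice[OF this] obtain D where
    D: "\<forall>z\<in>Z. D z \<in> src.\<C> \<and> (\<forall>x\<in>A. \<forall>w\<in>D z. c0 (z, 0) (x + w) = c0 (z, 0) x)" ..
  obtain C where C: "C \<in> src.\<C>" "\<forall>E\<in>D ` Z. C \<subseteq> E"
    using src.constructible_finite_lower_bound[of "D ` Z"] assms(1) D by auto
  have CA: "C \<subseteq> A" using src.constructible_subgroup C by blast
  let ?K = "{z \<in> A. \<forall>x\<in>A. \<forall>w\<in>C. c0 (z, 0) (x + w) = c0 (z, 0) x}"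
  have "is_subgroup ?K"
    unfolding is_subgroup_def
  proof (intro conjI ballI)
    show "0 \<in> ?K" using A_closed c0_zero CA by auto
  next
    fix z y assume z: "z \<in> ?K" and y: "y \<in> ?K"
    have "c0 (z + y, 0) (x + w) = c0 (z + y, 0) x" if "x \<in> A" "w \<in> C" for x w
    proof -
      have xw: "x + w \<in> A" "y + x \<in> A" using that CA A_closed y by auto
      have "c0 (z, 0) (y + x + w) = c0 (z, 0) (y + x)" "c0 (y, 0) (x + w) = c0 (y, 0) x"
        using z y that xw by blast+
      then show ?thesis
        using c0_add[of z y "x + w"] c0_add[of z y x] z y that xw by (simp add: add.assoc)
    qed
    then show "z + y \<in> ?K" using z y A_closed by blast
  next
    fix z assume z: "z \<in> ?K"
    have zA: "z \<in> A" using z by blast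
    have inv: "sd_mult \<tau> (c0 (z, 0) (- z + x)) (c0 (- z, 0) x) = (0, 0)" if "x \<in> A" for x
      using c0_add[OF zA A_closed(3)[OF zA] that] c0_zero[OF that] by simp
    have "c0 (- z, 0) (x + w) = c0 (- z, 0) x" if "x \<in> A" "w \<in> C" for x w
    proof -
      have xw: "x + w \<in> A" "- z + x \<in> A"
        using that CA A_closed(2)[OF that(1)] A_closed(2)[OF A_closed(3)[OF zA] that(1)] by auto
      have "c0 (z, 0) (- z + x + w) = c0 (z, 0) (- z + x)" using z that xw by blast
      then show ?thesis
        using inv[OF xw(1)] inv[OF that(1)] sd_mult_right_inverse_unique by (metis add.assoc)
    qed
    then show "- z \<in> ?K" using zA A_closed by blast
  qed
  moreover have "Z \<subseteq> ?K"
  proof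
    fix z assume z: "z \<in> Z"
    then have "C \<subseteq> D z" using C(2) by blast
    then show "z \<in> ?K" using D z assms(2) by blast
  qed
  ultimately have "gen_subgroup Z \<subseteq> ?K" by (rule gen_subgroup_least)
  then show ?thesis using C(1) by blast
qed

text \<open>Everything is read off at the image of \<open>0 \<in> A\<close>, which every element of the acting group
  \<open>\<SS>\<close> fixes: \<open>tt\<close> is the homomorphism \<open>\<tt>\<close> of the theorem, while \<open>(bb, al)\<close> is multiplicative only
  locally.\<close>

definition bb :: "'a \<Rightarrow> 'b" where "bb z = fst (c0 (z, 0) 0)"
definition al :: "'a \<Rightarrow> 'h" where "al z = snd (c0 (z, 0) 0)"
definition tt :: "'g \<Rightarrow> 'h" where "tt g = snd (c0 (0, g) 0)"

lemma bb_al_zero [simp]: "bb 0 = 0" "al 0 = 0"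
  using c0_zero[OF A_closed(1)] unfolding bb_def al_def by simp_all

text \<open>All injectivity statements below go back to this consequence of the hypothesis on the
  unit space.\<close>

lemma bb_al_eq_0: "z \<in> A \<Longrightarrow> bb z = 0 \<Longrightarrow> al z = 0 \<Longrightarrow> z = 0"
  using c0_unit[of 0 "(z, 0)"] A_closed unfolding bb_def al_def by (simp add: prod_eq_iff)

lemma tt_add: "tt (g + h) = tt g + tt h"
  using c0_mult[of 0 "(0, h)" "(0, g)"] A_closed(1) unfolding tt_def
  by (simp add: sd_act_def sd_mult_def split: prod.splits)

lemma tt_zero [simp]: "tt 0 = 0"
  using tt_add[of 0 0] by (metis add_0_right add_left_cancel)

lemma tt_minus: "tt (- g) = - tt g"
  using tt_add[of "- g" g] by (simp add: eq_neg_iff_add_eq_0)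

text \<open>The element \<open>(\<sigma> s z, s)\<close> is both \<open>(0, s)\<close> after
  \<open>(z, 0)\<close> and \<open>(\<sigma> s z, 0)\<close> after \<open>(0, s)\<close>. Evaluation
  at 0 compares the two once the value at \<open>(0, s)\<close> is the same at \<open>z\<close> and
  at 0, which holds for \<open>z\<close> in a small \<open>C\<close>. If \<open>al z = 0\<close>,
  the translation part of that value cancels because the target's abelian factor is
  commutative.\<close>

lemma tt_conj:
  assumes s: "s \<in> S"
  shows "\<exists>C\<in>src.\<C>. \<forall>z\<in>C. tt s + al z = al (\<sigma> s z) + tt s \<and>
    (al z = 0 \<longrightarrow> al (\<sigma> s z) = 0 \<and> bb (\<sigma> s z) = \<tau> (tt s) (bb z))"
proof -
  have dom: "sd_act \<sigma> (0, s) x \<in> A" if "x \<in> A" for x using src.act_A[OF s that] by (simp add: sd_act_def)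
  obtain C where C: "C \<in> src.\<C>" "\<forall>b\<in>A. sd_act \<sigma> (0, s) b \<in> A \<longrightarrow> b - 0 \<in> C \<longrightarrow> c0 (0, s) b = c0 (0, s) 0"
    using c0_continuous[OF A_closed(1) dom[OF A_closed(1)]] by blast
  have "tt s + al z = al (\<sigma> s z) + tt s \<and>
    (al z = 0 \<longrightarrow> al (\<sigma> s z) = 0 \<and> bb (\<sigma> s z) = \<tau> (tt s) (bb z))" if z: "z \<in> C" for z
  proof -
    have zA: "z \<in> A" using z src.constructible_subgroup C by blast
    have sz: "\<sigma> s z \<in> A" using src.act_A[OF s zA] .
    have "c0 (0, s) z = c0 (0, s) 0" using C(2) zA z dom by simp
    then have 1: "c0 (\<sigma> s z, s) 0 = sd_mult \<tau> (c0 (0, s) 0) (c0 (z, 0) 0)"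
      using c0_mult[of 0 "(z, 0)" "(0, s)"] A_closed(1) zA dom[OF zA] by (simp add: sd_mult_def)
    have 2: "c0 (\<sigma> s z, s) 0 = sd_mult \<tau> (c0 (\<sigma> s z, 0) 0) (c0 (0, s) 0)"
      using c0_mult[of 0 "(0, s)" "(\<sigma> s z, 0)"] A_closed(1) sz by (simp add: sd_mult_def sd_act_def)
    define d where "d = fst (c0 (0, s) 0)"
    have "sd_mult \<tau> (d, tt s) (bb z, al z) = sd_mult \<tau> (bb (\<sigma> s z), al (\<sigma> s z)) (d, tt s)"
      using 1 2 unfolding d_def tt_def bb_def al_def by simp
    then have 3: "tt s + al z = al (\<sigma> s z) + tt s" "d + \<tau> (tt s) (bb z) = bb (\<sigma> s z) + \<tau> (al (\<sigma> s z)) d"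
      unfolding sd_mult_def by simp_all
    have "al (\<sigma> s z) = 0 \<and> bb (\<sigma> s z) = \<tau> (tt s) (bb z)" if "al z = 0"
    proof -
      have "al (\<sigma> s z) = 0" using 3(1) that by (metis add_0_left add_0_right add_right_cancel)
      then show ?thesis using 3(2) by (simp add: add.commute)
    qed
    then show ?thesis using 3(1) by blast
  qed
  then show ?thesis using C(1) by blast
qed

text \<open>The second summand becomes the base point for the first value, and constancy on cosets
  of \<open>C\<close> moves it back to 0. That is why \<open>w\<close> is restricted to
  \<open>C\<close> and \<open>z\<close> is not.\<close>

definition local_hom :: "'a set \<Rightarrow> 'a set \<Rightarrow> bool" where
  "local_hom G C \<longleftrightarrow> is_subgroup G \<and> G \<subseteq> A \<and> C \<in> src.\<C> \<and>
    (\<forall>z\<in>G. \<forall>w\<in>G \<inter> C. al (z + w) = al z + al w \<and> bb (z + w) = bb z + \<tau> (al z) (bb w))"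

lemma local_hom_exists:
  assumes "finite Z" "Z \<subseteq> A"
  shows "\<exists>C. local_hom (gen_subgroup Z) C"
proof -
  obtain C where C: "C \<in> src.\<C>"
    "\<forall>z\<in>gen_subgroup Z. \<forall>x\<in>A. \<forall>w\<in>C. c0 (z, 0) (x + w) = c0 (z, 0) x"
    using c0_uniform_gen[OF assms] by blast
  have G: "gen_subgroup Z \<subseteq> A" by (rule gen_subgroup_least[OF src.subgroup_A assms(2)])
  have "al (z + w) = al z + al w \<and> bb (z + w) = bb z + \<tau> (al z) (bb w)"
    if z: "z \<in> gen_subgroup Z" and w: "w \<in> gen_subgroup Z" "w \<in> C" for z w
  proof -
    have "c0 (z, 0) (0 + w) = c0 (z, 0) 0" using C(2) z w A_closed(1) by blast
    then have "c0 (z + w, 0) 0 = sd_mult \<tau> (c0 (z, 0) 0) (c0 (w, 0) 0)"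
      using c0_add[of z w 0] z w G A_closed(1) by (simp add: subset_iff)
    then show ?thesis unfolding al_def bb_def sd_mult_def by (simp split: prod.splits)
  qed
  then show ?thesis unfolding local_hom_def using C(1) G is_subgroup_gen by blast
qed

lemma local_homD:
  assumes "local_hom G C"
  shows "is_subgroup G" "G \<subseteq> A" "C \<in> src.\<C>" "is_subgroup C" "C \<subseteq> A"
    "z \<in> G \<Longrightarrow> w \<in> G \<Longrightarrow> w \<in> C \<Longrightarrow> al (z + w) = al z + al w"
    "z \<in> G \<Longrightarrow> w \<in> G \<Longrightarrow> w \<in> C \<Longrightarrow> bb (z + w) = bb z + \<tau> (al z) (bb w)"
  using assms src.constructible_subgroup[of C] unfolding local_hom_def by blast+

lemma local_hom_al_zmul:
  assumes "local_hom G C" "z \<in> G" "z \<in> C"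
  shows "al (zmul k z) = zmul k (al z)"
proof (induction k rule: int_induct[where k = 0])
  case (step1 i)
  have "zmul i z \<in> G" using is_subgroup_zmul[OF local_homD(1)[OF assms(1)] assms(2)] .
  then show ?case using local_homD(6)[OF assms(1)] assms step1 by (simp add: zmul_succ)
next
  case (step2 i)
  have "zmul (i - 1) z \<in> G" using is_subgroup_zmul[OF local_homD(1)[OF assms(1)] assms(2)] .
  then have "al (zmul (i - 1) z + z) = al (zmul (i - 1) z) + al z"
    using local_homD(6)[OF assms(1)] assms by blast
  then show ?case using step2 by (simp add: zmul_pred)
qed simp

lemma local_hom_bb_zmul:
  assumes "local_hom G C" "z \<in> G" "z \<in> C" "al z = 0"
  shows "bb (zmul k z) = zmul k (bb z)"
proof (induction k rule: int_induct[where k = 0])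
  case (step1 i)
  have "zmul i z \<in> G" using is_subgroup_zmul[OF local_homD(1)[OF assms(1)] assms(2)] .
  then have "bb (zmul i z + z) = bb (zmul i z) + \<tau> (al (zmul i z)) (bb z)"
    using local_homD(7)[OF assms(1)] assms by blast
  then show ?case using step1 local_hom_al_zmul[OF assms(1-3)] assms(4) by (simp add: zmul_succ)
next
  case (step2 i)
  have "zmul (i - 1) z \<in> G" using is_subgroup_zmul[OF local_homD(1)[OF assms(1)] assms(2)] .
  then have "bb (zmul (i - 1) z + z) = bb (zmul (i - 1) z) + \<tau> (al (zmul (i - 1) z)) (bb z)"
    using local_homD(7)[OF assms(1)] assms by blast
  moreover have "al (zmul (i - 1) z) = 0" using local_hom_al_zmul[OF assms(1-3)] assms(4) by simp
  ultimately have "bb (zmul (i - 1) z + z) = bb (zmul (i - 1) z) + bb z" by simp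
  then show ?case using step2 by (simp add: zmul_pred eq_diff_eq)
qed simp

text \<open>No subgroup \<open>G\<close> or \<open>C\<close> is mentioned, so good elements found in
  different finitely generated subgroups can be combined. Requiring all multiples makes the property
  stable under \<open>zmul\<close>.\<close>

definition good :: "'a \<Rightarrow> bool" where
  "good z \<longleftrightarrow> z \<in> A \<and> (\<forall>k. al (zmul k z) = 0 \<and> bb (zmul k z) = zmul k (bb z))"

lemma goodI: "local_hom G C \<Longrightarrow> z \<in> G \<Longrightarrow> z \<in> C \<Longrightarrow> al z = 0 \<Longrightarrow> good z"
  unfolding good_def
  using local_hom_al_zmul[of G C z] local_hom_bb_zmul[of G C z] subsetD[OF local_homD(2)[of G C]] by simp

lemma goodD:
  assumes "good z"
  shows "z \<in> A" "al z = 0" "al (zmul k z) = 0" "bb (zmul k z) = zmul k (bb z)" "good (zmul k z)"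
proof -
  show z: "z \<in> A" "al (zmul k z) = 0" "bb (zmul k z) = zmul k (bb z)" for k
    using assms unfolding good_def by auto
  show "al z = 0" using z(2)[of 1] by simp
  show "good (zmul k z)" unfolding good_def
    using z is_subgroup_zmul[OF src.subgroup_A] by (simp flip: zmul_mult)
qed

text \<open>A common multiple carries both elements into the subgroup on which the group generated
  by them behaves additively.\<close>

lemma good_add:
  assumes "good z" "good w"
  shows "\<exists>N>0. good (zmul N (z + w)) \<and> bb (zmul N (z + w)) = zmul N (bb z + bb w)"
proof -
  obtain C where C: "local_hom (gen_subgroup {z, w}) C"
    using local_hom_exists[of "{z, w}"] goodD(1) assms by auto
  note lh = local_homD[OF C]
  obtain M where M: "M > 0" "zmul M z \<in> C" using src.multiple_in_constructible[OF lh(3)] goodD(1) assms by blast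
  obtain N where N: "N > 0" "zmul N w \<in> C" using src.multiple_in_constructible[OF lh(3)] goodD(1) assms by blast
  define K where "K = M * N"
  have K: "K > 0" unfolding K_def using M N by simp
  have zC: "zmul K z \<in> C" using is_subgroup_zmul[OF lh(4) M(2), of N] unfolding K_def
    by (simp add: mult.commute flip: zmul_mult)
  have wC: "zmul K w \<in> C" using is_subgroup_zmul[OF lh(4) N(2), of M] unfolding K_def
    by (simp flip: zmul_mult)
  have zw: "zmul K z \<in> gen_subgroup {z, w}" "zmul K w \<in> gen_subgroup {z, w}"
    using is_subgroup_zmul[OF lh(1)] gen_subgroup_superset[of "{z, w}"] by auto
  have e: "zmul K (z + w) = zmul K z + zmul K w" by (rule zmul_add_right)
  have "al (zmul K z + zmul K w) = 0" using lh(6)[OF zw wC] goodD(3) assms by simp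
  moreover have "zmul K z + zmul K w \<in> gen_subgroup {z, w}" "zmul K z + zmul K w \<in> C"
    using zw zC wC lh(1,4) unfolding is_subgroup_def by blast+
  ultimately have "good (zmul K z + zmul K w)" using goodI[OF C] by blast
  moreover have "bb (zmul K z + zmul K w) = zmul K (bb z + bb w)"
    using lh(7)[OF zw wC] goodD(3,4) assms by (simp add: zmul_add_right)
  ultimately show ?thesis using K unfolding e[symmetric] by blast
qed

text \<open>\<open>ext a y\<close> says that the homomorphism between the rational hulls which extends \<open>bb\<close> maps
  \<open>a\<close> to \<open>y\<close>.\<close>

definition ext :: "'a \<Rightarrow> 'b \<Rightarrow> bool" where
  "ext a y \<longleftrightarrow> (\<exists>N>0. good (zmul N a) \<and> bb (zmul N a) = zmul N y)"

lemma ext_good: "good z \<Longrightarrow> ext z (bb z)"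
  unfolding ext_def by (intro exI[of _ 1]) auto

lemma ext_unique:
  assumes "ext a y" "ext a y'"
  shows "y = y'"
proof -
  obtain N M where N: "N > 0" "good (zmul N a)" "bb (zmul N a) = zmul N y"
    and M: "M > 0" "good (zmul M a)" "bb (zmul M a) = zmul M y'"
    using assms unfolding ext_def by blast
  have "zmul (M * N) y = bb (zmul M (zmul N a))" using N goodD(4)[OF N(2), of M] by (simp add: zmul_mult)
  also have "\<dots> = bb (zmul N (zmul M a))" by (simp add: zmul_commute)
  also have "\<dots> = zmul (M * N) y'" using M goodD(4)[OF M(2), of N] by (simp add: mult.commute flip: zmul_mult)
  finally show ?thesis using torsion_free_cancel[OF tf_B] N M by (metis mult_pos_pos less_irrefl)
qed

lemma ext_zmul:
  assumes "ext a y"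
  shows "ext (zmul k a) (zmul k y)"
proof -
  obtain N where N: "N > 0" "good (zmul N a)" "bb (zmul N a) = zmul N y"
    using assms unfolding ext_def by blast
  have "good (zmul N (zmul k a))" "bb (zmul N (zmul k a)) = zmul N (zmul k y)"
    using goodD(4,5)[OF N(2), of k] N(3) by (simp_all add: zmul_commute[of N k])
  then show ?thesis unfolding ext_def using N(1) by blast
qed

lemma ext_divide:
  assumes "ext (zmul k a) (zmul k y)" "k > 0"
  shows "ext a y"
proof -
  obtain N where N: "N > 0" "good (zmul N (zmul k a))" "bb (zmul N (zmul k a)) = zmul N (zmul k y)"
    using assms unfolding ext_def by blast
  then show ?thesis unfolding ext_def using assms(2)
    by (intro exI[of _ "N * k"]) (simp add: zmul_mult)
qed

lemma ext_add:
  assumes "ext a y" "ext a' y'"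
  shows "ext (a + a') (y + y')"
proof -
  obtain N M where N: "N > 0" "good (zmul N a)" "bb (zmul N a) = zmul N y"
    and M: "M > 0" "good (zmul M a')" "bb (zmul M a') = zmul M y'"
    using assms unfolding ext_def by blast
  let ?z = "zmul M (zmul N a)" and ?w = "zmul N (zmul M a')"
  have "good ?z" "good ?w" using N M goodD(5) by auto
  then obtain K where K: "K > 0" "good (zmul K (?z + ?w))" "bb (zmul K (?z + ?w)) = zmul K (bb ?z + bb ?w)"
    using good_add by blast
  have e: "zmul K (?z + ?w) = zmul (K * (M * N)) (a + a')"
    by (simp add: zmul_add_right zmul_mult zmul_commute[of N M])
  have "bb ?z + bb ?w = zmul (M * N) (y + y')"
    using goodD(4)[OF N(2), of M] goodD(4)[OF M(2), of N] N(3) M(3)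
    by (simp add: zmul_add_right zmul_mult zmul_commute[of N M])
  then have "bb (zmul (K * (M * N)) (a + a')) = zmul (K * (M * N)) (y + y')"
    using K(3) unfolding e by (simp add: zmul_mult)
  then show ?thesis using K(1,2) N(1) M(1) unfolding e ext_def
    by (intro exI[of _ "K * (M * N)"]) simp
qed

lemma ext_diff:
  assumes "ext a y" "ext a' y'"
  shows "ext (a - a') (y - y')"
  using ext_add[OF assms(1) ext_zmul[OF assms(2), of "- 1"]] by (simp add: zmul_minus)

lemma ext_zero_imp:
  assumes "ext a 0"
  shows "a = 0"
proof -
  obtain N where N: "N > 0" "good (zmul N a)" "bb (zmul N a) = zmul N 0"
    using assms unfolding ext_def by blast
  then have "zmul N a = 0" using bb_al_eq_0[of "zmul N a"] goodD(1,2) by simp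
  then show ?thesis using torsion_freeD[OF tf_A] N(1) by blast
qed

lemma ext_act_S:
  assumes s: "s \<in> S" and "ext a y"
  shows "ext (\<sigma> s a) (\<tau> (tt s) y)"
proof -
  obtain N where N: "N > 0" "good (zmul N a)" "bb (zmul N a) = zmul N y"
    using assms unfolding ext_def by blast
  obtain C where C: "C \<in> src.\<C>" "\<forall>z\<in>C. tt s + al z = al (\<sigma> s z) + tt s \<and>
    (al z = 0 \<longrightarrow> al (\<sigma> s z) = 0 \<and> bb (\<sigma> s z) = \<tau> (tt s) (bb z))"
    using tt_conj[OF s] by blast
  obtain M where M: "M > 0" "zmul M (zmul N a) \<in> C"
    using src.multiple_in_constructible[OF C(1) goodD(1)[OF N(2)]] by blast
  let ?z = "zmul M (zmul N a)"
  have gz: "good ?z" using goodD(5)[OF N(2)] .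
  \<comment> \<open>Goodness of the image concerns all its multiples; those of \<open>?z\<close>
    remain in the subgroup \<open>C\<close>, so the conjugation formula applies to each.\<close>
  have k: "al (\<sigma> s (zmul k ?z)) = 0 \<and> bb (\<sigma> s (zmul k ?z)) = \<tau> (tt s) (zmul k (bb ?z))" for k
  proof -
    have "zmul k ?z \<in> C" using is_subgroup_zmul M(2) src.constructible_subgroup[OF C(1)] by blast
    then show ?thesis using C(2) goodD(3,4)[OF gz] by simp
  qed
  have "good (\<sigma> s ?z)" unfolding good_def
    using k k[of 1] src.act_A[OF s goodD(1)[OF gz]] by (simp add: src.act_zmul tgt.act_zmul)
  moreover have "\<sigma> s ?z = zmul (M * N) (\<sigma> s a)" by (simp add: src.act_zmul zmul_mult)
  moreover have "bb (\<sigma> s ?z) = zmul (M * N) (\<tau> (tt s) y)"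
    using k[of 1] goodD(4)[OF N(2), of M] N(3) by (simp add: tgt.act_zmul zmul_mult)
  ultimately show ?thesis unfolding ext_def using M(1) N(1)
    by (intro exI[of _ "M * N"]) simp
qed

end

text \<open>The common outcome of the conditions (I) and (III), from which both embeddings are
  built.\<close>

locale torsion_cocycle = cocycle S A \<sigma> T B \<tau> c
  for S :: "'g::group_add set" and A :: "'a::ab_group_add set" and \<sigma> :: "'g \<Rightarrow> 'a \<Rightarrow> 'a"
    and T :: "'h::group_add set" and B :: "'b::ab_group_add set" and \<tau> :: "'h \<Rightarrow> 'b \<Rightarrow> 'b"
    and c :: "'a \<times> 'g \<Rightarrow> ('a set \<Rightarrow> 'a set) \<Rightarrow> 'b \<times> 'h" +
  assumes multiple_good: "z \<in> A \<Longrightarrow> \<exists>N>0. good (zmul N z)"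
begin

section \<open>The equivariant map between the rational hulls\<close>

lemma ext_multiple: "\<exists>N>0. \<exists>y. ext (zmul N a) y"
proof -
  obtain M where M: "M > 0" "zmul M a \<in> A" using src.multiple_in_A by blast
  then obtain N where N: "N > 0" "good (zmul N (zmul M a))" using multiple_good by blast
  then have "ext (zmul (N * M) a) (bb (zmul (N * M) a))" using ext_good by (simp add: zmul_mult)
  then show ?thesis using M N by (intro exI[of _ "N * M"]) auto
qed

text \<open>The inverse of \<open>s\<close> may lead out of \<open>A\<close>, so the conjugation
  formula is not applied to it. Some multiple of the new element has a value anyway, and applying
  \<open>s\<close> to it determines this value.\<close>

lemma ext_act_minus_S:
  assumes s: "s \<in> S" and e: "ext a y"
  shows "ext (\<sigma> (- s) a) (\<tau> (- tt s) y)"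
proof -
  obtain N y0 where N: "N > 0" "ext (zmul N (\<sigma> (- s) a)) y0" using ext_multiple by blast
  have "ext (zmul N a) (\<tau> (tt s) y0)"
    using ext_act_S[OF s N(2)] by (simp add: src.act_zmul)
  then have "zmul N y = \<tau> (tt s) y0" using ext_unique ext_zmul[OF e, of N] by blast
  then have "y0 = zmul N (\<tau> (- tt s) y)" by (metis tgt.act_minus_cancel(1) tgt.act_zmul)
  then show ?thesis using ext_divide N by blast
qed

lemma ext_act: "ext a y \<Longrightarrow> ext (\<sigma> g a) (\<tau> (tt g) y)"
proof -
  have "g \<in> gen_subgroup S" using src.gen_S by simp
  then have "(\<forall>a y. ext a y \<longrightarrow> ext (\<sigma> g a) (\<tau> (tt g) y)) \<and> (\<forall>a y. ext a y \<longrightarrow> ext (\<sigma> (- g) a) (\<tau> (- tt g) y))"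
  proof (induction rule: gen_subgroup_induct)
    case zero
    then show ?case by simp
  next
    case (add x y)
    have "\<sigma> (- y - x) a = \<sigma> (- y) (\<sigma> (- x) a)" "\<tau> (- tt y - tt x) b = \<tau> (- tt y) (\<tau> (- tt x) b)" for a b
      using src.act_add[of "- y" "- x" a] tgt.act_add[of "- tt y" "- tt x" b] by simp_all
    then show ?case using add by (simp add: tt_add minus_add src.act_add tgt.act_add)
  next
    case (minus x)
    then show ?case by (simp add: tt_minus)
  next
    case (gen x)
    then show ?case using ext_act_S ext_act_minus_S by blast
  qed
  then show "ext a y \<Longrightarrow> ext (\<sigma> g a) (\<tau> (tt g) y)" by blast
qed

lemma tt_inj: "inj tt"
proof (rule injI)
  fix g h assume gh: "tt g = tt h"
  have t0: "tt (- h + g) = 0" using gh by (simp add: tt_add tt_minus)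
  have "\<sigma> (- h + g) a = a" for a
  proof -
    obtain N y where N: "N > 0" "ext (zmul N a) y" using ext_multiple by blast
    have "ext (\<sigma> (- h + g) (zmul N a)) y" using ext_act[OF N(2), of "- h + g"] t0 by simp
    then have "ext (\<sigma> (- h + g) (zmul N a) - zmul N a) 0" using ext_diff[OF _ N(2)] by fastforce
    then have "zmul N (\<sigma> (- h + g) a) = zmul N a" using ext_zero_imp by (fastforce simp: src.act_zmul)
    then show ?thesis using torsion_free_cancel[OF tf_A] N(1) by blast
  qed
  then have "- h + g = 0" using src.eq_0_if_fixes[OF constructible.top] by blast
  then show "g = h" by (metis add_minus_cancel add_0_right)
qed

text \<open>A class may have numerators without a value under \<open>ext\<close>, so the choice
  ranges over those representatives that have one; any two lead to the same class.\<close>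

definition bd :: "('a \<times> int) set \<Rightarrow> ('b \<times> int) set" where
  "bd x = (SOME X. \<exists>a m y. x = qcls UNIV (a, m) \<and> 0 < m \<and> ext a y \<and> X = qcls UNIV (y, m))"

lemma bd_qcls:
  assumes "ext a y" "0 < m"
  shows "bd (qcls UNIV (a, m)) = qcls UNIV (y, m)"
  unfolding bd_def
proof (rule some_equality)
  show "\<exists>a' m' y'. qcls UNIV (a, m) = qcls UNIV (a', m') \<and> 0 < m' \<and> ext a' y' \<and> qcls UNIV (y, m) = qcls UNIV (y', m')"
    using assms by blast
  fix X assume "\<exists>a' m' y'. qcls UNIV (a, m) = qcls UNIV (a', m') \<and> 0 < m' \<and> ext a' y' \<and> X = qcls UNIV (y', m')"
  then obtain a' m' y' where *: "qcls UNIV (a, m) = qcls UNIV (a', m')" "0 < m'" "ext a' y'" "X = qcls UNIV (y', m')"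
    by (elim exE conjE)
  have "zmul m' a = zmul m a'" using *(1) qcls_eq_iff[OF tf_A UNIV_I UNIV_I assms(2) *(2)] by simp
  then have "zmul m' y = zmul m y'"
    using ext_zmul[OF assms(1), of m'] ext_zmul[OF *(3), of m] ext_unique by simp
  then show "X = qcls UNIV (y, m)"
    unfolding *(4) using qcls_eq_iff[OF tf_B UNIV_I UNIV_I *(2) assms(2)] by simp
qed

lemma QT_ext:
  assumes "x \<in> QT UNIV"
  shows "\<exists>a m y. x = qcls UNIV (a, m) \<and> 0 < m \<and> ext a y"
proof -
  obtain a m where am: "x = qcls UNIV (a, m)" "0 < m" using assms unfolding QT_def by (elim CollectE exE conjE)
  obtain N y where N: "N > 0" "ext (zmul N a) y" using ext_multiple by blast
  have "x = qcls UNIV (zmul N a, N * m)"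
    unfolding am(1) using qcls_eq_iff[OF tf_A, of a UNIV "zmul N a" m "N * m"] am N
    by (simp add: mult.commute flip: zmul_mult)
  moreover have "0 < N * m" using N(1) am(2) by simp
  ultimately show ?thesis using N(2) by (intro exI[of _ "zmul N a"] exI[of _ "N * m"] exI[of _ y]) simp
qed

lemma rational_embedding:
  "\<exists>(t :: 'g \<Rightarrow> 'h) (bd :: ('a \<times> int) set \<Rightarrow> ('b \<times> int) set).
     is_group_hom t \<and> inj t \<and>
     bd ` QT (UNIV :: 'a set) \<subseteq> QT (UNIV :: 'b set) \<and>
     (\<forall>x\<in>QT UNIV. \<forall>y\<in>QT UNIV. bd (qadd UNIV x y) = qadd UNIV (bd x) (bd y)) \<and>
     inj_on bd (QT UNIV) \<and>
     (\<forall>s. \<forall>x\<in>QT UNIV. bd (qmap UNIV (\<sigma> s) x) = qmap UNIV (\<tau> (t s)) (bd x))"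
proof (intro exI[of _ tt] exI[of _ bd] conjI ballI allI)
  show "is_group_hom tt" unfolding is_group_hom_def using tt_add by blast
  show "inj tt" by (rule tt_inj)
  show "bd ` QT UNIV \<subseteq> QT UNIV"
  proof (rule image_subsetI)
    fix x :: "('a \<times> int) set" assume "x \<in> QT UNIV"
    then obtain a m y where "x = qcls UNIV (a, m)" "0 < m" "ext a y" using QT_ext by blast
    then show "bd x \<in> QT UNIV" by (simp add: bd_qcls qcls_in_QT)
  qed
next
  fix x y :: "('a \<times> int) set" assume "x \<in> QT UNIV" "y \<in> QT UNIV"
  then obtain a m u b n v where x: "x = qcls UNIV (a, m)" "0 < m" "ext a u"
    and y: "y = qcls UNIV (b, n)" "0 < n" "ext b v" using QT_ext by metis
  have "ext (zmul n a + zmul m b) (zmul n u + zmul m v)" using ext_add ext_zmul x y by blast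
  then show "bd (qadd UNIV x y) = qadd UNIV (bd x) (bd y)"
    using x y by (simp add: bd_qcls qadd_qcls tf_A tf_B)
next
  show "inj_on bd (QT UNIV)"
  proof (rule inj_onI)
    fix x y :: "('a \<times> int) set" assume "x \<in> QT UNIV" "y \<in> QT UNIV" and e: "bd x = bd y"
    then obtain a m u b n v where x: "x = qcls UNIV (a, m)" "0 < m" "ext a u"
      and y: "y = qcls UNIV (b, n)" "0 < n" "ext b v" using QT_ext by metis
    have "zmul n u = zmul m v" using e x y by (simp add: bd_qcls qcls_eq_iff[OF tf_B])
    then have "ext (zmul n a - zmul m b) 0"
      using ext_diff[OF ext_zmul[OF x(3), of n] ext_zmul[OF y(3), of m]] by simp
    then have "zmul n a = zmul m b" using ext_zero_imp by fastforce
    then show "x = y" using x y by (simp add: qcls_eq_iff[OF tf_A])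
  qed
next
  fix s and x :: "('a \<times> int) set" assume "x \<in> QT UNIV"
  then obtain a m u where x: "x = qcls UNIV (a, m)" "0 < m" "ext a u" using QT_ext by blast
  then show "bd (qmap UNIV (\<sigma> s) x) = qmap UNIV (\<tau> (tt s)) (bd x)"
    using ext_act by (simp add: bd_qcls qmap_qcls tf_A tf_B src.act_hom tgt.act_hom)
qed

text \<open>If \<open>\<sigma> (r + s) x\<close> is good, pulling its value back by equivariance
  gives a value of \<open>ext\<close> at \<open>x\<close> itself. So \<open>ext\<close> is defined
  everywhere and no denominators remain.\<close>

lemma integral_embedding:
  assumes int: "\<And>z. z \<in> A \<Longrightarrow> \<exists>r\<in>S. good (\<sigma> r z)"
    and loc: "loc_set S A \<sigma> = UNIV" "loc_set T B \<tau> = UNIV"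
  shows "\<exists>(t :: 'g \<Rightarrow> 'h) (b' :: 'a \<Rightarrow> 'b).
     is_group_hom t \<and> inj t \<and>
     b' ` loc_set S A \<sigma> \<subseteq> loc_set T B \<tau> \<and>
     (\<forall>x\<in>loc_set S A \<sigma>. \<forall>y\<in>loc_set S A \<sigma>. b' (x + y) = b' x + b' y) \<and>
     inj_on b' (loc_set S A \<sigma>) \<and>
     (\<forall>x\<in>loc_set S A \<sigma>. \<forall>s. b' (\<sigma> s x) = \<tau> (t s) (b' x))"
proof -
  have "\<exists>y. ext x y" for x
  proof -
    have "x \<in> loc_set S A \<sigma>" using loc by simp
    then obtain s where s: "s \<in> S" "\<sigma> s x \<in> A" unfolding loc_set_def by blast
    obtain r where r: "r \<in> S" "good (\<sigma> r (\<sigma> s x))" using int[OF s(2)] by blast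
    have "ext (\<sigma> (- (r + s)) (\<sigma> (r + s) x)) (\<tau> (tt (- (r + s))) (bb (\<sigma> r (\<sigma> s x))))"
      by (rule ext_act) (use ext_good[OF r(2)] in \<open>simp add: src.act_add\<close>)
    then show ?thesis by (auto simp only: src.act_minus_cancel)
  qed
  then have "\<forall>x. \<exists>y. ext x y" by blast
  from choice[OF this] obtain b' where b: "\<And>x. ext x (b' x)" by blast
  show ?thesis
    unfolding loc
  proof (intro exI[of _ tt] exI[of _ b'] conjI ballI allI)
    show "is_group_hom tt" unfolding is_group_hom_def using tt_add by blast
    show "inj tt" by (rule tt_inj)
    show "b' (x + y) = b' x + b' y" for x y by (rule ext_unique[OF b ext_add[OF b b]])
    show "b' (\<sigma> s x) = \<tau> (tt s) (b' x)" for s x by (rule ext_unique[OF b ext_act[OF b]])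
    show "inj b'"
    proof (rule injI)
      fix x y assume "b' x = b' y"
      then have "ext (x - y) 0" using ext_diff[OF b[of x] b[of y]] by simp
      then show "x = y" using ext_zero_imp by fastforce
    qed
  qed simp
qed

end

section \<open>Torsion and integrality\<close>

text \<open>Let \<open>d\<close> be the nontrivial gcd of \<open>l\<close> with
  \<open>\<mu>\<close>, say. Then \<open>l div d\<close> kills the \<open>\<mu>\<close>-fold of
  \<open>a\<close>, hence also its conjugate, the \<open>\<nu>\<close>-fold, and so \<open>d\<close>
  divides \<open>\<nu>\<close> too. The other case is symmetric.\<close>

lemma conj_multiples_order_contradiction:
  fixes a u :: "'h::group_add"
  assumes a: "has_order a l" and conj: "u + zmul (int \<mu>) a - u = zmul (int \<nu>) a"
    and cop: "coprime \<mu> \<nu>" and g: "gcd l \<mu> > 1 \<or> gcd l \<nu> > 1"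
  shows False
proof -
  have l: "0 < l" "zmul (int l) a = 0" using a unfolding has_order_def by auto
  have kill: "zmul (int (l div d)) (zmul (int m) a) = 0" if "d dvd l" "d dvd m" for d m :: nat
  proof -
    have "l div d * m = (m div d) * l" using that by (metis dvd_div_mult mult.commute dvd_mult_div_cancel div_mult_swap)
    then have "int (l div d) * int m = int (m div d) * int l" by (simp flip: of_nat_mult)
    then show ?thesis using l(2) by (simp flip: zmul_mult) (simp add: zmul_mult)
  qed
  have dvd: "d dvd m" if "d dvd l" "zmul (int (l div d)) (zmul (int m) a) = 0" for d m :: nat
  proof -
    have "int l dvd int (l div d) * int m" using has_order_dvd[OF a] that(2) by (simp add: zmul_mult)
    then have "l dvd (l div d) * m" by (simp flip: of_nat_mult)
    then have "(l div d) * d dvd (l div d) * m" using that(1) by simp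
    moreover have "l div d \<noteq> 0" using that(1) l(1) by (auto elim: dvdE)
    ultimately show ?thesis by simp
  qed
  have tr: "zmul k (zmul (int \<nu>) a) = u + zmul k (zmul (int \<mu>) a) - u" for k
    using zmul_conj[of k u "zmul (int \<mu>) a"] conj by simp
  have "\<exists>d>1. d dvd \<mu> \<and> d dvd \<nu>"
    using g
  proof
    assume g: "gcd l \<mu> > 1"
    let ?d = "gcd l \<mu>"
    have "zmul (int (l div ?d)) (zmul (int \<mu>) a) = 0" by (rule kill) auto
    then have "zmul (int (l div ?d)) (zmul (int \<nu>) a) = 0" by (simp add: tr)
    then have "?d dvd \<nu>" using dvd by blast
    then show ?thesis using g by (intro exI[of _ ?d]) auto
  next
    assume g: "gcd l \<nu> > 1"
    let ?d = "gcd l \<nu>"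
    have "zmul (int (l div ?d)) (zmul (int \<nu>) a) = 0" by (rule kill) auto
    then have "u + zmul (int (l div ?d)) (zmul (int \<mu>) a) - u = 0" by (simp add: tr)
    then have "zmul (int (l div ?d)) (zmul (int \<mu>) a) = 0" by (metis add_0_right add_left_cancel diff_eq_eq add_0_left)
    then have "?d dvd \<mu>" using dvd by blast
    then show ?thesis using g by (intro exI[of _ ?d]) auto
  qed
  then show False using cop by (metis coprime_common_divisor_nat nat_less_le)
qed

section \<open>Finite order from conjugation to a power\<close>

context std_action
begin

lemma act_zmul_group: "\<sigma> (zmul (int n) g) x = ((\<sigma> g) ^^ n) x"
proof (induction n arbitrary: x)
  case (Suc n)
  have "zmul (int (Suc n)) g = zmul (int n) g + g" by (rule zmul_of_nat_Suc)
  then show ?case using Suc by (simp add: act_add funpow_swap1)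
qed simp

lemma zmul_in_S: "s \<in> S \<Longrightarrow> zmul (int n) s \<in> S"
proof (induction n)
  case (Suc n)
  then show ?case using S_monoid zmul_of_nat_Suc[of n s] by simp
qed (use S_monoid in simp)

text \<open>As \<open>\<kappa>\<close> may be negative, conjugation is done twice: the exponent
  becomes the square, and iterates of \<open>\<sigma> \<alpha>\<close> can be used. The resulting
  nonzero vector fixed by a power of \<open>\<alpha>\<close> makes this power trivial by
  (F).\<close>

lemma finite_order_if_conj_power:
  fixes u \<alpha> :: 'g
  assumes tf: "torsion_free_set (UNIV :: 'a set)" and fr: "finite_rank (UNIV :: 'a set)"
    and F: "cond_F \<sigma>" and conj: "u + \<alpha> - u = zmul \<kappa> \<alpha>" and \<kappa>: "\<bar>\<kappa>\<bar> \<ge> 2"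
  shows "finite_order \<alpha>"
proof (cases "\<forall>x::'a. x = 0")
  case True
  have "\<sigma> \<alpha> x = x" for x using True by metis
  then have "\<alpha> = 0" using eq_0_if_fixes[OF constructible.top] by blast
  then show ?thesis by (intro finite_orderI[of 1]) auto
next
  case False
  define k where "k = nat (\<kappa> * \<kappa>)"
  have "2 * 2 \<le> \<bar>\<kappa>\<bar> * \<bar>\<kappa>\<bar>" by (rule mult_mono) (use \<kappa> in auto)
  then have k: "2 \<le> k" "int k = \<kappa> * \<kappa>" unfolding k_def by (auto simp flip: abs_mult simp: le_nat_iff)
  have c1: "u + \<alpha> = zmul \<kappa> \<alpha> + u" using conj by (simp add: diff_eq_eq)
  have c2: "u + zmul \<kappa> \<alpha> = zmul (\<kappa> * \<kappa>) \<alpha> + u"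
    using zmul_conj[of \<kappa> u \<alpha>] conj by (simp add: zmul_mult diff_eq_eq)
  have "u + u + \<alpha> = u + zmul \<kappa> \<alpha> + u" using c1 by (simp add: add.assoc)
  then have c3: "u + u + \<alpha> = zmul (int k) \<alpha> + (u + u)" unfolding c2 k(2) by (simp add: add.assoc)
  have UM: "\<sigma> (u + u) (\<sigma> \<alpha> x) = ((\<sigma> \<alpha>) ^^ k) (\<sigma> (u + u) x)" for x
    using arg_cong[OF c3, of "\<lambda>g. \<sigma> g x"] unfolding act_add act_zmul_group .
  have "surj (\<sigma> (u + u))" by (rule surjI[of _ "\<sigma> (- (u + u))"]) (rule act_minus_cancel(2))
  moreover have "inj (\<sigma> \<alpha>)" by (rule injI) (rule act_inj)
  ultimately obtain n w where n: "n > 0" "w \<noteq> 0" "((\<sigma> \<alpha>) ^^ n) w = w"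
    using fixed_vector_if_conj_to_power[OF tf fr, of "\<sigma> \<alpha>" "\<sigma> (u + u)" k] act_hom k(1) UM False by blast
  have "zmul (int n) \<alpha> = 0"
  proof (rule ccontr)
    assume "zmul (int n) \<alpha> \<noteq> 0"
    then have inj: "inj (\<lambda>x. x - \<sigma> (zmul (int n) \<alpha>) x)" using F unfolding cond_F_def by blast
    have "w - \<sigma> (zmul (int n) \<alpha>) w = 0 - \<sigma> (zmul (int n) \<alpha>) 0"
      using n(3) unfolding act_zmul_group[of n \<alpha> w] by simp
    then show False using n(2) injD[OF inj, of w 0] by simp
  qed
  then show ?thesis using n(1) by (intro finite_orderI[of "int n"]) auto
qed

text \<open>For the exponent -1 squaring yields nothing. Instead (F) forces a nontrivial involution
  \<open>u\<close> to act as -1, because x + \<sigma>_u(x) is fixed by \<open>u\<close>. Then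
  \<open>u\<close> commutes with the action of \<open>\<alpha>\<close>, which therefore equals that
  of \<open>- \<alpha>\<close>.\<close>

lemma finite_order_if_conj_minus:
  fixes u \<alpha> :: 'g
  assumes F: "cond_F \<sigma>" and conj: "u + \<alpha> - u = - \<alpha>" and uu: "u + u = 0"
  shows "finite_order \<alpha>"
proof -
  have two: "zmul 2 \<alpha> = \<alpha> + \<alpha>" using zmul_add_left[of 1 1 \<alpha>] by simp
  have "\<alpha> + \<alpha> = 0"
  proof (cases "u = 0")
    case True
    then have "\<alpha> = - \<alpha>" using conj by simp
    then show ?thesis by (metis add.right_inverse)
  next
    case False
    then have inj: "inj (\<lambda>x. x - \<sigma> u x)" using F unfolding cond_F_def by blast
    have u: "\<sigma> u x = - x" for x
    proof -
      have "\<sigma> u (\<sigma> u x) = x" using act_add[of u u x] uu by simp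
      then have "(x + \<sigma> u x) - \<sigma> u (x + \<sigma> u x) = 0 - \<sigma> u 0" by (simp add: act_hom)
      then have "x + \<sigma> u x = 0" using injD[OF inj, of "x + \<sigma> u x" 0] by simp
      then show ?thesis by (simp add: eq_neg_iff_add_eq_0 add.commute)
    qed
    have m: "\<sigma> g (- x) = - \<sigma> g x" for g x using act_diff[of g 0 x] by simp
    have "u + \<alpha> = - \<alpha> + u" using conj by (metis diff_add_cancel)
    then have "\<sigma> u (\<sigma> \<alpha> x) = \<sigma> (- \<alpha>) (\<sigma> u x)" for x by (simp flip: act_add)
    then have "\<sigma> \<alpha> x = \<sigma> (- \<alpha>) x" for x by (simp add: u m)
    then have "\<sigma> (\<alpha> + \<alpha>) x = x" for x unfolding act_add by (metis act_minus_cancel(2))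
    then show ?thesis using eq_0_if_fixes[OF constructible.top] by blast
  qed
  then show ?thesis using two by (intro finite_orderI[of 2]) auto
qed

end

section \<open>Torsion of the component in the acting group\<close>

context cocycle
begin

lemma common_multiple_in_constructible:
  assumes "C \<in> src.\<C>" "y \<in> A" "z \<in> A"
  shows "\<exists>N>0. zmul N y \<in> C \<and> zmul N z \<in> C"
proof -
  obtain M where M: "M > 0" "zmul M y \<in> C" using src.multiple_in_constructible[OF assms(1,2)] by blast
  obtain N where N: "N > 0" "zmul N z \<in> C" using src.multiple_in_constructible[OF assms(1,3)] by blast
  have "zmul N (zmul M y) \<in> C" "zmul M (zmul N z) \<in> C"
    using is_subgroup_zmul src.constructible_subgroup[OF assms(1)] M N by blast+
  then show ?thesis using M N
    by (intro exI[of _ "M * N"]) (simp add: zmul_mult zmul_commute[of M N])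
qed

lemma good_multiple_if_finite_order:
  assumes "local_hom G C" "z \<in> G" "z \<in> C" "finite_order (al z)"
  shows "\<exists>N>0. good (zmul N z)"
proof -
  obtain n :: nat where n: "0 < n" "zmul (int n) (al z) = 0" using assms(4) unfolding finite_order_def by blast
  have "al (zmul (int n) z) = 0" using local_hom_al_zmul[OF assms(1-3)] n by simp
  moreover have "zmul (int n) z \<in> G" "zmul (int n) z \<in> C"
    using is_subgroup_zmul local_homD(1,4)[OF assms(1)] assms(2,3) by blast+
  ultimately have "good (zmul (int n) z)" using goodI[OF assms(1)] by blast
  then show ?thesis using n(1) by (intro exI[of _ "int n"]) auto
qed

text \<open>For a multiple \<open>w\<close> of \<open>z\<close> on which both additivity and
  \<open>tt_conj\<close> are available, \<open>al (\<sigma> s w)\<close> is the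
  \<open>\<kappa>\<close>-fold of \<open>al w\<close> and also its conjugate by
  \<open>tt s\<close>.\<close>

lemma multiple_good_scalar:
  assumes s: "s \<in> S" "\<And>a. a \<in> A \<Longrightarrow> \<sigma> s a = zmul \<kappa> a"
    and fin: "\<And>\<alpha>. tt s + \<alpha> - tt s = zmul \<kappa> \<alpha> \<Longrightarrow> finite_order \<alpha>" and z: "z \<in> A"
  shows "\<exists>N>0. good (zmul N z)"
proof -
  obtain C where C: "local_hom (gen_subgroup {z}) C" using local_hom_exists[of "{z}"] z by auto
  note lh = local_homD[OF C]
  obtain D where D: "D \<in> src.\<C>" "\<forall>z\<in>D. tt s + al z = al (\<sigma> s z) + tt s"
    using tt_conj[OF s(1)] by blast
  have CD: "C \<inter> D \<in> src.\<C>" using src.constructible_inter lh(3) D(1) by blast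
  obtain n where n: "n > 0" "zmul n z \<in> C \<inter> D" using src.multiple_in_constructible[OF CD z] by blast
  let ?w = "zmul n z"
  have w: "?w \<in> gen_subgroup {z}" "?w \<in> C" "?w \<in> D"
    using is_subgroup_zmul[OF lh(1)] gen_subgroup_superset[of "{z}"] n by auto
  have "al (\<sigma> s ?w) = zmul \<kappa> (al ?w)"
    using s(2)[of ?w] subsetD[OF lh(5) w(2)] local_hom_al_zmul[OF C w(1,2)] by simp
  then have "tt s + al ?w - tt s = zmul \<kappa> (al ?w)" using D(2) w(3) by (simp add: diff_eq_eq)
  then obtain N where "N > 0" "good (zmul N ?w)"
    using good_multiple_if_finite_order[OF C w(1,2) fin] by blast
  then show ?thesis using n(1) by (intro exI[of _ "N * n"]) (simp add: zmul_mult)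
qed

text \<open>Since id - \<sigma>_s is injective and \<open>A'\<close> has finite rank, a multiple of
  \<open>z\<close> has the form y - \<sigma>_s(y). After passing to multiples, \<open>al u\<close>
  and its conjugate \<open>al v\<close> by \<open>tt s\<close> commute, as \<open>al\<close> is
  additive on commuting summands. The alternative between free and abelian then makes
  \<open>tt s\<close> commute with \<open>al u\<close>, so \<open>al (u - v) = 0\<close>.\<close>

lemma multiple_good_i1:
  assumes A': "is_subgroup A'" "A' \<subseteq> A" "finite_rank A'" and i1: "cond_i1 S A \<sigma> TYPE('h) A'" and z: "z \<in> A'"
  shows "\<exists>N>0. good (zmul N z)"
proof -
  obtain s where s: "s \<in> S" "\<sigma> s ` A' \<subseteq> A'" "inj_on (\<lambda>x. x - \<sigma> s x) A'"
    using i1 unfolding cond_i1_def by blast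
  have fa: "is_free_group (gen_subgroup {\<alpha>, \<beta>}) \<or> is_abelian_set (gen_subgroup {\<alpha>, \<beta>})" for \<alpha> \<beta> :: 'h
    using i1 unfolding cond_i1_def by blast
  have "(\<lambda>x. x - \<sigma> s x) ` A' \<subseteq> A'" using s(2) is_subgroup_diff[OF A'(1)] by blast
  then obtain M y where M: "M > 0" "y \<in> A'" "zmul M z = y - \<sigma> s y"
    using injective_endomorphism_rationally_onto[OF tf_A A'(1,3), of "\<lambda>x. x - \<sigma> s x" z] s(3) z
    by (auto simp: src.act_hom algebra_simps)
  have y: "y \<in> A" "\<sigma> s y \<in> A" using M(2) A'(2) s(2) by blast+
  let ?G = "gen_subgroup {y, \<sigma> s y}"
  obtain C where C: "local_hom ?G C" using local_hom_exists[of "{y, \<sigma> s y}"] y by auto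
  note lh = local_homD[OF C]
  obtain D where D: "D \<in> src.\<C>" "\<forall>z\<in>D. tt s + al z = al (\<sigma> s z) + tt s"
    using tt_conj[OF s(1)] by blast
  have CD: "C \<inter> D \<in> src.\<C>" using src.constructible_inter lh(3) D(1) by blast
  obtain n where n: "n > 0" "zmul n y \<in> C \<inter> D" "zmul n (\<sigma> s y) \<in> C \<inter> D"
    using common_multiple_in_constructible[OF CD y] by blast
  define u v where "u = zmul n y" and "v = zmul n (\<sigma> s y)"
  have uG: "u \<in> ?G" "v \<in> ?G" unfolding u_def v_def
    using is_subgroup_zmul[OF lh(1)] gen_subgroup_superset[of "{y, \<sigma> s y}"] by auto
  have uC: "u \<in> C" "v \<in> C" "u \<in> D" using n unfolding u_def v_def by auto
  have comm: "al u + al v = al v + al u"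
    using lh(6)[OF uG(1) uG(2) uC(2)] lh(6)[OF uG(2) uG(1) uC(1)] by (simp add: add.commute)
  have conj: "tt s + al u - tt s = al v"
    using D(2) uC(3) unfolding u_def v_def by (simp add: src.act_zmul diff_eq_eq)
  have "tt s + al u = al u + tt s"
    by (rule commute_if_commute_conj[OF fa]) (simp add: conj comm)
  then have "al v = al u" using conj by (simp add: diff_eq_eq)
  moreover have uv: "u - v \<in> ?G" "u - v \<in> C" using is_subgroup_diff lh(1,4) uG uC by blast+
  moreover have "al (u - v + v) = al (u - v) + al v" using lh(6)[OF uv(1) uG(2) uC(2)] .
  ultimately have "0 + al u = al (u - v) + al u" by simp
  then have "al (u - v) = 0" by (simp only: add_right_cancel)
  then have "good (u - v)" using goodI[OF C uv] by blast
  moreover have "u - v = zmul (n * M) z" unfolding u_def v_def using M(3) by (simp add: zmul_mult zmul_diff_right)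
  ultimately show ?thesis using n(1) M(1) by (intro exI[of _ "n * M"]) simp
qed

lemma multiple_good_cond_I_seq:
  assumes "cond_I_seq S A \<sigma> TYPE('h) An" and z: "z \<in> A"
  shows "\<exists>N>0. good (zmul N z)"
proof -
  have ex: "exhausting_fr_seq A An" using assms unfolding cond_I_seq_def by blast
  have "(\<forall>n. cond_i1 S A \<sigma> TYPE('h) (An n)) \<or> cond_i2 S A \<sigma> TYPE('h)"
    using assms unfolding cond_I_seq_def by blast
  then show ?thesis
  proof
    assume i1: "\<forall>n. cond_i1 S A \<sigma> TYPE('h) (An n)"
    obtain n where "z \<in> An n" using ex z unfolding exhausting_fr_seq_def by blast
    then show ?thesis using multiple_good_i1[of "An n"] i1 ex unfolding exhausting_fr_seq_def by blast
  next
    assume "cond_i2 S A \<sigma> TYPE('h)"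
    then obtain s \<kappa> where s: "s \<in> S" "\<forall>a\<in>A. \<sigma> s a = zmul \<kappa> a"
      "\<forall>\<alpha>::'h. (\<exists>\<gamma>. \<gamma> + \<alpha> + - \<gamma> = zmul \<kappa> \<alpha>) \<longrightarrow> finite_order \<alpha>"
      unfolding cond_i2_def by blast
    show ?thesis
    proof (rule multiple_good_scalar[OF s(1) _ _ z])
      fix \<alpha> assume "tt s + \<alpha> - tt s = zmul \<kappa> \<alpha>"
      then have "tt s + \<alpha> + - tt s = zmul \<kappa> \<alpha>" by simp
      then show "finite_order \<alpha>" using s(3) by blast
    qed (use s in blast)
  qed
qed

lemma multiple_good_cond_III:
  assumes III: "cond_III S A \<sigma> \<tau>" and z: "z \<in> A"
  shows "\<exists>N>0. good (zmul N z)"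
proof -
  obtain s \<kappa> where s: "s \<in> S" "\<kappa> \<noteq> 0" "\<kappa> \<noteq> 1" "\<forall>a\<in>A. \<sigma> s a = zmul \<kappa> a"
    using III unfolding cond_III_def by blast
  have fr: "finite_rank (UNIV :: 'b set)" and F: "cond_F \<tau>" using III unfolding cond_III_def by auto
  show ?thesis
  proof (rule multiple_good_scalar[OF s(1) _ _ z])
    fix \<alpha> assume conj: "tt s + \<alpha> - tt s = zmul \<kappa> \<alpha>"
    show "finite_order \<alpha>"
    proof (cases "\<kappa> = - 1")
      case True
      \<comment> \<open>Here \<open>s\<close> acts as -1, so (JF) makes it an involution, and
        \<open>tt s\<close> inherits this.\<close>
      have "\<sigma> (s + s) a = a" if "a \<in> A" for a
        using s(4) that A_closed(3)[OF that] by (simp add: src.act_add True zmul_minus)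
      then have "s + s = 0" using src.eq_0_if_fixes[OF constructible.top] by blast
      then have "tt s + tt s = 0" using tt_add[of s s] by simp
      then show ?thesis using tgt.finite_order_if_conj_minus[OF F] conj by (simp add: True zmul_minus)
    next
      case False
      then have "\<bar>\<kappa>\<bar> \<ge> 2" using s(2,3) by linarith
      then show ?thesis using tgt.finite_order_if_conj_power[OF tf_B fr F conj] by blast
    qed
  qed (use s in blast)
qed

end

section \<open>Integrality after applying an element of \<open>S\<close>\<close>

context torsion_cocycle
begin

text \<open>By (PC) and invariance, \<open>y = \<sigma> r z\<close> lies where additivity holds. It
  commutes with its good multiple, so \<open>al y\<close> fixes the value of that multiple. If
  \<open>al y\<close> were nontrivial, (F) would make this value 0 and hence \<open>y\<close> itself
  0.\<close>

lemma integral_if_cond_F: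
  assumes F: "cond_F \<tau>" and fg: "finite Z" "Z \<subseteq> A"
    and inv: "\<And>s. s \<in> S \<Longrightarrow> \<sigma> s ` gen_subgroup Z \<subseteq> gen_subgroup Z"
    and PC: "\<And>C. C \<in> src.\<C> \<Longrightarrow> \<exists>s\<in>S. \<sigma> s ` A \<subseteq> C" and z: "z \<in> gen_subgroup Z"
  shows "\<exists>r\<in>S. good (\<sigma> r z)"
proof -
  let ?G = "gen_subgroup Z"
  obtain C where C: "local_hom ?G C" using local_hom_exists[OF fg] by blast
  note lh = local_homD[OF C]
  obtain r where r: "r \<in> S" "\<sigma> r ` A \<subseteq> C" using PC[OF lh(3)] by blast
  define y where "y = \<sigma> r z"
  have y: "y \<in> ?G" "y \<in> C" "y \<in> A" using r z lh(2) inv[OF r(1)] src.act_A[OF r(1)] unfolding y_def by blast+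
  obtain N where N: "N > 0" "good (zmul N y)" using multiple_good[OF y(3)] by blast
  have Ny: "zmul N y \<in> ?G" "zmul N y \<in> C" using is_subgroup_zmul lh(1,4) y by blast+
  have "al y = 0"
  proof (rule ccontr)
    assume a: "al y \<noteq> 0"
    have "bb (y + zmul N y) = bb y + \<tau> (al y) (bb (zmul N y))" by (rule lh(7)[OF y(1) Ny])
    moreover have "bb (zmul N y + y) = bb (zmul N y) + bb y"
      using lh(7)[OF Ny(1) y(1,2)] goodD(2)[OF N(2)] by simp
    ultimately have "\<tau> (al y) (bb (zmul N y)) = bb (zmul N y)" by (simp add: add.commute)
    then have "bb (zmul N y) - \<tau> (al y) (bb (zmul N y)) = 0 - \<tau> (al y) 0" by simp
    moreover have "inj (\<lambda>x. x - \<tau> (al y) x)" using F a unfolding cond_F_def by blast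
    ultimately have "bb (zmul N y) = 0" using injD[of "\<lambda>x. x - \<tau> (al y) x" "bb (zmul N y)" 0] by simp
    then have "zmul N y = 0" using bb_al_eq_0 goodD(1,2)[OF N(2)] by blast
    then have "y = 0" using torsion_freeD[OF tf_A] N(1) by blast
    then show False using a by simp
  qed
  then show ?thesis using goodI[OF C y(1,2)] r(1) unfolding y_def by blast
qed

text \<open>Suitable multiples of the finitely many generators lie in \<open>C\<close> and have
  trivial \<open>al\<close>; a common factor \<open>e\<close> then does the same for the whole
  group. The bound leaves finitely many orders to be excluded.\<close>

lemma exponent_exists:
  assumes lh: "local_hom (gen_subgroup Z) C" and fg: "finite Z" "Z \<subseteq> A"
  shows "\<exists>e>0. \<forall>w\<in>gen_subgroup Z \<inter> C. zmul e (al w) = 0"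
proof -
  note lhD = local_homD[OF lh]
  let ?G = "gen_subgroup Z"
  have "\<exists>e>0. \<forall>f\<in>Z. zmul e f \<in> C \<and> al (zmul e f) = 0"
  proof -
    have "\<exists>e>0. \<forall>f\<in>Z'. zmul e f \<in> C \<and> good (zmul e f)" if "finite Z'" "Z' \<subseteq> A" for Z'
      using that
    proof induction
      case (insert f Z')
      then obtain d where d: "d > 0" "\<forall>f\<in>Z'. zmul d f \<in> C \<and> good (zmul d f)" by auto
      obtain N where N: "N > 0" "good (zmul N f)" using multiple_good[of f] insert by auto
      obtain M where M: "M > 0" "zmul M (zmul N f) \<in> C"
        using src.multiple_in_constructible[OF lhD(3) goodD(1)[OF N(2)]] by blast
      have sm: "zmul k x \<in> C \<and> good (zmul k x)" if "x \<in> C" "good x" for k x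
        using that is_subgroup_zmul[OF lhD(4)] goodD(5) by blast
      have "zmul (d * (M * N)) x \<in> C \<and> good (zmul (d * (M * N)) x)" if "x \<in> insert f Z'" for x
      proof (cases "x = f")
        case True
        have "good (zmul M (zmul N f))" using goodD(5)[OF N(2)] .
        then show ?thesis using sm[OF M(2), of d] True by (simp add: zmul_mult)
      next
        case False
        then have "zmul d x \<in> C" "good (zmul d x)" using that d(2) by auto
        then show ?thesis using sm[of "zmul d x" "M * N"] by (simp add: mult.commute flip: zmul_mult)
      qed
      then show ?case using d M N by (intro exI[of _ "d * (M * N)"]) auto
    qed (auto intro: exI[of _ 1])
    then show ?thesis using fg goodD(2) by meson
  qed
  then obtain e where e: "e > 0" "\<forall>f\<in>Z. zmul e f \<in> C \<and> al (zmul e f) = 0" by blast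
  have P: "x \<in> ?G \<and> zmul e x \<in> C \<and> al (zmul e x) = 0" if "x \<in> ?G" for x
    using that
  proof (induction rule: gen_subgroup_induct)
    case zero
    then show ?case using lhD(1,4) unfolding is_subgroup_def by simp
  next
    case (add x y)
    then have xy: "zmul e x \<in> ?G" "zmul e y \<in> ?G" using is_subgroup_zmul[OF lhD(1)] by blast+
    have "al (zmul e x + zmul e y) = 0" using lhD(6)[OF xy] add by simp
    then show ?case using add lhD(1,4) unfolding is_subgroup_def zmul_add_right by blast
  next
    case (minus x)
    then have x: "zmul e x \<in> ?G" "- zmul e x \<in> ?G"
      using is_subgroup_zmul[OF lhD(1)] lhD(1) unfolding is_subgroup_def by blast+
    have "al (- zmul e x + zmul e x) = al (- zmul e x) + al (zmul e x)"
      using lhD(6)[OF x(2,1)] minus by blast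
    then have "al (- zmul e x) = 0" using minus by simp
    then show ?case using minus lhD(1,4) unfolding is_subgroup_def zmul_minus_right by blast
  next
    case (gen x)
    then show ?case using e(2) gen_subgroup_superset by blast
  qed
  have "zmul e (al w) = 0" if "w \<in> ?G \<inter> C" for w
    using local_hom_al_zmul[OF lh, of w e] P[of w] that by simp
  then show ?thesis using e(1) by blast
qed

text \<open>Each order \<open>l\<close> is excluded on its own constructible subgroup, supplied by
  \<open>tt_conj\<close> for an element depending on \<open>l\<close>. As the orders are bounded by
  \<open>e\<close>, one subgroup \<open>E\<close> lies below all of these, and (PC) moves
  \<open>z\<close> into it.\<close>

lemma integral_if_cond_ii1:
  assumes A': "is_subgroup A'" "A' \<subseteq> A" and ii1: "cond_ii1 S A \<sigma> TYPE('h) A'"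
    and fg: "finite Z" "Z \<subseteq> A'"
    and inv: "\<And>s. s \<in> S \<Longrightarrow> \<sigma> s ` gen_subgroup Z \<subseteq> gen_subgroup Z"
    and PC: "\<And>C. C \<in> src.\<C> \<Longrightarrow> \<exists>s\<in>S. \<sigma> s ` A \<subseteq> C" and z: "z \<in> gen_subgroup Z"
  shows "\<exists>r\<in>S. good (\<sigma> r z)"
proof -
  let ?G = "gen_subgroup Z"
  have ZA: "Z \<subseteq> A" using fg A' by blast
  have GA': "?G \<subseteq> A'" by (rule gen_subgroup_least[OF A'(1) fg(2)])
  obtain C where C: "local_hom ?G C" using local_hom_exists[OF fg(1) ZA] by blast
  note lh = local_homD[OF C]
  obtain e where e: "e > 0" "\<forall>w\<in>?G \<inter> C. zmul e (al w) = 0" using exponent_exists[OF C fg(1) ZA] by blast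
  define L where "L = {l::nat. 1 < l \<and> int l \<le> e \<and> (\<exists>\<alpha>::'h. has_order \<alpha> l)}"
  have finL: "finite L" by (rule finite_subset[of _ "{..nat e}"]) (auto simp: L_def)
  have "\<exists>D. D \<in> src.\<C> \<and> (\<forall>w\<in>?G \<inter> C \<inter> D. \<not> has_order (al w) l)" if l: "l \<in> L" for l
  proof -
    have "1 < l \<and> (\<exists>\<alpha>::'h. has_order \<alpha> l)" using l unfolding L_def by blast
    from ii1[unfolded cond_ii1_def, rule_format, OF this]
    obtain s \<mu> \<nu> P \<delta> where s: "s \<in> S" "0 < \<mu>" "coprime \<mu> \<nu>" "\<sigma> s ` A' \<subseteq> A'"
      and P: "is_charpoly A' (\<sigma> s) P" "Polynomial.smult (of_nat \<mu>) P = monom (of_nat \<mu>) \<delta> - [:of_nat \<nu>:]"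
      and gcd: "gcd l \<mu> > 1 \<or> gcd l \<nu> > 1" by (elim bexE exE conjE)
    \<comment> \<open>\<open>g\<close> acts as the \<open>\<delta>\<close>-th power of
      \<open>\<sigma> s\<close>, so on \<open>A'\<close> the binomial relation reads
      \<open>\<mu> \<sigma>_g = \<nu>\<close> and turns into a conjugation between multiples of
      \<open>al w\<close>.\<close>
    define g where "g = zmul (int \<delta>) s"
    have g: "g \<in> S" unfolding g_def by (rule src.zmul_in_S[OF s(1)])
    obtain D where D: "D \<in> src.\<C>" "\<forall>z\<in>D. tt g + al z = al (\<sigma> g z) + tt g" using tt_conj[OF g] by blast
    have "\<not> has_order (al w) l" if w: "w \<in> ?G \<inter> C \<inter> D" for w
    proof
      assume o: "has_order (al w) l"
      have "zmul (int \<mu>) (\<sigma> g w) = zmul (int \<nu>) w"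
        unfolding g_def src.act_zmul_group
        by (rule is_charpoly_binomial[OF tf_A A'(1) src.act_hom s(4) P s(2)]) (use w GA' in blast)
      then have e1: "\<sigma> g (zmul (int \<mu>) w) = zmul (int \<nu>) w" by (simp add: src.act_zmul)
      have "zmul (int \<mu>) w \<in> D" using is_subgroup_zmul src.constructible_subgroup[OF D(1)] w by blast
      then have "tt g + al (zmul (int \<mu>) w) = al (zmul (int \<nu>) w) + tt g" using D(2) e1 by simp
      then have "tt g + zmul (int \<mu>) (al w) - tt g = zmul (int \<nu>) (al w)"
        using local_hom_al_zmul[OF C] w by (simp add: diff_eq_eq)
      then show False by (rule conj_multiples_order_contradiction[OF o _ s(3) gcd])
    qed
    then show ?thesis using D(1) by blast
  qed
  then have "\<forall>l\<in>L. \<exists>D. D \<in> src.\<C> \<and> (\<forall>w\<in>?G \<inter> C \<inter> D. \<not> has_order (al w) l)" by blast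
  from bchoice[OF this] obtain D where
    D: "\<forall>l\<in>L. D l \<in> src.\<C> \<and> (\<forall>w\<in>?G \<inter> C \<inter> D l. \<not> has_order (al w) l)" ..
  have "finite (insert C (D ` L))" "insert C (D ` L) \<subseteq> src.\<C>" using finL D lh(3) by auto
  from src.constructible_finite_lower_bound[OF this]
  obtain E where E: "E \<in> src.\<C>" "\<forall>X\<in>insert C (D ` L). E \<subseteq> X" ..
  obtain r where r: "r \<in> S" "\<sigma> r ` A \<subseteq> E" using PC[OF E(1)] by blast
  define y where "y = \<sigma> r z"
  have y: "y \<in> ?G" "y \<in> E" using r z lh(2) inv[OF r(1)] unfolding y_def by blast+
  have yC: "y \<in> C" using y(2) E(2) by blast
  have "zmul e (al y) = 0" using e(2) y yC by blast
  then have "finite_order (al y)" using e(1) by (intro finite_orderI[of e]) auto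
  then obtain l where l: "has_order (al y) l" using finite_order_has_order by blast
  have "int l dvd e" using has_order_dvd[OF l] \<open>zmul e (al y) = 0\<close> by blast
  then have le: "int l \<le> e" using e(1) by (rule zdvd_imp_le)
  have "l = 1"
  proof (rule ccontr)
    assume "l \<noteq> 1"
    moreover have "0 < l" using l unfolding has_order_def by blast
    ultimately have "l \<in> L" unfolding L_def using le l by auto
    moreover from this have "y \<in> D l" using E(2) y(2) by blast
    ultimately show False using D y(1) yC l by blast
  qed
  then have "al y = 0" using l unfolding has_order_def by simp
  then show ?thesis using goodI[OF C y(1) yC] r(1) unfolding y_def by blast
qed

end

section \<open>Assembly of the two statements\<close>

lemma increasing_union_finite_subset:
  assumes "finite F" "F \<subseteq> (\<Union>n. X n)" "\<And>n. X n \<subseteq> X (Suc n)"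
  shows "\<exists>n::nat. F \<subseteq> X n"
  using assms(1,2)
proof induction
  case (insert x F)
  have mono: "X m \<subseteq> X n" if "m \<le> n" for m n using that assms(3) by (rule lift_Suc_mono_le[rotated])
  obtain m n where "F \<subseteq> X m" "x \<in> X n" using insert by auto
  then show ?case using mono[of m "max m n"] mono[of n "max m n"] by (intro exI[of _ "max m n"]) auto
qed simp

theorem theorem3p23:
  fixes S :: "'g::group_add set" and A :: "'a::ab_group_add set" and \<sigma> :: "'g \<Rightarrow> 'a \<Rightarrow> 'a"
    and T :: "'h::group_add set" and B :: "'b::ab_group_add set" and \<tau> :: "'h \<Rightarrow> 'b \<Rightarrow> 'b"
    and c :: "'a \<times> 'g \<Rightarrow> ('a set \<Rightarrow> 'a set) \<Rightarrow> 'b \<times> 'h"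
  assumes std_S: "std_alg_action S A \<sigma>"
    and std_T: "std_alg_action T B \<tau>"
    and tf_A: "torsion_free_set (UNIV :: 'a set)"
    and tf_B: "torsion_free_set (UNIV :: 'b set)"
    and hom: "cont_groupoid_hom S A \<sigma> \<tau> c"
    and units: "unit_preimage S A \<sigma> c"
  shows "(cond_I S A \<sigma> TYPE('h) \<longrightarrow>
            (\<exists>t :: 'g \<Rightarrow> 'h. \<exists>bd :: ('a \<times> int) set \<Rightarrow> ('b \<times> int) set.
               is_group_hom t \<and> inj t \<and>
               bd ` QT (UNIV :: 'a set) \<subseteq> QT (UNIV :: 'b set) \<and>
               (\<forall>x\<in>QT UNIV. \<forall>y\<in>QT UNIV. bd (qadd UNIV x y) = qadd UNIV (bd x) (bd y)) \<and>
               inj_on bd (QT UNIV) \<and>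
               (\<forall>s. \<forall>x\<in>QT UNIV. bd (qmap UNIV (\<sigma> s) x) = qmap UNIV (\<tau> (t s)) (bd x))))
       \<and> (cond_star S A \<sigma> T B \<tau> \<longrightarrow>
            (\<exists>t :: 'g \<Rightarrow> 'h. \<exists>b' :: 'a \<Rightarrow> 'b.
               is_group_hom t \<and> inj t \<and>
               b' ` loc_set S A \<sigma> \<subseteq> loc_set T B \<tau> \<and>
               (\<forall>x\<in>loc_set S A \<sigma>. \<forall>y\<in>loc_set S A \<sigma>. b' (x + y) = b' x + b' y) \<and>
               inj_on b' (loc_set S A \<sigma>) \<and>
               (\<forall>x\<in>loc_set S A \<sigma>. \<forall>s. b' (\<sigma> s x) = \<tau> (t s) (b' x))))"
proof -
  interpret cocycle S A \<sigma> T B \<tau> c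
    by unfold_locales (fact std_S std_T tf_A tf_B hom units)+
  show ?thesis
  proof (intro conjI impI)
    assume "cond_I S A \<sigma> TYPE('h)"
    then obtain An where "cond_I_seq S A \<sigma> TYPE('h) An" unfolding cond_I_def by blast
    then interpret torsion_cocycle S A \<sigma> T B \<tau> c
      by unfold_locales (rule multiple_good_cond_I_seq)
    show "\<exists>t :: 'g \<Rightarrow> 'h. \<exists>bd :: ('a \<times> int) set \<Rightarrow> ('b \<times> int) set.
               is_group_hom t \<and> inj t \<and>
               bd ` QT (UNIV :: 'a set) \<subseteq> QT (UNIV :: 'b set) \<and>
               (\<forall>x\<in>QT UNIV. \<forall>y\<in>QT UNIV. bd (qadd UNIV x y) = qadd UNIV (bd x) (bd y)) \<and>
               inj_on bd (QT UNIV) \<and>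
               (\<forall>s. \<forall>x\<in>QT UNIV. bd (qmap UNIV (\<sigma> s) x) = qmap UNIV (\<tau> (t s)) (bd x))"
      by (rule rational_embedding)
  next
    assume star: "cond_star S A \<sigma> T B \<tau>"
    obtain An where An: "exhausting_fr_seq A An"
      "(cond_I_seq S A \<sigma> TYPE('h) An \<and> cond_II_seq S A \<sigma> \<tau> An) \<or> cond_III S A \<sigma> \<tau>"
      using star[unfolded cond_star_def, THEN conjunct1] by blast
    obtain Ak :: "nat \<Rightarrow> 'a set" where Ak: "\<forall>k. \<exists>F. finite F \<and> Ak k = gen_subgroup F"
      "\<forall>k. Ak k \<subseteq> Ak (Suc k)" "(\<Union>k. Ak k) = A" "\<forall>s\<in>S. \<forall>k. \<sigma> s ` Ak k \<subseteq> Ak k"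
      using star[unfolded cond_star_def, THEN conjunct2, THEN conjunct1] by (elim exE conjE)
    have ore: "ore_loc S A \<sigma>" "ore_loc T B \<tau>" using star unfolding cond_star_def by simp_all
    have loc: "loc_set S A \<sigma> = UNIV" "loc_set T B \<tau> = UNIV"
      using ore unfolding ore_loc_def by simp_all
    have PC: "\<exists>s\<in>S. \<sigma> s ` A \<subseteq> C" if "C \<in> src.\<C>" for C
      using star[unfolded cond_star_def, THEN conjunct2, THEN conjunct2, THEN conjunct2, THEN conjunct2] that
      by blast
    interpret torsion_cocycle S A \<sigma> T B \<tau> c
      by unfold_locales (use An(2) multiple_good_cond_I_seq multiple_good_cond_III in blast)
    have int: "\<exists>r\<in>S. good (\<sigma> r z)" if z: "z \<in> A" for z
    proof -
      obtain k where k: "z \<in> Ak k" using Ak(3) z by blast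
      obtain Z where Z: "finite Z" "Ak k = gen_subgroup Z" using Ak(1) by blast
      have ZA: "Z \<subseteq> A" using gen_subgroup_superset[of Z] Z(2) Ak(3) by blast
      have inv: "\<sigma> s ` gen_subgroup Z \<subseteq> gen_subgroup Z" if "s \<in> S" for s
        using Ak(4) that unfolding Z(2)[symmetric] by blast
      have zZ: "z \<in> gen_subgroup Z" using k Z(2) by simp
      show ?thesis
      \<comment> \<open>Condition (III) and the alternative (ii2) both contain (F). If (F) fails,
        only (ii1) remains, and the finite generating set then lies in a single
        \<open>An n\<close>.\<close>
      proof (cases "cond_F \<tau>")
        case True
        then show ?thesis using integral_if_cond_F[OF _ Z(1) ZA inv PC zZ] by blast
      next
        case False
        then have ii1: "\<forall>n. cond_ii1 S A \<sigma> TYPE('h) (An n)"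
          using An(2) unfolding cond_II_seq_def cond_III_def by blast
        obtain n where n: "Z \<subseteq> An n"
          using increasing_union_finite_subset[OF Z(1), of An] An(1) ZA
          unfolding exhausting_fr_seq_def by blast
        have sub: "is_subgroup (An n)" "An n \<subseteq> A" using An(1) unfolding exhausting_fr_seq_def by blast+
        show ?thesis by (rule integral_if_cond_ii1[OF sub ii1[rule_format] Z(1) n inv PC zZ])
      qed
    qed
    show "\<exists>t :: 'g \<Rightarrow> 'h. \<exists>b' :: 'a \<Rightarrow> 'b.
               is_group_hom t \<and> inj t \<and>
               b' ` loc_set S A \<sigma> \<subseteq> loc_set T B \<tau> \<and>
               (\<forall>x\<in>loc_set S A \<sigma>. \<forall>y\<in>loc_set S A \<sigma>. b' (x + y) = b' x + b' y) \<and>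
               inj_on b' (loc_set S A \<sigma>) \<and>
               (\<forall>x\<in>loc_set S A \<sigma>. \<forall>s. b' (\<sigma> s x) = \<tau> (t s) (b' x))"
      by (rule integral_embedding[OF int loc])
  qed
qed

end
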